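(* Let $\mu_0=\mu_0(S_1,\ldots,S_m;\rho_1,\ldots,\rho_m)$ be a self-similar measure on $[0,1]$, let $g:[0,1]\to[0,1]$ be a $W^1_\infty$ diffeomorphism, and let $\mu=\mu_0\circ g$ be the corresponding deformed self-similar measure. Then $$N(\lambda,\mu)\asymp N(\lambda,\mu_0),$$ i.e. there exist constants $C_1,C_2>0$ such that for all $\lambda\ge0$ $$C_1N(\lambda,\mu_0)\le N(\lambda,\mu)\le C_2N(\lambda,\mu_0).$$
   Context: Self-similar measure: $m\ge2$; $S_i:[0,1]\to I_i$ ($i=1,\dots,m$) are affine contractions of $[0,1]$ onto nondegenerate subsegments $I_i\subset[0,1]$ which pairwise have no common interior points, with $\sum_{i=1}^m|I_i|<1$ (orientation-reversing $S_i$ are allowed); $\rho_i>0$ with $\sum_{i=1}^m\rho_i=1$. Then $\mu_0=\mu_0(S_1,\ldots,S_m;\rho_1,\ldots,\rho_m)$ is the unique Borel probability measure on $[0,1]$ with $\mu_0(E)=\sum_{i=1}^m\rho_i\,\mu_0(S_i^{-1}(E))$ for all measurable $E$ (it has no atoms). A $W^1_\infty$ diffeomorphism of $[0,1]$ is a bijection $g:[0,1]\to[0,1]$ such that both $g$ and $g^{-1}$ belong to $W^1_\infty[0,1]$ (i.e. are Lipschitz). The deformed self-similar measure $\mu=\mu_0\circ g$ is defined by $\mu(E)=\mu_0(g(E))$ for every measurable $E$. Spectrum: for a finite atomless Borel measure $\mu$ on $[0,1]$ consider the Neumann problem $-y''=\lambda\mu y$, $y'(0)=y'(1)=0$. A number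 $\lambda$ is an eigenvalue if there is a nonzero $y\in W_2^1[0,1]$ with $\int_0^1y'\eta'\,dx=\lambda\int_0^1y\eta\,d\mu$ for all $\eta\in W_2^1[0,1]$. The eigenvalues are numbered in ascending order $\lambda_n(\mu)$, and $N(\lambda,\mu)=\#\{n:\lambda_n(\mu)<\lambda\}$. *)

theory Defs
  imports "HOL-Probability.Probability"
begin

abbreviation unit_borel :: "real measure" where
  "unit_borel \<equiv> restrict_space borel {0..1}"

definition similarity_system :: "nat \<Rightarrow> (nat \<Rightarrow> real \<Rightarrow> real) \<Rightarrow> (nat \<Rightarrow> real) \<Rightarrow> bool" where
  "similarity_system m S \<rho> \<longleftrightarrow>
     m \<ge> 2 \<and>
     (\<forall>i\<in>{1..m}. \<exists>a b. a \<noteq> 0 \<and> \<bar>a\<bar> < 1 \<and> (\<forall>x\<in>{0..1}. S i x = a * x + b)) \<and>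
     (\<forall>i\<in>{1..m}. S i ` {0..1} \<subseteq> {0..1}) \<and>
     (\<forall>i\<in>{1..m}. \<forall>j\<in>{1..m}. i \<noteq> j \<longrightarrow>
        interior (S i ` {0..1}) \<inter> interior (S j ` {0..1}) = {}) \<and>
     (\<Sum>i=1..m. measure lborel (S i ` {0..1})) < 1 \<and>
     (\<forall>i\<in>{1..m}. \<rho> i > 0) \<and> (\<Sum>i=1..m. \<rho> i) = 1"

definition self_similar_measure ::
    "nat \<Rightarrow> (nat \<Rightarrow> real \<Rightarrow> real) \<Rightarrow> (nat \<Rightarrow> real) \<Rightarrow> real measure \<Rightarrow> bool" where
  "self_similar_measure m S \<rho> M \<longleftrightarrow>
     prob_space M \<and> sets M = sets unit_borel \<and>
     (\<forall>E\<in>sets M. measure M E = (\<Sum>i=1..m. \<rho> i * measure M (S i -` E \<inter> {0..1})))"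

definition W1inf_diffeo :: "(real \<Rightarrow> real) \<Rightarrow> bool" where
  "W1inf_diffeo g \<longleftrightarrow>
     bij_betw g {0..1} {0..1} \<and>
     (\<exists>C. C-lipschitz_on {0..1} g) \<and>
     (\<exists>C. C-lipschitz_on {0..1} (inv_into {0..1} g))"

definition deformed_measure :: "real measure \<Rightarrow> (real \<Rightarrow> real) \<Rightarrow> real measure" where
  "deformed_measure M g = measure_of {0..1} (sets unit_borel) (\<lambda>E. emeasure M (g ` E))"

(* measure_of yields the null measure when the given set function is not a measure;
   the following shows that this does not happen here. *)
lemma emeasure_deformed_measure:
  assumes g: "W1inf_diffeo g" and M: "sets M = sets unit_borel"
    and E: "E \<in> sets unit_borel"
  shows "emeasure (deformed_measure M g) E = emeasure M (g ` E)"
proof -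
  have bij: "bij_betw g {0..1} {0..1}" using g by (simp add: W1inf_diffeo_def)
  have sub: "A \<subseteq> {0..1}" if "A \<in> sets unit_borel" for A
    using that sets.sets_into_space[of A unit_borel] by (simp add: space_restrict_space)
  have "continuous_on {0..1} (inv_into {0..1} g)"
    using g lipschitz_on_continuous_on unfolding W1inf_diffeo_def by blast
  then have "inv_into {0..1} g \<in> borel_measurable unit_borel"
    by (rule borel_measurable_continuous_on_restrict)
  moreover have "inv_into {0..1} g \<in> {0..1} \<rightarrow> {0..1}"
    using bij_betw_inv_into[OF bij] by (auto simp: bij_betw_def)
  ultimately have meas: "inv_into {0..1} g \<in> measurable unit_borel unit_borel"
    by (intro measurable_restrict_space2) (auto simp: space_restrict_space)
  have img: "g ` A = inv_into {0..1} g -` A \<inter> space unit_borel" if "A \<subseteq> {0..1}" for A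
  proof (intro equalityI subsetI)
    fix x assume "x \<in> g ` A"
    then obtain a where a: "a \<in> A" "x = g a" by blast
    then have "inv_into {0..1} g x = a"
      using that bij by (auto simp: bij_betw_def)
    moreover have "x \<in> {0..1}"
      using a that bij_betw_apply[OF bij] by blast
    ultimately show "x \<in> inv_into {0..1} g -` A \<inter> space unit_borel"
      using a by (simp add: space_restrict_space)
  next
    fix x assume x: "x \<in> inv_into {0..1} g -` A \<inter> space unit_borel"
    then have "g (inv_into {0..1} g x) = x"
      using bij_betw_inv_into_right[OF bij] by (simp add: space_restrict_space)
    with x show "x \<in> g ` A" by (metis IntD1 imageI vimageD)
  qed
  have im: "g ` A \<in> sets M" if "A \<in> sets unit_borel" for A
    unfolding M img[OF sub[OF that]] using meas that by (rule measurable_sets)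
  have "countably_additive (sets unit_borel) (\<lambda>E. emeasure M (g ` E))"
  proof (rule countably_additiveI)
    fix A :: "nat \<Rightarrow> real set"
    assume A: "range A \<subseteq> sets unit_borel" "disjoint_family A"
      "(\<Union>i. A i) \<in> sets unit_borel"
    have "A i \<subseteq> {0..1}" for i using A(1) sub by blast
    then have "disjoint_family (\<lambda>i. g ` A i)"
      using A(2) bij unfolding disjoint_family_on_def bij_betw_def
      by (metis UNIV_I image_empty inj_on_image_Int)
    then show "(\<Sum>i. emeasure M (g ` A i)) = emeasure M (g ` (\<Union>i. A i))"
      using A(1) im by (subst image_UN) (intro suminf_emeasure, auto)
  qed
  moreover have "sigma_algebra {0..1} (sets unit_borel)"
    using sets.sigma_algebra_axioms[of unit_borel] by (simp add: space_restrict_space)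
  ultimately show ?thesis
    using E unfolding deformed_measure_def
    by (subst emeasure_measure_of_sigma) (auto simp: positive_def)
qed

(* Functions on [0,1] are total functions whose values outside [0,1] are irrelevant. *)

definition L2_unit :: "(real \<Rightarrow> real) \<Rightarrow> bool" where
  "L2_unit f \<longleftrightarrow>
     set_borel_measurable lborel {0..1} f \<and> set_integrable lborel {0..1} (\<lambda>x. (f x)\<^sup>2)"

(* y is the continuous representative of an element of the Sobolev space W^1_2[0,1],
   i.e. y is absolutely continuous with a square integrable derivative y' = d.
   The continuous representative is needed in order to integrate y against a measure
   that may be singular. *)
definition W12_unit :: "(real \<Rightarrow> real) \<Rightarrow> (real \<Rightarrow> real) \<Rightarrow> bool" where
  "W12_unit y d \<longleftrightarrow>
     L2_unit d \<and> (\<forall>x\<in>{0..1}. y x = y 0 + (LINT t:{0..x}|lborel. d t))"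

definition neumann_eigenvalue :: "real measure \<Rightarrow> real \<Rightarrow> bool" where
  "neumann_eigenvalue M \<nu> \<longleftrightarrow>
     (\<exists>y y'. W12_unit y y' \<and> (\<exists>x\<in>{0..1}. y x \<noteq> 0) \<and>
        (\<forall>\<eta> \<eta>'. W12_unit \<eta> \<eta>' \<longrightarrow>
           (LINT x:{0..1}|lborel. y' x * \<eta>' x) = \<nu> * (LINT x|M. y x * \<eta> x)))"

(* The number of eigenvalues below \<lambda>, ennreal-valued since finiteness is a theorem
   and card would count an infinite set as 0.  No multiplicities are needed: a solution of
   the second-order problem is determined by its value at 0, since y'(0) = 0. *)
definition eigenvalue_count :: "real \<Rightarrow> real measure \<Rightarrow> ennreal" where
  "eigenvalue_count l M = emeasure (count_space UNIV) {\<nu>. neumann_eigenvalue M \<nu> \<and> \<nu> < l}"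

end

theory Submission
  imports Defs
begin

text \<open>Distorting a self-similar measure by a bi-Lipschitz map changes lengths and masses of
  cylinder intervals only by bounded factors, so it suffices to bound the eigenvalue count from
  both sides by a quantity that depends only on lengths and masses of cylinders: the number
  \<open>c(\<epsilon>)\<close> of words that are the first among their prefixes with length times mass at most
  \<open>\<epsilon>\<close>. This number grows by a bounded factor when \<open>\<epsilon>\<close> is divided by a constant.

  Upper bound: if there were more eigenvalues below \<open>l\<close> than cylinders, some nonzero combination
  \<open>y\<close> of eigenfunctions would vanish at the left end of every cylinder \<open>J\<close>. Cauchy--Schwarz then
  gives \<open>l\<integral>\<^sub>J y\<^sup>2 d\<mu> \<le> l|J|\<mu>(J) \<integral>\<^sub>J y'\<^sup>2 \<le> \<integral>\<^sub>J y'\<^sup>2\<close>, while orthogonality of the eigenfunctions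
  gives \<open>\<integral>y'\<^sup>2 < l\<integral>y\<^sup>2 d\<mu>\<close>.

  Lower bound: let \<open>u(x, l)\<close> solve \<open>u'' = -l\<mu>u\<close>, \<open>u(0) = 1\<close>, \<open>u'(0) = 0\<close>. Since a positive
  solution is concave, \<open>u(\<cdot>, l)\<close> has a zero in every cylinder with \<open>l|J|\<mu>(J)\<close> large. The angle
  of \<open>u' + iu\<close> gains at least \<open>\<pi>\<close> at every zero, and it is continuous in \<open>l\<close>; as \<open>l\<close> grows from
  \<open>0\<close>, the angle at \<open>x = 1\<close> therefore passes through all the values where \<open>u'(1, l) = 0\<close>, and each of
  these passages is an eigenvalue. No spectral theorem is needed.\<close>

section \<open>Upper bound for the number of eigenvalues\<close>

text \<open>An eigenvalue is defined by testing against all Sobolev functions, so nothing is known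
  in advance about how many there are. Hence the upper bound treats an arbitrary finite set of
  eigenvalues, and the lower bound constructs eigenvalues one by one.

  The two bounds ask for different things. The upper one involves the whole mass of a cylinder, but
  a zero is forced only by mass that stays away from its end points. Self-similarity supplies such
  mass: since end points carry none, some \<theta> has at least half of the mass in
  [\<theta>, 1 - \<theta>], and the word maps copy this proportion into every cylinder. Absence of
  atoms is not part of the definition of the measure; it is derived by following an atom of maximal
  mass.

  With G the inverse of g, the G-image of a cylinder has the same \<mu>-mass as the cylinder has
  \<mu>0-mass, and its length changes by a factor between 1/L and L. Below threshold 1, cutting at
  \<epsilon> leaves weights between \<epsilon> times the least letter weight and \<epsilon>. So both
  counts are squeezed between the cut counts at thresholds A/l and B/l, with B/A independent of
  l.\<close>

lemma homogeneous_system_nontrivial: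
  fixes A :: "'i \<Rightarrow> 'k \<Rightarrow> real"
  assumes "finite I" "finite E" "card I < card E"
  shows "\<exists>c. (\<exists>k\<in>E. c k \<noteq> 0) \<and> (\<forall>i\<in>I. (\<Sum>k\<in>E. c k * A i k) = 0)"
  using assms
proof (induction I arbitrary: A E rule: finite_induct)
  case empty
  then have "E \<noteq> {}" by auto
  then show ?case by (intro exI[of _ "\<lambda>_. 1"]) auto
next
  case (insert j I)
  show ?case
  proof (cases "\<forall>k\<in>E. A j k = 0")
    case True
    obtain c where "\<exists>k\<in>E. c k \<noteq> 0" "\<forall>i\<in>I. (\<Sum>k\<in>E. c k * A i k) = 0"
      using insert.IH[OF insert.prems(1), of A] insert.prems insert.hyps by auto
    with True show ?thesis by (intro exI[of _ c]) auto
  next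
    case False
    \<comment> \<open>Gaussian elimination: row \<open>j\<close> is solved for the unknown
      \<open>k0\<close>, and \<open>B\<close> holds the remaining rows after substitution. Equations
      and unknowns both drop by one.\<close>
    then obtain k0 where k0: "k0 \<in> E" "A j k0 \<noteq> 0" by blast
    define B where "B i k = A i k - A j k / A j k0 * A i k0" for i k
    have "card I < card (E - {k0})"
      using insert.prems insert.hyps k0 by auto
    then obtain c where c: "\<exists>k\<in>E-{k0}. c k \<noteq> 0" "\<forall>i\<in>I. (\<Sum>k\<in>E-{k0}. c k * B i k) = 0"
      using insert.IH[of "E-{k0}" B] insert.prems by auto
    define c' where "c' = c(k0 := - (\<Sum>k\<in>E-{k0}. c k * A j k) / A j k0)"
    have S: "(\<Sum>k\<in>E. c' k * A i k) =
        (\<Sum>k\<in>E-{k0}. c k * A i k) - (\<Sum>k\<in>E-{k0}. c k * A j k) / A j k0 * A i k0" for i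
      using k0 insert.prems by (subst sum.remove[of _ k0]) (auto simp: c'_def)
    have "(\<Sum>k\<in>E-{k0}. c k * B i k) = (\<Sum>k\<in>E. c' k * A i k)" for i
      unfolding S by (simp add: B_def algebra_simps sum_subtractf sum_distrib_left sum_divide_distrib)
    moreover have "(\<Sum>k\<in>E. c' k * A j k) = 0"
      unfolding S using k0 by simp
    moreover have "\<exists>k\<in>E. c' k \<noteq> 0"
      using c(1) by (auto simp: c'_def)
    ultimately show ?thesis
      using c(2) by (intro exI[of _ c']) auto
  qed
qed

section \<open>Square integrable functions and Sobolev functions on the unit interval\<close>

lemma L2_unit_mult_measurable:
  assumes "L2_unit a" "L2_unit b"
  shows "set_borel_measurable lborel {0..1} (\<lambda>x. a x * b x)"
proof -
  have "(\<lambda>x. (indicator {0..1} x *\<^sub>R a x) * (indicator {0..1} x *\<^sub>R b x)) \<in> borel_measurable lborel"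
    using assms unfolding L2_unit_def set_borel_measurable_def by (intro borel_measurable_times) auto
  also have "(\<lambda>x. (indicator {0..1} x *\<^sub>R a x) * (indicator {0..1} x *\<^sub>R b x)) =
      (\<lambda>x. indicator {0..1} x *\<^sub>R (a x * b x))"
    by (auto simp: indicator_def)
  finally show ?thesis unfolding set_borel_measurable_def .
qed

lemma L2_unit_mult:
  assumes "L2_unit a" "L2_unit b"
  shows "set_integrable lborel {0..1} (\<lambda>x. a x * b x)"
proof (rule set_integrable_bound)
  show "set_integrable lborel {0..1} (\<lambda>x. (a x)\<^sup>2 + (b x)\<^sup>2)"
    using assms by (intro set_integral_add) (auto simp: L2_unit_def)
  have "\<bar>p * q\<bar> \<le> p\<^sup>2 + q\<^sup>2" for p q :: real
  proof -
    have "0 \<le> (p + q)\<^sup>2" "0 \<le> (p - q)\<^sup>2" by simp_all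
    moreover have "0 \<le> p\<^sup>2 + q\<^sup>2" by simp
    ultimately show ?thesis unfolding power2_sum power2_diff by linarith
  qed
  then show "AE x in lborel. x \<in> {0..1} \<longrightarrow> norm (a x * b x) \<le> norm ((a x)\<^sup>2 + (b x)\<^sup>2)"
    by (simp add: abs_mult)
qed (use L2_unit_mult_measurable[OF assms] in auto)

lemma L2_unit_const: "L2_unit (\<lambda>_. c)"
  unfolding L2_unit_def set_borel_measurable_def set_integrable_def by simp

lemma L2_unit_integrable:
  assumes "L2_unit a" shows "set_integrable lborel {0..1} a"
  using L2_unit_mult[OF assms L2_unit_const[of 1]] by simp

lemma L2_unit_add:
  assumes "L2_unit a" "L2_unit b" shows "L2_unit (\<lambda>x. a x + b x)"
  unfolding L2_unit_def
proof
  have "(\<lambda>x. indicator {0..1} x *\<^sub>R a x + indicator {0..1} x *\<^sub>R b x) \<in> borel_measurable lborel"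
    using assms unfolding L2_unit_def set_borel_measurable_def by (intro borel_measurable_add) auto
  then show "set_borel_measurable lborel {0..1} (\<lambda>x. a x + b x)"
    unfolding set_borel_measurable_def scaleR_add_right .
  have "set_integrable lborel {0..1} (\<lambda>x. (a x * a x + 2 * (a x * b x)) + b x * b x)"
    using assms by (intro set_integral_add set_integrable_mult_right L2_unit_mult)
  then show "set_integrable lborel {0..1} (\<lambda>x. (a x + b x)\<^sup>2)"
    by (simp add: power2_eq_square algebra_simps)
qed

lemma L2_unit_cmult:
  assumes "L2_unit a" shows "L2_unit (\<lambda>x. c * a x)"
  using L2_unit_mult_measurable[OF L2_unit_const assms, of c] assms
  by (auto simp: L2_unit_def power_mult_distrib intro: set_integrable_mult_right)

lemma L2_unit_sum:
  assumes "finite E" "\<And>k. k \<in> E \<Longrightarrow> L2_unit (d k)"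
  shows "L2_unit (\<lambda>x. \<Sum>k\<in>E. c k * d k x)"
  using assms
  by (induction E rule: finite_induct) (auto intro!: L2_unit_add L2_unit_cmult L2_unit_const)

lemma L2_unit_subinterval:
  assumes "L2_unit d" "0 \<le> a" "b \<le> 1"
  shows "set_integrable lborel {a..b} d" "set_integrable lborel {a..b} (\<lambda>x. (d x)\<^sup>2)"
  using L2_unit_integrable[OF assms(1)] assms
  by (auto simp: L2_unit_def intro: set_integrable_subset)

text \<open>Cauchy-Schwarz against the constant 1: subtract from \<open>d\<close> its mean
  \<open>c\<close> and expand the nonnegative integral of the square.\<close>

lemma set_integral_power2_le:
  assumes "L2_unit d" "0 \<le> a" "a \<le> b" "b \<le> 1"
  shows "(LINT t:{a..b}|lborel. d t)\<^sup>2 \<le> (b - a) * (LINT t:{a..b}|lborel. (d t)\<^sup>2)"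
proof (cases "a = b")
  case True
  have "(LINT t:{b}|lborel. d t) = 0"
    by (simp add: set_borel_integral_eq_integral)
  then show ?thesis using True by simp
next
  case False
  define I Q c where "I = (LINT t:{a..b}|lborel. d t)" and "Q = (LINT t:{a..b}|lborel. (d t)\<^sup>2)"
    and "c = I / (b - a)"
  note ints = L2_unit_subinterval[OF assms(1,2,4)]
  have [simp]: "set_integrable lborel {a..b} (\<lambda>x. k)" for k :: real
    using borel_integrable_compact[of "{a..b}" "\<lambda>_. k"]
    unfolding set_integrable_def by (simp add: if_distrib indicator_def cong: if_cong)
  have "0 \<le> (LINT t:{a..b}|lborel. (d t - c)\<^sup>2)"
    unfolding set_lebesgue_integral_def by (intro integral_nonneg_AE) auto
  also have "\<dots> = (LINT t:{a..b}|lborel. ((d t)\<^sup>2 - (2 * c) * d t) + c\<^sup>2)"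
    by (simp add: power2_diff algebra_simps)
  also have "\<dots> = Q - 2 * c * I + (b - a) * c\<^sup>2"
    using ints assms(3) unfolding Q_def I_def
    by (simp add: set_integral_add set_integral_diff set_integral_const)
  also have "\<dots> = Q - I\<^sup>2 / (b - a)"
    using False by (simp add: c_def power2_eq_square divide_simps)
  finally show ?thesis
    using False assms(3) by (simp add: I_def Q_def divide_simps mult.commute)
qed

lemma W12_unitD:
  assumes "W12_unit y d"
  shows "L2_unit d" "\<And>x. x \<in> {0..1} \<Longrightarrow> y x = y 0 + (LINT t:{0..x}|lborel. d t)"
  using assms unfolding W12_unit_def by blast+

lemma W12_unit_diff:
  assumes "W12_unit y d" "0 \<le> a" "a \<le> b" "b \<le> 1"
  shows "y b - y a = (LINT t:{a..b}|lborel. d t)"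
proof -
  note d = W12_unitD(1)[OF assms(1)] and y = W12_unitD(2)[OF assms(1)]
  have eq: "(LINT t:{p..q}|lborel. d t) = integral {p..q} d" if "0 \<le> p" "q \<le> 1" for p q
    by (rule set_borel_integral_eq_integral(2)[OF L2_unit_subinterval(1)[OF d that]])
  have "d integrable_on {0..b}"
    using set_borel_integral_eq_integral(1)[OF L2_unit_subinterval(1)[OF d order_refl assms(4)]] .
  then have "integral {0..a} d + integral {a..b} d = integral {0..b} d"
    using assms by (intro Henstock_Kurzweil_Integration.integral_combine) auto
  moreover have "y a = y 0 + integral {0..a} d" "y b = y 0 + integral {0..b} d"
    using y[of a] y[of b] assms by (simp_all add: eq)
  ultimately show ?thesis using assms by (simp add: eq)
qed

lemma W12_unit_continuous:
  assumes "W12_unit y d" shows "continuous_on {0..1} y"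
proof -
  note d = W12_unitD(1)[OF assms(1)] and y = W12_unitD(2)[OF assms(1)]
  have "y x = y 0 + integral {0..x} d" if "x \<in> {0..1}" for x
    using y[OF that] set_borel_integral_eq_integral(2)[OF L2_unit_subinterval(1)[OF d, of 0 x]] that by simp
  then have "continuous_on {0..1} y \<longleftrightarrow> continuous_on {0..1} (\<lambda>x. y 0 + integral {0..x} d)"
    by (rule continuous_on_cong[OF refl])
  also have \<dots>
    using set_borel_integral_eq_integral(1)[OF L2_unit_integrable[OF d]]
    by (intro continuous_intros indefinite_integral_continuous_1)
  finally show ?thesis .
qed

lemma W12_unit_sum:
  assumes "finite E" "\<And>k. k \<in> E \<Longrightarrow> W12_unit (y k) (d k)"
  shows "W12_unit (\<lambda>x. \<Sum>k\<in>E. c k * y k x) (\<lambda>x. \<Sum>k\<in>E. c k * d k x)"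
  unfolding W12_unit_def
proof (intro conjI ballI)
  show "L2_unit (\<lambda>x. \<Sum>k\<in>E. c k * d k x)"
    using assms by (intro L2_unit_sum) (auto simp: W12_unit_def)
next
  fix x :: real assume x: "x \<in> {0..1}"
  have int: "set_integrable lborel {0..x} (d k)" if "k \<in> E" for k
    using x assms(2)[OF that] by (intro L2_unit_subinterval) (auto simp: W12_unit_def)
  have "(LINT t:{0..x}|lborel. (\<Sum>k\<in>E. c k * d k t)) = (\<Sum>k\<in>E. c k * (LINT t:{0..x}|lborel. d k t))"
    using int unfolding set_lebesgue_integral_def set_integrable_def
    by (simp add: sum_distrib_left mult.left_commute)
  moreover have "(\<Sum>k\<in>E. c k * y k x) = (\<Sum>k\<in>E. c k * (y k 0 + (LINT t:{0..x}|lborel. d k t)))"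
  proof (rule sum.cong[OF refl])
    fix k assume "k \<in> E"
    show "c k * y k x = c k * (y k 0 + (LINT t:{0..x}|lborel. d k t))"
      using W12_unitD(2)[OF assms(2)[OF \<open>k \<in> E\<close>] x] by simp
  qed
  ultimately show "(\<Sum>k\<in>E. c k * y k x) = (\<Sum>k\<in>E. c k * y k 0) + (LINT t:{0..x}|lborel. (\<Sum>k\<in>E. c k * d k t))"
    by (simp add: distrib_left sum.distrib)
qed

section \<open>The Neumann problem for a probability measure on the unit interval\<close>

locale unit_prob_space = prob_space M for M :: "real measure" +
  assumes sets_unit: "sets M = sets unit_borel"
begin

lemma space_unit: "space M = {0..1}"
  using sets_eq_imp_space_eq[OF sets_unit] by (simp add: space_restrict_space)

lemma interval_sets: "0 \<le> a \<Longrightarrow> b \<le> 1 \<Longrightarrow> {a..b} \<in> sets M"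
  unfolding sets_unit by (auto simp: sets_restrict_space)

lemma continuous_measurable:
  "continuous_on {0..1} f \<Longrightarrow> f \<in> borel_measurable M" for f :: "real \<Rightarrow> real"
  using borel_measurable_continuous_on_restrict measurable_cong_sets[OF sets_unit refl] by blast

lemma continuous_integrable:
  fixes f :: "real \<Rightarrow> real"
  assumes "continuous_on {0..1} f" shows "integrable M f"
proof -
  have "compact (f ` {0..1})" using assms by (intro compact_continuous_image) auto
  then obtain B where "\<And>x. x \<in> {0..1} \<Longrightarrow> norm (f x) \<le> B"
    using compact_imp_bounded bounded_iff by (metis imageI)
  then show ?thesis
    using space_unit by (intro integrable_const_bound[of _ B] continuous_measurable assms AE_I2) auto
qed

lemma W12_mult_integrable:
  assumes "W12_unit y d" "W12_unit z e" shows "integrable M (\<lambda>x. y x * z x)"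
  using assms by (intro continuous_integrable continuous_intros) (auto dest: W12_unit_continuous)

lemma W12_energy_zero:
  assumes y: "W12_unit y d" and "x \<in> {0..1}" "y x \<noteq> 0"
  shows "(LINT x:{0..1}|lborel. d x * d x) \<ge> 0"
    and "(LINT x:{0..1}|lborel. d x * d x) = 0 \<Longrightarrow> (LINT x|M. y x * y x) > 0"
proof -
  let ?Q = "LINT x:{0..1}|lborel. d x * d x"
  note d = W12_unitD(1)[OF y]
  show nn: "?Q \<ge> 0"
    unfolding set_lebesgue_integral_def by (intro integral_nonneg_AE) auto
  assume Q: "?Q = 0"
  have sub: "(LINT t:{0..z}|lborel. (d t)\<^sup>2) \<le> ?Q" if "z \<in> {0..1}" for z
    using that L2_unit_subinterval[OF d, of 0 z] L2_unit_subinterval[OF d, of 0 1]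
    unfolding set_lebesgue_integral_def set_integrable_def
    by (intro integral_mono) (auto simp: power2_eq_square indicator_def)
  have "(LINT t:{0..z}|lborel. d t) = 0" if "z \<in> {0..1}" for z
  proof -
    have "(LINT t:{0..z}|lborel. d t)\<^sup>2 \<le> z * (LINT t:{0..z}|lborel. (d t)\<^sup>2)"
      using set_integral_power2_le[OF d, of 0 z] that by simp
    also have "\<dots> \<le> 0"
      using sub[OF that] Q that by (simp add: mult_nonneg_nonpos)
    finally show ?thesis by simp
  qed
  then have yc: "y z = y 0" if "z \<in> {0..1}" for z
    using W12_unitD(2)[OF y that] \<open>\<And>z. z \<in> {0..1} \<Longrightarrow> (LINT t:{0..z}|lborel. d t) = 0\<close>[OF that] that by simp
  have "(LINT x|M. y x * y x) = (LINT x|M. y 0 * y 0)"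
    by (rule Bochner_Integration.integral_cong[OF refl]) (metis yc space_unit)
  also have "\<dots> = y 0 * y 0" by (simp add: prob_space)
  finally show "(LINT x|M. y x * y x) > 0"
    using assms(2,3) yc[OF assms(2)] by (auto simp: zero_less_mult_iff linorder_neq_iff)
qed

text \<open>An eigenfunction is only assumed nonzero somewhere in [0,1], possibly in a gap of
  \<open>M\<close>. If its \<open>M\<close>-norm were zero, testing the equation with
  \<open>y\<close> itself would give zero energy, so \<open>y\<close> would be a nonzero constant,
  whose norm is positive.\<close>

lemma eigenfunction_norm_pos:
  assumes y: "W12_unit y d" and "x \<in> {0..1}" "y x \<noteq> 0"
    and eq: "\<And>\<eta> \<eta>'. W12_unit \<eta> \<eta>' \<Longrightarrow>
      (LINT x:{0..1}|lborel. d x * \<eta>' x) = \<nu> * (LINT x|M. y x * \<eta> x)"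
  shows "(LINT x|M. y x * y x) > 0" "\<nu> \<ge> 0"
proof -
  have nn: "(LINT x|M. y x * y x) \<ge> 0" by (intro integral_nonneg_AE) auto
  note z = W12_energy_zero[OF y assms(2,3)]
  show pos: "(LINT x|M. y x * y x) > 0"
  proof (cases "(LINT x|M. y x * y x) = 0")
    case True
    then show ?thesis using z(2) eq[OF y] by simp
  next
    case False
    then show ?thesis using nn by linarith
  qed
  show "\<nu> \<ge> 0" using pos z(1) eq[OF y] by (simp add: zero_le_mult_iff)
qed

lemma neumann_eigenvalue_nonneg: "neumann_eigenvalue M \<nu> \<Longrightarrow> \<nu> \<ge> 0"
  unfolding neumann_eigenvalue_def using eigenfunction_norm_pos(2) by blast

text \<open>The eigenfunctions are the constants. This eigenvalue alone gives the lower bound for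
  small \<open>l\<close>, where the cut set consists of the empty word.\<close>

lemma neumann_eigenvalue_0: "neumann_eigenvalue M 0"
  unfolding neumann_eigenvalue_def
  by (intro exI[of _ "\<lambda>_. 1"] exI[of _ "\<lambda>_. 0"])
     (auto simp: W12_unit_def L2_unit_const set_lebesgue_integral_def intro!: bexI[of _ 0])

text \<open>Settles \<open>l = 0\<close>, where thresholds of the form \<open>A / l\<close> say
  nothing.\<close>

lemma eigenvalue_count_0: "eigenvalue_count 0 M = 0"
proof -
  have "{\<nu>. neumann_eigenvalue M \<nu> \<and> \<nu> < 0} = {}"
    using neumann_eigenvalue_nonneg by force
  then show ?thesis unfolding eigenvalue_count_def by (metis emeasure_empty)
qed

lemma eigenvalue_count_ge_card:
  assumes "finite E" "\<And>\<nu>. \<nu> \<in> E \<Longrightarrow> neumann_eigenvalue M \<nu> \<and> \<nu> < l"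
  shows "of_nat (card E) \<le> eigenvalue_count l M"
proof -
  have "emeasure (count_space UNIV) E \<le> eigenvalue_count l M"
    unfolding eigenvalue_count_def using assms(2) by (intro emeasure_mono) auto
  then show ?thesis using assms(1) by simp
qed

lemma W12_vanishing_bound:
  assumes y: "W12_unit y d" and fin: "finite J"
    and J: "\<And>j. j \<in> J \<Longrightarrow> 0 \<le> a j \<and> a j \<le> b j \<and> b j \<le> 1"
    and disj: "disjoint_family_on (\<lambda>j. {a j<..<b j}) J"
    and cover: "prob (\<Union>j\<in>J. {a j..b j}) = 1"
    and small: "\<And>j. j \<in> J \<Longrightarrow> l * (b j - a j) * prob {a j..b j} \<le> 1"
    and l: "l > 0" and zero: "\<And>j. j \<in> J \<Longrightarrow> y (a j) = 0"
  shows "l * (LINT x|M. y x * y x) \<le> (LINT x:{0..1}|lborel. d x * d x)"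
proof -
  note d = W12_unitD(1)[OF y]
  define Q where "Q j = (LINT t:{a j..b j}|lborel. (d t)\<^sup>2)" for j
  have Q0: "Q j \<ge> 0" for j
    unfolding Q_def set_lebesgue_integral_def by (intro integral_nonneg_AE) auto
  have sq: "y x * y x \<le> (b j - a j) * Q j" if "j \<in> J" "x \<in> {a j..b j}" for j x
  proof -
    note * = J[OF that(1)]
    have "y x = (LINT t:{a j..x}|lborel. d t)"
      using W12_unit_diff[OF y, of "a j" x] zero[OF that(1)] * that(2) by auto
    then have "y x * y x \<le> (x - a j) * (LINT t:{a j..x}|lborel. (d t)\<^sup>2)"
      using set_integral_power2_le[OF d, of "a j" x] * that(2) by (simp add: power2_eq_square)
    also have "\<dots> \<le> (b j - a j) * Q j"
    proof (intro mult_mono)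
      show "(LINT t:{a j..x}|lborel. (d t)\<^sup>2) \<le> Q j"
        using that * L2_unit_subinterval[OF d, of "a j" x] L2_unit_subinterval[OF d, of "a j" "b j"]
        unfolding set_lebesgue_integral_def set_integrable_def Q_def
        by (intro integral_mono) (auto simp: indicator_def)
      show "0 \<le> (LINT t:{a j..x}|lborel. (d t)\<^sup>2)"
        unfolding set_lebesgue_integral_def by (intro integral_nonneg_AE) auto
    qed (use * that in auto)
    finally show ?thesis .
  qed
  have sets: "{a j..b j} \<in> sets M" if "j \<in> J" for j
    using J[OF that] by (intro interval_sets) auto
  have "AE x in M. x \<in> (\<Union>j\<in>J. {a j..b j})"
    using cover sets fin by (intro AE_prob_1) auto
  \<comment> \<open>The closed intervals may share end points, so the sum of the indicators is only
    an upper bound; it exceeds each single term, which is all that is needed.\<close>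
  then have "(LINT x|M. y x * y x) \<le> (LINT x|M. (\<Sum>j\<in>J. indicator {a j..b j} x * ((b j - a j) * Q j)))"
  proof (intro integral_mono_AE)
    show "AE x in M. y x * y x \<le> (\<Sum>j\<in>J. indicator {a j..b j} x * ((b j - a j) * Q j))"
      if "AE x in M. x \<in> (\<Union>j\<in>J. {a j..b j})"
      using that
    proof eventually_elim
      case (elim x)
      then obtain j where j: "j \<in> J" "x \<in> {a j..b j}" by auto
      have "y x * y x \<le> indicator {a j..b j} x * ((b j - a j) * Q j)"
        using sq[OF j] j by simp
      also have "\<dots> \<le> (\<Sum>j\<in>J. indicator {a j..b j} x * ((b j - a j) * Q j))"
        using fin j(1) Q0 J by (intro member_le_sum) auto
      finally show ?case .
    qed
  qed (use W12_mult_integrable[OF y y] sets in \<open>auto intro!: Bochner_Integration.integrable_sum integrable_mult_left simp: finite_measure_axioms emeasure_eq_measure\<close>)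
  also have "\<dots> = (\<Sum>j\<in>J. prob {a j..b j} * ((b j - a j) * Q j))"
    using sets by (subst Bochner_Integration.integral_sum) (auto intro!: sum.cong simp: emeasure_eq_measure space_unit Int_absorb1 dest: J)
  finally have "l * (LINT x|M. y x * y x) \<le> (\<Sum>j\<in>J. (l * (b j - a j) * prob {a j..b j}) * Q j)"
    using l by (subst (asm) mult_le_cancel_left_pos[symmetric, of l])
      (auto simp: sum_distrib_left algebra_simps)
  also have "\<dots> \<le> (\<Sum>j\<in>J. 1 * Q j)"
    using small Q0 by (intro sum_mono mult_right_mono) auto
  \<comment> \<open>The energies have to add up to at most the total energy. Dropping the end
    points, which are Lebesgue null, makes the intervals disjoint.\<close>
  also have "\<dots> = (\<Sum>j\<in>J. LINT t|lborel. indicator {a j<..<b j} t * (d t)\<^sup>2)"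
  proof (intro sum.cong refl)
    fix j assume "j \<in> J"
    have "AE t in lborel. t \<noteq> a j \<and> t \<noteq> b j"
      by (auto intro!: AE_conjI AE_lborel_singleton)
    then have "AE t in lborel. indicator {a j..b j} t * (d t)\<^sup>2 = indicator {a j<..<b j} t * (d t)\<^sup>2"
      by eventually_elim (auto simp: indicator_def)
    moreover have "(\<lambda>t. indicator {a j..b j} t * (d t)\<^sup>2) \<in> borel_measurable lborel"
      using L2_unit_subinterval(2)[OF d, of "a j" "b j"] J[OF \<open>j \<in> J\<close>]
      unfolding set_integrable_def by auto
    moreover have "(\<lambda>t. indicator {a j<..<b j} t * (indicator {a j..b j} t * (d t)\<^sup>2)) \<in> borel_measurable lborel"
      by (rule borel_measurable_times[OF borel_measurable_indicator calculation(2)]) simp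
    moreover have "(\<lambda>t. indicator {a j<..<b j} t * (indicator {a j..b j} t * (d t)\<^sup>2)) = (\<lambda>t. indicator {a j<..<b j} t * (d t)\<^sup>2)"
      by (auto simp: indicator_def)
    ultimately show "1 * Q j = (LINT t|lborel. indicator {a j<..<b j} t * (d t)\<^sup>2)"
      unfolding Q_def set_lebesgue_integral_def by (auto intro!: integral_cong_AE)
  qed
  also have "\<dots> = (LINT t|lborel. (\<Sum>j\<in>J. indicator {a j<..<b j} t * (d t)\<^sup>2))"
  proof (rule Bochner_Integration.integral_sum[symmetric])
    fix j assume "j \<in> J"
    then have "set_integrable lborel {a j<..<b j} (\<lambda>t. (d t)\<^sup>2)"
      using L2_unit_subinterval(2)[OF d, of "a j" "b j"] J[OF \<open>j \<in> J\<close>]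
      by (auto intro: set_integrable_subset)
    then show "integrable lborel (\<lambda>t. indicator {a j<..<b j} t * (d t)\<^sup>2)"
      by (simp add: set_integrable_def)
  qed
  also have "\<dots> \<le> (LINT t|lborel. indicator {0..1} t * (d t)\<^sup>2)"
  proof (rule integral_mono)
    show "integrable lborel (\<lambda>t. \<Sum>j\<in>J. indicator {a j<..<b j} t * (d t)\<^sup>2)"
    proof (intro Bochner_Integration.integrable_sum)
      fix j assume "j \<in> J"
      then have "set_integrable lborel {a j<..<b j} (\<lambda>t. (d t)\<^sup>2)"
        using L2_unit_subinterval(2)[OF d, of "a j" "b j"] J[OF \<open>j \<in> J\<close>]
        by (auto intro: set_integrable_subset)
      then show "integrable lborel (\<lambda>t. indicator {a j<..<b j} t * (d t)\<^sup>2)"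
        by (simp add: set_integrable_def)
    qed
    show "integrable lborel (\<lambda>t. indicator {0..1} t * (d t)\<^sup>2)"
      using d by (simp add: L2_unit_def set_integrable_def)
    fix t
    have "(\<Sum>j\<in>J. indicator {a j<..<b j} t) = (indicator (\<Union>j\<in>J. {a j<..<b j}) t :: real)"
      by (rule indicator_UN_disjoint[OF fin disj, symmetric])
    also have "\<dots> \<le> indicator {0..1} t"
      using J by (fastforce simp: indicator_def)
    finally have "(\<Sum>j\<in>J. indicator {a j<..<b j} t) * (d t)\<^sup>2 \<le> indicator {0..1} t * (d t)\<^sup>2"
      by (intro mult_right_mono) auto
    then show "(\<Sum>j\<in>J. indicator {a j<..<b j} t * (d t)\<^sup>2) \<le> indicator {0..1} t * (d t)\<^sup>2"
      by (simp add: sum_distrib_right)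
  qed
  finally show ?thesis
    by (simp add: set_lebesgue_integral_def power2_eq_square)
qed

theorem eigenvalue_count_le_card:
  assumes fin: "finite J"
    and J: "\<And>j. j \<in> J \<Longrightarrow> 0 \<le> a j \<and> a j \<le> b j \<and> b j \<le> 1"
    and disj: "disjoint_family_on (\<lambda>j. {a j<..<b j}) J"
    and cover: "prob (\<Union>j\<in>J. {a j..b j}) = 1"
    and small: "\<And>j. j \<in> J \<Longrightarrow> l * (b j - a j) * prob {a j..b j} \<le> 1"
    and l: "l > 0"
  shows "eigenvalue_count l M \<le> of_nat (card J)"
proof -
  let ?N = "{\<nu>. neumann_eigenvalue M \<nu> \<and> \<nu> < l}"
  \<comment> \<open>Every finite subset is bounded first, because finiteness of \<open>?N\<close> is
    part of what has to be shown.\<close>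
  have bdd: "card E \<le> card J" if E: "E \<subseteq> ?N" "finite E" for E
  proof (rule ccontr)
    assume "\<not> card E \<le> card J"
    have "\<exists>y. \<forall>\<nu>\<in>E. \<exists>d. W12_unit (y \<nu>) d \<and> (\<exists>x\<in>{0..1}. y \<nu> x \<noteq> 0) \<and>
        (\<forall>\<eta> \<eta>'. W12_unit \<eta> \<eta>' \<longrightarrow>
           (LINT x:{0..1}|lborel. d x * \<eta>' x) = \<nu> * (LINT x|M. y \<nu> x * \<eta> x))"
      using E(1) unfolding neumann_eigenvalue_def by (intro bchoice) blast
    then obtain y where "\<forall>\<nu>\<in>E. \<exists>d. W12_unit (y \<nu>) d \<and> (\<exists>x\<in>{0..1}. y \<nu> x \<noteq> 0) \<and>
        (\<forall>\<eta> \<eta>'. W12_unit \<eta> \<eta>' \<longrightarrow>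
           (LINT x:{0..1}|lborel. d x * \<eta>' x) = \<nu> * (LINT x|M. y \<nu> x * \<eta> x))" ..
    from bchoice[OF this] obtain d where y: "\<And>\<nu>. \<nu> \<in> E \<Longrightarrow> W12_unit (y \<nu>) (d \<nu>)"
      and nz: "\<And>\<nu>. \<nu> \<in> E \<Longrightarrow> \<exists>x\<in>{0..1}. y \<nu> x \<noteq> 0"
      and eq: "\<And>\<nu> \<eta> \<eta>'. \<nu> \<in> E \<Longrightarrow> W12_unit \<eta> \<eta>' \<Longrightarrow>
         (LINT x:{0..1}|lborel. d \<nu> x * \<eta>' x) = \<nu> * (LINT x|M. y \<nu> x * \<eta> x)"
      by blast
    define n where "n \<nu> = (LINT x|M. y \<nu> x * y \<nu> x)" for \<nu>
    have npos: "n \<nu> > 0" if "\<nu> \<in> E" for \<nu>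
      using nz[OF that] eigenfunction_norm_pos(1)[OF y[OF that] _ _ eq[OF that]] unfolding n_def by blast
    have orth: "(LINT x|M. y \<nu> x * y \<kappa> x) = 0" if "\<nu> \<in> E" "\<kappa> \<in> E" "\<nu> \<noteq> \<kappa>" for \<nu> \<kappa>
    proof -
      have "(LINT x:{0..1}|lborel. d \<nu> x * d \<kappa> x) = (LINT x:{0..1}|lborel. d \<kappa> x * d \<nu> x)"
        "(LINT x|M. y \<nu> x * y \<kappa> x) = (LINT x|M. y \<kappa> x * y \<nu> x)"
        by (simp_all add: mult.commute)
      then have "\<nu> * (LINT x|M. y \<nu> x * y \<kappa> x) = \<kappa> * (LINT x|M. y \<nu> x * y \<kappa> x)"
        using eq[OF that(1) y[OF that(2)]] eq[OF that(2) y[OF that(1)]] by metis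
      then show ?thesis using that(3) by (metis mult_cancel_right)
    qed
    obtain c where c: "\<exists>\<nu>\<in>E. c \<nu> \<noteq> 0" "\<forall>j\<in>J. (\<Sum>\<nu>\<in>E. c \<nu> * y \<nu> (a j)) = 0"
      using homogeneous_system_nontrivial[OF fin E(2), of "\<lambda>j \<nu>. y \<nu> (a j)"] \<open>\<not> card E \<le> card J\<close>
      by auto
    define z where "z = (\<lambda>x. \<Sum>\<nu>\<in>E. c \<nu> * y \<nu> x)"
    define e where "e = (\<lambda>x. \<Sum>\<nu>\<in>E. c \<nu> * d \<nu> x)"
    have z: "W12_unit z e" unfolding z_def e_def using E(2) y by (rule W12_unit_sum)
    have yz: "(LINT x|M. y \<nu> x * z x) = c \<nu> * n \<nu>" if "\<nu> \<in> E" for \<nu>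
    proof -
      have "(LINT x|M. y \<nu> x * z x) = (LINT x|M. (\<Sum>\<kappa>\<in>E. c \<kappa> * (y \<nu> x * y \<kappa> x)))"
        unfolding z_def by (simp add: sum_distrib_left mult.left_commute)
      also have "\<dots> = (\<Sum>\<kappa>\<in>E. c \<kappa> * (LINT x|M. y \<nu> x * y \<kappa> x))"
        using W12_mult_integrable[OF y[OF that] y]
        by (subst Bochner_Integration.integral_sum) auto
      also have "\<dots> = (\<Sum>\<kappa>\<in>E. if \<kappa> = \<nu> then c \<nu> * n \<nu> else 0)"
        using orth[OF that] by (intro sum.cong) (auto simp: n_def)
      finally show ?thesis using E(2) that by simp
    qed
    have "(LINT x|M. z x * z x) = (LINT x|M. (\<Sum>\<nu>\<in>E. c \<nu> * (y \<nu> x * z x)))"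
      by (subst (1) z_def) (simp add: sum_distrib_right mult.assoc)
    also have "\<dots> = (\<Sum>\<nu>\<in>E. c \<nu> * (c \<nu> * n \<nu>))"
      using W12_mult_integrable[OF y z] yz
      by (subst Bochner_Integration.integral_sum) auto
    finally have zz: "(LINT x|M. z x * z x) = (\<Sum>\<nu>\<in>E. c \<nu> * (c \<nu> * n \<nu>))" .
    have int: "integrable lborel (\<lambda>x. indicator {0..1} x * (d \<nu> x * e x))" if "\<nu> \<in> E" for \<nu>
      using L2_unit_mult[OF W12_unitD(1)[OF y[OF that]] W12_unitD(1)[OF z]]
      by (simp add: set_integrable_def)
    have "(LINT x:{0..1}|lborel. e x * e x) =
        (LINT x|lborel. (\<Sum>\<nu>\<in>E. c \<nu> * (indicator {0..1} x * (d \<nu> x * e x))))"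
      unfolding set_lebesgue_integral_def
      by (subst (1) e_def) (simp add: sum_distrib_right sum_distrib_left mult.assoc mult.left_commute)
    also have "\<dots> = (\<Sum>\<nu>\<in>E. c \<nu> * (LINT x:{0..1}|lborel. d \<nu> x * e x))"
      using int unfolding set_lebesgue_integral_def
      by (subst Bochner_Integration.integral_sum) auto
    also have "\<dots> = (\<Sum>\<nu>\<in>E. c \<nu> * (\<nu> * (c \<nu> * n \<nu>)))"
      using eq[OF _ z] yz by (intro sum.cong) auto
    \<comment> \<open>Strict because some coefficient is nonzero, its eigenfunction has positive
      norm, and its eigenvalue is strictly below \<open>l\<close>.\<close>
    also have "\<dots> < (\<Sum>\<nu>\<in>E. l * (c \<nu> * (c \<nu> * n \<nu>)))"
    proof (rule sum_strict_mono_ex1[OF E(2)])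
      have *: "c \<nu> * (\<nu> * (c \<nu> * n \<nu>)) = \<nu> * ((c \<nu>)\<^sup>2 * n \<nu>)"
        "l * (c \<nu> * (c \<nu> * n \<nu>)) = l * ((c \<nu>)\<^sup>2 * n \<nu>)" for \<nu>
        by (simp_all add: power2_eq_square algebra_simps)
      show "\<forall>\<nu>\<in>E. c \<nu> * (\<nu> * (c \<nu> * n \<nu>)) \<le> l * (c \<nu> * (c \<nu> * n \<nu>))"
        unfolding * using E(1) npos by (intro ballI mult_right_mono) (auto simp: less_imp_le)
      from c(1) obtain \<nu> where "\<nu> \<in> E" "c \<nu> \<noteq> 0" by blast
      then show "\<exists>\<nu>\<in>E. c \<nu> * (\<nu> * (c \<nu> * n \<nu>)) < l * (c \<nu> * (c \<nu> * n \<nu>))"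
        unfolding * using E(1) npos by (intro bexI[of _ \<nu>] mult_strict_right_mono) auto
    qed
    also have "\<dots> = l * (LINT x|M. z x * z x)"
      unfolding zz by (simp add: sum_distrib_left)
    also have "\<dots> \<le> (LINT x:{0..1}|lborel. e x * e x)"
      using c(2) by (intro W12_vanishing_bound[OF z fin J disj cover small l]) (auto simp: z_def)
    finally show False by simp
  qed
  then have "finite ?N" "card ?N \<le> card J"
    using finite_if_finite_subsets_card_bdd[of ?N "card J"] by blast+
  then show ?thesis unfolding eigenvalue_count_def by simp
qed

end

section \<open>Counting zeros by the angle\<close>

text \<open>A nonvanishing continuous complex function on a contractible set has a continuous
  logarithm; its imaginary part is the angle, jointly continuous in \<open>x\<close> and
  \<open>l\<close>. On the edges \<open>x = 0\<close> and \<open>l = 0\<close> the function is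
  constantly the imaginary unit, which ties together the angles at the two corners.\<close>

lemma polar_lift:
  fixes u v :: "real \<Rightarrow> real \<Rightarrow> real"
  assumes L: "L \<ge> 0"
    and cu: "continuous_on ({0..1} \<times> {0..L}) (\<lambda>(x, l). u x l)"
    and cv: "continuous_on ({0..1} \<times> {0..L}) (\<lambda>(x, l). v x l)"
    and nz: "\<And>x l. x \<in> {0..1} \<Longrightarrow> l \<in> {0..L} \<Longrightarrow> u x l \<noteq> 0 \<or> v x l \<noteq> 0"
    and init: "\<And>l. l \<in> {0..L} \<Longrightarrow> u 0 l = 1" "\<And>l. l \<in> {0..L} \<Longrightarrow> v 0 l = 0"
    and free: "\<And>x. x \<in> {0..1} \<Longrightarrow> u x 0 = 1" "\<And>x. x \<in> {0..1} \<Longrightarrow> v x 0 = 0"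
  obtains \<phi> R :: "real \<Rightarrow> real \<Rightarrow> real"
  where "continuous_on ({0..1} \<times> {0..L}) (\<lambda>(x, l). \<phi> x l)"
    "\<And>x l. R x l > 0"
    "\<And>x l. x \<in> {0..1} \<Longrightarrow> l \<in> {0..L} \<Longrightarrow> u x l = R x l * sin (\<phi> x l)"
    "\<And>x l. x \<in> {0..1} \<Longrightarrow> l \<in> {0..L} \<Longrightarrow> v x l = R x l * cos (\<phi> x l)"
    "\<phi> 0 L = pi / 2" "\<phi> 1 0 = pi / 2"
proof -
  let ?S = "{0..1::real} \<times> {0..L}"
  define f where "f = (\<lambda>p. Complex (v (fst p) (snd p)) (u (fst p) (snd p)))"
  have "continuous_on ?S f"
    using cu cv unfolding f_def case_prod_beta' by (intro continuous_on_Complex)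
  moreover have "contractible ?S"
    by (intro convex_imp_contractible convex_Times) auto
  moreover have "f p \<noteq> 0" if "p \<in> ?S" for p
    using nz[of "fst p" "snd p"] that by (auto simp: f_def Complex_eq_0)
  ultimately obtain h where h: "continuous_on ?S h" "\<And>p. p \<in> ?S \<Longrightarrow> f p = exp (h p)"
    using continuous_logarithm_on_contractible[of ?S f] by metis
  \<comment> \<open>Logarithms of the same number differ by multiples of 2 pi i, so a continuous one
    has discrete range and is constant on a connected set.\<close>
  have const: "h p = h q" if "connected T" "T \<subseteq> ?S" "p \<in> T" "q \<in> T" "\<And>t. t \<in> T \<Longrightarrow> f t = \<i>" for T p q
  proof -
    have "h constant_on T"
    proof (rule continuous_discrete_range_constant[OF that(1)])
      show "continuous_on T h" using h(1) that(2) by (rule continuous_on_subset)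
      fix x assume x: "x \<in> T"
      have "2 * pi \<le> norm (h y - h x)" if y: "y \<in> T" "h y \<noteq> h x" for y
      proof -
        have "exp (h y) = exp (h x)"
          using h(2) x y(1) \<open>T \<subseteq> ?S\<close> \<open>\<And>t. t \<in> T \<Longrightarrow> f t = \<i>\<close> by (metis subsetD)
        then obtain n :: int where n: "h y = h x + of_int (2 * n) * pi * \<i>"
          unfolding exp_eq by auto
        with y have "n \<noteq> 0" by auto
        then have "1 \<le> \<bar>real_of_int n\<bar>" by linarith
        then have "2 * pi * 1 \<le> 2 * pi * \<bar>real_of_int n\<bar>"
          by (intro mult_left_mono) auto
        also have "\<dots> = norm (h y - h x)"
          unfolding n by (simp add: norm_mult abs_mult)
        finally show ?thesis by simp
      qed
      then show "\<exists>e>0. \<forall>y. y \<in> T \<and> h y \<noteq> h x \<longrightarrow> e \<le> norm (h y - h x)"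
        by (intro exI[of _ "2 * pi"]) auto
    qed
    then show ?thesis using that(3,4) unfolding constant_on_def by metis
  qed
  have i: "Complex 0 1 = \<i>" by (simp add: complex_eq_iff)
  have h1: "h (0, L) = h (0, 0)"
    using L init by (intro const[of "{0} \<times> {0..L}"]) (auto intro!: connected_Times simp: f_def i)
  have h2: "h (1, 0) = h (0, 0)"
    using L free by (intro const[of "{0..1} \<times> {0}"]) (auto intro!: connected_Times simp: f_def i)
  define a where "a = Im (h (0, 0))"
  \<comment> \<open>The shift normalises the angle at the corner to pi/2. Since
    \<open>cos a = 0\<close> and \<open>sin a = 1\<close>, it is a multiple of 2 pi and changes
    neither sine nor cosine.\<close>
  define \<phi> where "\<phi> x l = Im (h (x, l)) - a + pi / 2" for x l
  define R where "R x l = exp (Re (h (x, l)))" for x l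
  have "exp (h (0, 0)) = \<i>" using h(2)[of "(0,0)"] L init[of 0] by (simp add: f_def i)
  then have "exp (Re (h (0,0))) * cos a = 0" "exp (Re (h (0,0))) * sin a = 1"
    unfolding a_def by (metis Re_exp imaginary_unit.simps(1)) (metis \<open>exp (h (0, 0)) = \<i>\<close> Im_exp imaginary_unit.simps(2))
  then have "cos a = 0" "sin a > 0" by (simp, metis exp_gt_zero zero_less_mult_pos zero_less_one)
  moreover from this(1) have "(sin a)\<^sup>2 = 1" using sin_cos_squared_add[of a] by simp
  ultimately have a: "cos a = 0" "sin a = 1" by (auto simp: power2_eq_1_iff)
  have tr: "sin (\<phi> x l) = sin (Im (h (x, l)))" "cos (\<phi> x l) = cos (Im (h (x, l)))" for x l
    using a by (simp_all add: \<phi>_def sin_add cos_add sin_diff cos_diff)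
  show thesis
  proof
    show "continuous_on ?S (\<lambda>(x, l). \<phi> x l)"
      unfolding \<phi>_def case_prod_beta' using h(1) by (auto intro!: continuous_intros)
    show "R x l > 0" for x l by (simp add: R_def)
    show "u x l = R x l * sin (\<phi> x l)" if "x \<in> {0..1}" "l \<in> {0..L}" for x l
    proof -
      have "u x l = Im (exp (h (x, l)))" using h(2)[of "(x, l)"] that by (simp add: f_def flip: h(2))
      then show ?thesis by (simp add: Im_exp tr R_def)
    qed
    show "v x l = R x l * cos (\<phi> x l)" if "x \<in> {0..1}" "l \<in> {0..L}" for x l
    proof -
      have "v x l = Re (exp (h (x, l)))" using h(2)[of "(x, l)"] that by (simp add: f_def flip: h(2))
      then show ?thesis by (simp add: Re_exp tr R_def)
    qed
  qed (simp_all add: \<phi>_def h1 h2 a_def)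
qed

section \<open>The angle along \<open>x\<close> for a fixed spectral parameter\<close>

context
  fixes \<psi> R U V :: "real \<Rightarrow> real"
  assumes cont: "continuous_on {0..1} \<psi>" and R: "\<And>x. R x > 0"
    and U: "\<And>x. x \<in> {0..1} \<Longrightarrow> U x = R x * sin (\<psi> x)"
    and V: "\<And>x. x \<in> {0..1} \<Longrightarrow> V x = R x * cos (\<psi> x)"
    and deriv: "\<And>x. x \<in> {0..1} \<Longrightarrow> (U has_real_derivative V x) (at x within {0..1})"
begin

lemma sin_int_times_pi: "sin (real_of_int k * pi) = 0"
  by (simp add: sin_times_pi_eq_0)

text \<open>The angle crosses every multiple of pi strictly upwards: there the derivative of
  \<open>U\<close> is \<open>R x * cos (k * pi)\<close>. For a singular measure \<open>V\<close>
  need not be differentiable, so the sign of \<open>U\<close> is used and not a derivative of the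
  angle.\<close>

lemma angle_sign_near_zero:
  fixes k :: int
  assumes x: "x \<in> {0..1}" "\<psi> x = k * pi"
  shows "\<exists>d>0. \<forall>y\<in>{0..1}. (x < y \<and> y < x + d \<longrightarrow> \<psi> y > k * pi) \<and>
    (y < x \<and> x - d < y \<longrightarrow> \<psi> y < k * pi)"
proof -
  \<comment> \<open>The factor is 1 or -1 and removes the parity of \<open>k\<close>, so that
    \<open>W\<close> increases through zero at \<open>x\<close>.\<close>
  define W where "W y = cos (k * pi) * U y" for y
  have c2: "cos (k * pi) * cos (k * pi) = 1"
    using sin_cos_squared_add[of "k * pi"] by (simp add: power2_eq_square sin_int_times_pi)
  have W: "W y = R y * sin (\<psi> y - k * pi)" if "y \<in> {0..1}" for y
    by (simp add: W_def U[OF that] sin_diff sin_int_times_pi)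
  have W0: "W x = 0" using W[OF x(1)] x(2) by simp
  have "cos (k * pi) * V x = R x * (cos (k * pi) * cos (k * pi))"
    using V[OF x(1)] x(2) by simp
  then have "cos (k * pi) * V x = R x" by (simp add: c2)
  then have der: "(W has_real_derivative R x) (at x within {0..1})"
    unfolding W_def using DERIV_cmult[OF deriv[OF x(1)], of "cos (k * pi)"] by simp
  obtain d1 where d1: "d1 > 0" "\<And>h. 0 < h \<Longrightarrow> x + h \<in> {0..1} \<Longrightarrow> h < d1 \<Longrightarrow> W x < W (x + h)"
    using has_real_derivative_pos_inc_right[OF der R] by blast
  obtain d2 where d2: "d2 > 0" "\<And>h. 0 < h \<Longrightarrow> x - h \<in> {0..1} \<Longrightarrow> h < d2 \<Longrightarrow> W (x - h) < W x"
    using has_real_derivative_pos_inc_left[OF der R] by blast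
  \<comment> \<open>Within distance pi of \<open>k * pi\<close>, the sign of the sine decides on
    which side the angle lies.\<close>
  obtain d3 where d3: "d3 > 0" "\<And>y. y \<in> {0..1} \<Longrightarrow> dist y x < d3 \<Longrightarrow> dist (\<psi> y) (\<psi> x) < pi"
    using cont x(1) pi_gt_zero unfolding continuous_on_iff by metis
  show ?thesis
  proof (intro exI[of _ "min d1 (min d2 d3)"] conjI ballI impI; (elim conjE)?)
    show "min d1 (min d2 d3) > 0" using d1 d2 d3 by simp
    fix y :: real assume y: "y \<in> {0..1}"
    show "\<psi> y > k * pi" if "x < y" "y < x + min d1 (min d2 d3)"
    proof (rule ccontr)
      assume "\<not> \<psi> y > k * pi"
      have "W x < W (x + (y - x))" using that y by (intro d1(2)) auto
      then have "sin (\<psi> y - k * pi) > 0" using W[OF y] W0 R[of y] by (simp add: zero_less_mult_iff)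
      moreover have "\<bar>\<psi> y - k * pi\<bar> < pi"
        using d3(2)[OF y] that x(2) by (simp add: dist_real_def)
      ultimately show False
        using \<open>\<not> \<psi> y > k * pi\<close> sin_ge_zero[of "k * pi - \<psi> y"] sin_minus[of "\<psi> y - k * pi"] by simp
    qed
    show "\<psi> y < k * pi" if "y < x" "x - min d1 (min d2 d3) < y"
    proof (rule ccontr)
      assume "\<not> \<psi> y < k * pi"
      have "W (x - (x - y)) < W x" using that y by (intro d2(2)) auto
      then have "sin (\<psi> y - k * pi) < 0" using W[OF y] W0 R[of y] by (simp add: mult_less_0_iff)
      moreover have "\<bar>\<psi> y - k * pi\<bar> < pi"
        using d3(2)[OF y] that x(2) by (simp add: dist_real_def)
      ultimately show False
        using \<open>\<not> \<psi> y < k * pi\<close> sin_ge_zero[of "\<psi> y - k * pi"] by simp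
    qed
  qed
qed

text \<open>Otherwise there is a last point \<open>t\<close> of \<open>{x..y}\<close> where the
  angle is at least \<open>k * pi\<close>. By the intermediate value theorem the angle equals
  \<open>k * pi\<close> there, and it is above this level right after \<open>t\<close>, a
  contradiction.\<close>

lemma angle_stays_above:
  fixes k :: int
  assumes "0 \<le> x" "x < y" "y \<le> 1" "\<psi> x \<ge> k * pi"
  shows "\<psi> y \<ge> k * pi"
proof (rule ccontr)
  assume "\<not> \<psi> y \<ge> k * pi"
  then have y: "\<psi> y < k * pi" by simp
  have cxy: "continuous_on {x..y} \<psi>" using cont assms by (auto intro: continuous_on_subset)
  define A where "A = {x..y} \<inter> \<psi> -` {k * pi..}"
  have "closed A" unfolding A_def
    by (intro continuous_closed_preimage[OF cxy]) auto
  then have "compact A" unfolding A_def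
    by (metis Int_commute A_def bounded_Int bounded_closed_interval compact_eq_bounded_closed)
  moreover have "x \<in> A" using assms by (auto simp: A_def)
  ultimately obtain t where t: "t \<in> A" "\<And>s. s \<in> A \<Longrightarrow> s \<le> t"
    using compact_attains_sup[of A] by blast
  have ty: "x \<le> t" "t < y" using t(1) y by (auto simp: A_def order_less_le)
  have "\<exists>s\<ge>t. s \<le> y \<and> \<psi> s = k * pi"
    using t(1) y ty cxy by (intro IVT2') (auto simp: A_def intro: continuous_on_subset)
  then obtain s where s: "t \<le> s" "s \<le> y" "\<psi> s = k * pi" by blast
  then have "s \<in> A" using ty by (auto simp: A_def)
  then have "t = s" using t(2) s by force
  then have "\<psi> t = k * pi" using s by simp
  moreover have "t \<in> {0..1}" using ty assms by auto
  ultimately obtain d where d: "d > 0" "\<And>y. y \<in> {0..1} \<Longrightarrow> t < y \<Longrightarrow> y < t + d \<Longrightarrow> \<psi> y > k * pi"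
    using angle_sign_near_zero[of t k] by metis
  define r where "r = t + min d (y - t) / 2"
  have "t < r" "r < t + d" "r \<le> y" "r \<in> {0..1}"
    using d ty assms by (auto simp: r_def min_def field_simps)
  then have "r \<in> A" using d(2)[of r] ty by (auto simp: A_def)
  then show False using t(2) \<open>t < r\<close> by force
qed

text \<open>At a zero of \<open>U\<close> the angle is a multiple of pi. It cannot be
  \<open>k * pi\<close> again, since then it would have been below this level just before
  \<open>y\<close>.\<close>

lemma angle_increases:
  fixes k :: int
  assumes "0 \<le> x" "x < y" "y \<le> 1" "\<psi> x \<ge> k * pi" "U y = 0"
  shows "\<psi> y \<ge> (k + 1) * pi"
proof -
  have "\<psi> y \<noteq> k * pi"
  proof
    assume "\<psi> y = k * pi"
    moreover have "y \<in> {0..1}" using assms by auto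
    ultimately obtain d where d: "d > 0" "\<And>s. s \<in> {0..1} \<Longrightarrow> s < y \<Longrightarrow> y - d < s \<Longrightarrow> \<psi> s < k * pi"
      using angle_sign_near_zero[of y k] by metis
    define s where "s = y - min d (y - x) / 2"
    have s: "x < s" "s < y" "y - d < s" using d assms by (auto simp: s_def min_def field_simps)
    then have "\<psi> s < k * pi" using assms by (intro d(2)) auto
    then show False using angle_stays_above[of x s k] s assms by auto
  qed
  with angle_stays_above[OF assms(1-4)] have gt: "\<psi> y - k * pi > 0" by simp
  have "sin (\<psi> y) = 0" using assms U[of y] R[of y] by simp
  then have "sin (\<psi> y - k * pi) = 0" by (simp add: sin_diff sin_int_times_pi)
  then have "\<not> \<psi> y - k * pi < pi" using sin_gt_zero[OF gt] by auto
  then show ?thesis by (simp add: algebra_simps)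
qed

lemma angle_ge_zeros:
  assumes "finite Z" "Z \<subseteq> {0..1}" "\<And>z. z \<in> Z \<Longrightarrow> U z = 0" "\<psi> 0 = pi / 2"
    "y \<in> {0..1}" "\<And>z. z \<in> Z \<Longrightarrow> z \<le> y"
  shows "\<psi> y \<ge> card Z * pi"
  using assms(1-3,5,6)
proof (induction Z arbitrary: y rule: finite_linorder_max_induct)
  case empty
  have "\<psi> 0 \<ge> 0" using assms(4) pi_gt_zero by linarith
  then show ?case using angle_stays_above[of 0 y 0] empty by (cases "y = 0") auto
next
  case (insert b A)
  have b: "b \<in> {0..1}" "U b = 0" "b \<le> y" using insert.prems by auto
  \<comment> \<open>The previous zero, or the starting point, where the angle pi/2 is at least
    \<open>0 * pi\<close>.\<close>
  define x where "x = (if A = {} then 0 else Max A)"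
  \<comment> \<open>\<open>U\<close> is positive at 0, so even the first zero lies strictly to the
    right of the starting point, as \<open>angle_increases\<close> demands.\<close>
  have "b \<noteq> 0" using b U[of 0] R[of 0] assms(4) by auto
  then have x: "x \<in> {0..1}" "x < b"
    using insert b by (auto simp: x_def subset_iff)
  have "\<psi> x \<ge> card A * pi"
  proof (rule insert.IH)
    show "z \<le> x" if "z \<in> A" for z using that insert.hyps by (auto simp: x_def)
  qed (use insert.prems x in auto)
  then have "\<psi> b \<ge> (int (card A) + 1) * pi"
    using angle_increases[of x b "int (card A)"] x b by simp
  moreover have "card (insert b A) = card A + 1" using insert.hyps by force
  ultimately have *: "\<psi> b \<ge> int (card (insert b A)) * pi" by (simp add: add.commute)
  then have "\<psi> y \<ge> int (card (insert b A)) * pi"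
    using angle_stays_above[of b y "int (card (insert b A))"] b insert.prems
    by (cases "b = y") auto
  then show ?case by simp
qed

end

text \<open>Zeros in \<open>x\<close> are traded for parameters below \<open>L\<close>: at
  \<open>x = 1\<close> the angle runs from pi/2 at \<open>l = 0\<close> to at least
  \<open>card Z * pi\<close> at \<open>l = L\<close>, hence takes the value
  \<open>pi / 2 + k * pi\<close>, where the cosine vanishes, for each
  \<open>k < card Z\<close>.\<close>

lemma oscillation_count:
  fixes u v :: "real \<Rightarrow> real \<Rightarrow> real"
  assumes L: "L \<ge> 0"
    and cu: "continuous_on ({0..1} \<times> {0..L}) (\<lambda>(x, l). u x l)"
    and cv: "continuous_on ({0..1} \<times> {0..L}) (\<lambda>(x, l). v x l)"
    and nz: "\<And>x l. x \<in> {0..1} \<Longrightarrow> l \<in> {0..L} \<Longrightarrow> u x l \<noteq> 0 \<or> v x l \<noteq> 0"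
    and init: "\<And>l. l \<in> {0..L} \<Longrightarrow> u 0 l = 1" "\<And>l. l \<in> {0..L} \<Longrightarrow> v 0 l = 0"
    and free: "\<And>x. x \<in> {0..1} \<Longrightarrow> u x 0 = 1" "\<And>x. x \<in> {0..1} \<Longrightarrow> v x 0 = 0"
    and deriv: "\<And>x. x \<in> {0..1} \<Longrightarrow> ((\<lambda>x. u x L) has_real_derivative v x L) (at x within {0..1})"
    and Z: "finite Z" "Z \<subseteq> {0..1}" "\<And>z. z \<in> Z \<Longrightarrow> u z L = 0"
  shows "\<exists>E\<subseteq>{0..<L}. finite E \<and> card E = card Z \<and> (\<forall>l\<in>E. v 1 l = 0)"
proof -
  obtain \<phi> R where c: "continuous_on ({0..1} \<times> {0..L}) (\<lambda>(x, l). \<phi> x l)"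
    and R: "\<And>x l. R x l > 0"
    and u: "\<And>x l. x \<in> {0..1} \<Longrightarrow> l \<in> {0..L} \<Longrightarrow> u x l = R x l * sin (\<phi> x l)"
    and v: "\<And>x l. x \<in> {0..1} \<Longrightarrow> l \<in> {0..L} \<Longrightarrow> v x l = R x l * cos (\<phi> x l)"
    and ends: "\<phi> 0 L = pi / 2" "\<phi> 1 0 = pi / 2"
    using polar_lift[OF L cu cv nz init free] by blast
  have cx: "continuous_on {0..1} (\<lambda>x. \<phi> x L)"
    using continuous_on_compose2[OF c, of "{0..1}" "\<lambda>x. (x, L)"] L
    by (force intro!: continuous_intros)
  have cl: "continuous_on {0..L} (\<lambda>l. \<phi> 1 l)"
    using continuous_on_compose2[OF c, of "{0..L}" "\<lambda>l. (1, l)"]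
    by (force intro!: continuous_intros)
  have big: "\<phi> 1 L \<ge> card Z * pi"
    using L Z ends(1)
    by (intro angle_ge_zeros[where \<psi> = "\<lambda>x. \<phi> x L" and R = "\<lambda>x. R x L"
          and U = "\<lambda>x. u x L" and V = "\<lambda>x. v x L"] cx R u v deriv) auto
  have "\<exists>l\<in>{0..<L}. \<phi> 1 l = pi / 2 + k * pi" if "k < card Z" for k :: nat
  proof -
    have "real k + 1 \<le> card Z" using that by linarith
    then have "(real k + 1) * pi \<le> card Z * pi" by (intro mult_right_mono) auto
    with big have "k * pi + pi \<le> \<phi> 1 L" by (simp add: algebra_simps)
    then have lt: "pi / 2 + k * pi < \<phi> 1 L" using pi_gt_zero by linarith
    \<comment> \<open>For \<open>k = 0\<close> this is an equality; that value, attained at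
      \<open>l = 0\<close>, accounts for the eigenvalue 0.\<close>
    have "\<phi> 1 0 \<le> pi / 2 + k * pi" unfolding ends(2) by simp
    with lt L cl have "\<exists>l\<ge>0. l \<le> L \<and> \<phi> 1 l = pi / 2 + k * pi"
      by (intro IVT') auto
    with lt show ?thesis by (force simp: order_less_le)
  qed
  then obtain \<nu> where lam: "\<And>k. k < card Z \<Longrightarrow> \<nu> k \<in> {0..<L} \<and> \<phi> 1 (\<nu> k) = pi / 2 + k * pi"
    by metis
  have inj: "inj_on \<nu> {..<card Z}"
    using lam by (intro inj_onI) (metis lessThan_iff add_left_cancel mult_cancel_right of_nat_eq_iff pi_neq_zero)
  show ?thesis
  proof (intro exI[of _ "\<nu> ` {..<card Z}"] conjI ballI)
    fix l assume "l \<in> \<nu> ` {..<card Z}"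
    then obtain k where k: "k < card Z" "l = \<nu> k" by auto
    have "cos (pi / 2 + k * pi) = 0" by (simp add: cos_add)
    then show "v 1 l = 0" using lam[OF k(1)] k(2) v[of 1 l] by auto
  qed (use lam inj in \<open>auto simp: card_image\<close>)
qed

section \<open>The shooting solution\<close>

locale atomless_unit_prob = unit_prob_space +
  assumes atomless: "prob {x} = 0"
begin

lemma AE_neq: "AE t in M. t \<noteq> c"
proof (cases "c \<in> {0..1}")
  case True
  then have "{c} \<in> null_sets M"
    using interval_sets[of c c] atomless[of c] by (auto simp: null_sets_def emeasure_eq_measure)
  then show ?thesis using AE_not_in by fastforce
next
  case False
  then show ?thesis by (intro AE_I2) (auto simp: space_unit)
qed

lemma indicator_times_integrable:
  fixes f :: "real \<Rightarrow> real"
  assumes "continuous_on {0..1} f" "A \<in> sets M"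
  shows "integrable M (\<lambda>t. indicator A t * f t)"
  using integrable_mult_indicator[OF assms(2) continuous_integrable[OF assms(1)]] by simp

text \<open>Dominated convergence. The indicators converge at every \<open>t\<close> except possibly
  \<open>t = a\<close>, and this is where the absence of atoms enters.\<close>

lemma continuous_on_integral_upto:
  fixes f :: "real \<Rightarrow> real"
  assumes f: "continuous_on {0..1} f"
  shows "continuous_on {0..1} (\<lambda>x. LINT t:{0..x}|M. f t)"
  unfolding continuous_on_sequentially comp_def
proof (intro allI ballI impI)
  fix X :: "nat \<Rightarrow> real" and a :: real
  assume a: "a \<in> {0..1}" and X: "(\<forall>n. X n \<in> {0..1}) \<and> X \<longlonglongrightarrow> a"
  show "(\<lambda>n. LINT t:{0..X n}|M. f t) \<longlonglongrightarrow> (LINT t:{0..a}|M. f t)"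
    unfolding set_lebesgue_integral_def
  proof (rule integral_dominated_convergence)
    show "integrable M (\<lambda>t. \<bar>f t\<bar>)" using f by (intro continuous_integrable continuous_intros)
    show "(\<lambda>t. indicator {0..a} t *\<^sub>R f t) \<in> borel_measurable M"
      using a indicator_times_integrable[OF f interval_sets[of 0 a]] by auto
    show "(\<lambda>t. indicator {0..X n} t *\<^sub>R f t) \<in> borel_measurable M" for n
      using X indicator_times_integrable[OF f interval_sets[of 0 "X n"]] by auto
    show "AE t in M. norm (indicator {0..X n} t *\<^sub>R f t) \<le> \<bar>f t\<bar>" for n
      by (intro AE_I2) (auto simp: indicator_def)
    have "AE t in M. t \<in> {0..1}" by (intro AE_I2) (auto simp: space_unit)
    with AE_neq[of a] show "AE t in M. (\<lambda>n. indicator {0..X n} t *\<^sub>R f t) \<longlonglongrightarrow> indicator {0..a} t *\<^sub>R f t"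
    proof eventually_elim
      case (elim t)
      have "\<forall>\<^sub>F n in sequentially. (t \<le> X n) = (t \<le> a)"
      proof (cases "t < a")
        case True
        from order_tendstoD(1)[OF conjunct2[OF X] True] show ?thesis
          using True by (auto elim: eventually_mono)
      next
        case False
        with elim have "a < t" by simp
        from order_tendstoD(2)[OF conjunct2[OF X] this] show ?thesis
          using \<open>a < t\<close> by (auto elim: eventually_mono)
      qed
      then have "\<forall>\<^sub>F n in sequentially. indicator {0..X n} t *\<^sub>R f t = indicator {0..a} t *\<^sub>R f t"
        by eventually_elim (auto simp: indicator_def)
      then show ?case by (rule tendsto_eventually)
    qed
  qed
qed

text \<open>Coefficients of the power series in the spectral parameter of the solution of
  \<open>u' = v\<close>, \<open>v' = - l M u\<close>, \<open>u(0) = 1\<close>, \<open>v(0) = 0\<close>.\<close>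

primrec ucoeff :: "nat \<Rightarrow> real \<Rightarrow> real" where
  "ucoeff 0 = (\<lambda>x. 1)"
| "ucoeff (Suc k) = (\<lambda>x. integral {0..x} (\<lambda>s. LINT t:{0..s}|M. ucoeff k t))"

text \<open>Index shift: this is the derivative of \<open>ucoeff (Suc k)\<close>, so in the series
  for \<open>v\<close> it comes with the power \<open>Suc k\<close> of the parameter.\<close>

definition vcoeff :: "nat \<Rightarrow> real \<Rightarrow> real" where
  "vcoeff k x = (LINT t:{0..x}|M. ucoeff k t)"

lemma ucoeff_Suc: "ucoeff (Suc k) = (\<lambda>x. integral {0..x} (vcoeff k))"
  by (simp add: vcoeff_def[abs_def])

declare ucoeff.simps(2) [simp del]

lemma continuous_ucoeff: "continuous_on {0..1} (ucoeff k)"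
  and continuous_vcoeff: "continuous_on {0..1} (vcoeff k)"
proof -
  have v: "continuous_on {0..1} (vcoeff k)" if "continuous_on {0..1} (ucoeff k)" for k
    unfolding vcoeff_def[abs_def] using that by (rule continuous_on_integral_upto)
  have u: "continuous_on {0..1} (ucoeff k)" for k
  proof (induction k)
    case (Suc k)
    show ?case unfolding ucoeff_Suc
      by (intro indefinite_integral_continuous_1 integrable_continuous_interval v Suc)
  qed simp
  show "continuous_on {0..1} (ucoeff k)" "continuous_on {0..1} (vcoeff k)"
    using u v by auto
qed

lemma vcoeff_bounds:
  assumes u: "\<And>t. t \<in> {0..1} \<Longrightarrow> 0 \<le> ucoeff k t \<and> ucoeff k t \<le> t ^ k / fact k" and x: "x \<in> {0..1}"
  shows "0 \<le> vcoeff k x" "vcoeff k x \<le> x ^ k / fact k"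
proof -
  have int: "integrable M (\<lambda>t. indicator {0..x} t * ucoeff k t)"
    using x by (intro indicator_times_integrable continuous_ucoeff interval_sets) auto
  show "0 \<le> vcoeff k x"
    using u unfolding vcoeff_def set_lebesgue_integral_def
    by (intro integral_nonneg_AE AE_I2) (auto simp: space_unit)
  have "vcoeff k x \<le> (LINT t|M. x ^ k / fact k)"
    unfolding vcoeff_def set_lebesgue_integral_def
  proof (rule integral_mono)
    fix t assume "t \<in> space M"
    then have t: "t \<in> {0..1}" by (simp add: space_unit)
    show "indicator {0..x} t *\<^sub>R ucoeff k t \<le> x ^ k / fact k"
    proof (cases "t \<le> x")
      case True
      have "ucoeff k t \<le> t ^ k / fact k" using u[OF t] by simp
      also have "\<dots> \<le> x ^ k / fact k" using True t by (intro divide_right_mono power_mono) auto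
      finally show ?thesis using True t by simp
    next
      case False
      then show ?thesis using x by simp
    qed
  qed (use int in auto)
  then show "vcoeff k x \<le> x ^ k / fact k" by (simp add: prob_space)
qed

text \<open>Each step of the recursion integrates once against \<open>M\<close>, which costs at most
  the total mass 1, and once against Lebesgue measure, which supplies the next factorial. The series
  therefore converge for every parameter.\<close>

lemma ucoeff_bounds:
  "x \<in> {0..1} \<Longrightarrow> 0 \<le> ucoeff k x \<and> ucoeff k x \<le> x ^ k / fact k"
proof (induction k arbitrary: x)
  case (Suc k)
  have i: "vcoeff k integrable_on {0..x}"
    using Suc.prems continuous_on_subset[OF continuous_vcoeff] by (intro integrable_continuous_interval) auto
  have "((\<lambda>s. s ^ Suc k / fact (Suc k)) has_real_derivative s ^ k / fact k) (at s within {0..x})" for s :: real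
  proof -
    have "((\<lambda>s. s ^ Suc k / fact (Suc k)) has_real_derivative (real (Suc k) * s ^ k / fact (Suc k))) (at s within {0..x})"
      using DERIV_cdivide[OF DERIV_pow[of "Suc k" s], of "fact (Suc k)"] by simp
    then show ?thesis by (simp add: fact_Suc divide_simps)
  qed
  then have P: "((\<lambda>s. s ^ k / fact k) has_integral (x ^ Suc k / fact (Suc k) - 0 ^ Suc k / fact (Suc k))) {0..x}"
    using Suc.prems by (intro fundamental_theorem_of_calculus)
      (auto simp: has_real_derivative_iff_has_vector_derivative)
  have "integral {0..x} (vcoeff k) \<le> integral {0..x} (\<lambda>s. s ^ k / fact k)"
    using Suc vcoeff_bounds(2) i P by (intro integral_le) auto
  moreover have "0 \<le> integral {0..x} (vcoeff k)"
    using Suc vcoeff_bounds(1) i by (intro integral_nonneg) auto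
  ultimately show ?case using integral_unique[OF P] by (simp add: ucoeff_Suc)
qed simp

lemma coeff_abs_le:
  assumes "x \<in> {0..1}"
  shows "\<bar>ucoeff k x\<bar> \<le> 1 / fact k" "\<bar>vcoeff k x\<bar> \<le> 1 / fact k"
proof -
  have "x ^ k / fact k \<le> 1 / fact k"
    using assms by (intro divide_right_mono power_le_one) auto
  moreover note ucoeff_bounds[OF assms, of k] vcoeff_bounds[OF ucoeff_bounds assms, of k]
  ultimately show "\<bar>ucoeff k x\<bar> \<le> 1 / fact k" "\<bar>vcoeff k x\<bar> \<le> 1 / fact k" by auto
qed

definition usol :: "real \<Rightarrow> real \<Rightarrow> real" where
  "usol x l = 1 + (\<Sum>k. (- l) ^ Suc k * ucoeff (Suc k) x)"

definition vsol :: "real \<Rightarrow> real \<Rightarrow> real" where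
  "vsol x l = (\<Sum>k. (- l) ^ Suc k * vcoeff k x)"

lemma summable_majorant: "summable (\<lambda>k. L ^ Suc k / fact k :: real)"
  using summable_mult[OF summable_exp[of L], of L] by (simp add: divide_simps)

text \<open>One majorant serves both series, uniformly in \<open>x\<close> and in bounded
  parameters; it yields the joint continuity that the angle argument needs, as well as termwise
  differentiation.\<close>

lemma term_bounds:
  assumes "x \<in> {0..1}" "\<bar>l\<bar> \<le> L"
  shows "norm ((- l) ^ Suc k * ucoeff (Suc k) x) \<le> L ^ Suc k / fact k"
    "norm ((- l) ^ Suc k * vcoeff k x) \<le> L ^ Suc k / fact k"
proof -
  have p: "\<bar>l\<bar> ^ Suc k \<le> L ^ Suc k" using assms by (intro power_mono) auto
  have "(1 :: real) / fact (Suc k) \<le> 1 / fact k" by (intro divide_left_mono fact_mono) auto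
  with coeff_abs_le[OF assms(1)] have u: "\<bar>ucoeff (Suc k) x\<bar> \<le> 1 / fact k" by (meson order_trans)
  have L: "0 \<le> L" using assms by linarith
  show "norm ((- l) ^ Suc k * ucoeff (Suc k) x) \<le> L ^ Suc k / fact k"
    using mult_mono[OF p u] L by (simp add: abs_mult power_abs del: power_Suc)
  show "norm ((- l) ^ Suc k * vcoeff k x) \<le> L ^ Suc k / fact k"
    using mult_mono[OF p coeff_abs_le(2)[OF assms(1)]] L by (simp add: abs_mult power_abs del: power_Suc)
qed

lemma continuous_terms:
  "continuous_on ({0..1} \<times> {0..L}) (\<lambda>(x, l). (- l) ^ Suc k * ucoeff (Suc k) x)"
  "continuous_on ({0..1} \<times> {0..L}) (\<lambda>(x, l). (- l) ^ Suc k * vcoeff k x)"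
  unfolding case_prod_beta'
  by (intro continuous_intros continuous_on_compose2[OF continuous_ucoeff] continuous_on_compose2[OF continuous_vcoeff]; force)+

lemma continuous_usol: "continuous_on ({0..1} \<times> {0..L}) (\<lambda>(x, l). usol x l)"
proof -
  have "uniform_limit ({0..1} \<times> {0..L}) (\<lambda>n p. \<Sum>k<n. (- snd p) ^ Suc k * ucoeff (Suc k) (fst p))
      (\<lambda>p. \<Sum>k. (- snd p) ^ Suc k * ucoeff (Suc k) (fst p)) sequentially"
    by (rule Weierstrass_m_test[OF term_bounds(1) summable_majorant[of L]]) auto
  then have "continuous_on ({0..1} \<times> {0..L}) (\<lambda>p. \<Sum>k. (- snd p) ^ Suc k * ucoeff (Suc k) (fst p))"
    using continuous_terms(1)[of L]
    by (intro uniform_limit_theorem[where F = sequentially and f = "\<lambda>n p. \<Sum>k<n. (- snd p) ^ Suc k * ucoeff (Suc k) (fst p)"])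
      (auto intro!: always_eventually continuous_on_sum simp: case_prod_beta' simp del: power_Suc)
  then show ?thesis unfolding usol_def case_prod_beta' by (intro continuous_intros)
qed

lemma continuous_vsol: "continuous_on ({0..1} \<times> {0..L}) (\<lambda>(x, l). vsol x l)"
proof -
  have "uniform_limit ({0..1} \<times> {0..L}) (\<lambda>n p. \<Sum>k<n. (- snd p) ^ Suc k * vcoeff k (fst p))
      (\<lambda>p. \<Sum>k. (- snd p) ^ Suc k * vcoeff k (fst p)) sequentially"
    by (rule Weierstrass_m_test[OF term_bounds(2) summable_majorant[of L]]) auto
  then have "continuous_on ({0..1} \<times> {0..L}) (\<lambda>p. \<Sum>k. (- snd p) ^ Suc k * vcoeff k (fst p))"
    using continuous_terms(2)[of L]
    by (intro uniform_limit_theorem[where F = sequentially and f = "\<lambda>n p. \<Sum>k<n. (- snd p) ^ Suc k * vcoeff k (fst p)"])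
      (auto intro!: always_eventually continuous_on_sum simp: case_prod_beta' simp del: power_Suc)
  then show ?thesis unfolding vsol_def case_prod_beta' .
qed

lemma continuous_sol:
  assumes "l \<ge> 0"
  shows "continuous_on {0..1} (\<lambda>x. usol x l)" "continuous_on {0..1} (\<lambda>x. vsol x l)"
  using continuous_on_compose2[OF continuous_usol[of l], of "{0..1}" "\<lambda>x. (x, l)"]
    continuous_on_compose2[OF continuous_vsol[of l], of "{0..1}" "\<lambda>x. (x, l)"] assms
  by (force intro!: continuous_intros)+

lemma deriv_usol:
  assumes x: "x \<in> {0..1}"
  shows "((\<lambda>x. usol x l) has_real_derivative vsol x l) (at x within {0..1})"
proof -
  have "\<exists>g. \<forall>x\<in>{0..1}. (\<lambda>k. (- l) ^ Suc k * ucoeff (Suc k) x) sums g x \<and>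
      (g has_field_derivative vsol x l) (at x within {0..1})"
  proof (rule has_field_derivative_series)
    show "((\<lambda>x. (- l) ^ Suc k * ucoeff (Suc k) x) has_field_derivative (- l) ^ Suc k * vcoeff k x) (at x within {0..1})"
      if "x \<in> {0..1}" for k x
      unfolding ucoeff_Suc using continuous_vcoeff that
      by (intro DERIV_cmult integral_has_real_derivative) auto
    show "uniform_limit {0..1} (\<lambda>n x. \<Sum>k<n. (- l) ^ Suc k * vcoeff k x) (\<lambda>x. vsol x l) sequentially"
      unfolding vsol_def by (rule Weierstrass_m_test[OF term_bounds(2) summable_majorant[of "\<bar>l\<bar>"]]) auto
    show "summable (\<lambda>k. (- l) ^ Suc k * ucoeff (Suc k) 0)"
      by (rule summable_comparison_test'[OF summable_majorant[of "\<bar>l\<bar>"] term_bounds(1)]) auto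
  qed auto
  then obtain g where g: "\<And>x. x \<in> {0..1} \<Longrightarrow> (\<lambda>k. (- l) ^ Suc k * ucoeff (Suc k) x) sums g x"
    "\<And>x. x \<in> {0..1} \<Longrightarrow> (g has_field_derivative vsol x l) (at x within {0..1})" by blast
  have eq: "usol x l = 1 + g x" if "x \<in> {0..1}" for x
    using sums_unique[OF g(1)[OF that]] by (simp add: usol_def)
  have "((\<lambda>x. 1 + g x) has_real_derivative 0 + vsol x l) (at x within {0..1})"
    by (intro DERIV_add DERIV_const g x)
  then show ?thesis
    using has_derivative_transform[OF x, of "\<lambda>x. usol x l" "\<lambda>x. 1 + g x"] eq
    by (simp add: has_field_derivative_def)
qed

text \<open>The integrated form of \<open>v' = - l M u\<close>, which makes sense for singular
  \<open>M\<close>. Sum and integral are exchanged with the sum starting at \<open>k = 0\<close>;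
  the factor \<open>- l\<close> then shifts it to the series of \<open>vsol\<close>.\<close>

lemma vsol_eq:
  assumes x: "x \<in> {0..1}" and l: "l \<ge> 0"
  shows "vsol x l = - l * (LINT t:{0..x}|M. usol t l)"
proof -
  let ?f = "\<lambda>k t. indicator {0..x} t * ((- l) ^ k * ucoeff k t)"
  have bd: "norm (?f k t) \<le> l ^ k / fact k" if "t \<in> {0..1}" for k t
  proof -
    have "l ^ k * \<bar>ucoeff k t\<bar> \<le> l ^ k * (1 / fact k)"
      using coeff_abs_le[OF that] l by (intro mult_left_mono) auto
    then show ?thesis using l by (auto simp: indicator_def abs_mult power_abs)
  qed
  have sm: "summable (\<lambda>k. l ^ k / fact k)"
    using summable_exp[of l] by (simp add: divide_simps)
  have int: "integrable M (?f k)" for k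
    using x by (intro indicator_times_integrable interval_sets continuous_intros continuous_ucoeff) auto
  have I: "(LINT t|M. ?f k t) = (- l) ^ k * vcoeff k x" for k
    by (simp add: vcoeff_def set_lebesgue_integral_def mult.left_commute)
  have "(LINT t|M. (\<Sum>k. ?f k t)) = (\<Sum>k. LINT t|M. ?f k t)"
  proof (rule integral_suminf[OF int])
    show "AE t in M. summable (\<lambda>k. norm (?f k t))"
    proof (rule AE_I2)
      fix t assume "t \<in> space M"
      then have "t \<in> {0..1}" by (simp add: space_unit)
      then show "summable (\<lambda>k. norm (?f k t))"
        using bd by (intro summable_comparison_test'[OF sm]) auto
    qed
    have "norm (LINT t|M. norm (?f k t)) \<le> l ^ k / fact k" for k
    proof -
      have "(LINT t|M. norm (?f k t)) \<le> (LINT t|M. l ^ k / fact k)"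
        using int bd by (intro integral_mono) (auto simp: space_unit)
      moreover have "0 \<le> (LINT t|M. norm (?f k t))" by (intro integral_nonneg_AE) auto
      ultimately show ?thesis by (simp add: prob_space)
    qed
    then show "summable (\<lambda>k. LINT t|M. norm (?f k t))"
      by (intro summable_comparison_test'[OF sm]) auto
  qed
  moreover have "(\<Sum>k. ?f k t) = indicator {0..x} t * usol t l" if "t \<in> space M" for t
  proof -
    have t: "t \<in> {0..1}" using that by (simp add: space_unit)
    have s: "summable (\<lambda>k. (- l) ^ k * ucoeff k t)"
    proof (rule summable_comparison_test'[OF sm])
      show "norm ((- l) ^ k * ucoeff k t) \<le> l ^ k / fact k" for k
        using mult_left_mono[OF coeff_abs_le(1)[OF t, of k], of "l ^ k"] l by (simp add: abs_mult power_abs)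
    qed
    then show ?thesis
      using suminf_split_head[OF s] by (simp add: suminf_mult usol_def)
  qed
  ultimately have "(LINT t:{0..x}|M. usol t l) = (\<Sum>k. (- l) ^ k * vcoeff k x)"
    unfolding set_lebesgue_integral_def I[symmetric]
    by (simp cong: Bochner_Integration.integral_cong)
  moreover have "summable (\<lambda>k. (- l) ^ k * vcoeff k x)"
  proof (rule summable_comparison_test'[OF sm])
    show "norm ((- l) ^ k * vcoeff k x) \<le> l ^ k / fact k" for k
      using mult_left_mono[OF coeff_abs_le(2)[OF x, of k], of "l ^ k"] l by (simp add: abs_mult power_abs)
  qed
  ultimately show ?thesis
    using suminf_mult[of "\<lambda>k. (- l) ^ k * vcoeff k x" "- l"] by (simp add: vsol_def mult.assoc)
qed

lemma sol_initial:
  shows "usol 0 l = 1" "vsol 0 l = 0"  "usol x 0 = 1" "vsol x 0 = 0"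
proof -
  \<comment> \<open>The integral runs over the single point 0, which is null because there are no
    atoms.\<close>
  have v: "vcoeff k 0 = 0" for k
  proof -
    have "AE t in M. indicator {0..0} t *\<^sub>R ucoeff k t = 0"
      using AE_neq[of 0] by eventually_elim auto
    then show ?thesis unfolding vcoeff_def set_lebesgue_integral_def by (rule integral_eq_zero_AE)
  qed
  show "usol 0 l = 1" "vsol 0 l = 0"  "usol x 0 = 1" "vsol x 0 = 0"
    by (simp_all add: usol_def vsol_def v ucoeff_Suc)
qed

lemma prob_Ioc: "{x<..y} \<in> sets M \<and> prob {x<..y} = prob {x..y}" if "0 \<le> x" "x \<le> y" "y \<le> 1"
proof -
  have s: "{x} \<in> sets M" "{x..y} \<in> sets M"
    using interval_sets[of x x] interval_sets[of x y] that by auto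
  have e: "{x<..y} = {x..y} - {x}" by auto
  then have "{x<..y} \<in> sets M" using s by auto
  moreover have "prob {x<..y} = prob {x..y}"
    unfolding e using that s atomless[of x] by (subst finite_measure_Diff) auto
  ultimately show ?thesis by blast
qed

lemma vsol_diff:
  assumes "0 \<le> x" "x \<le> y" "y \<le> 1" "l \<ge> 0"
  shows "vsol x l - vsol y l = l * (LINT t:{x<..y}|M. usol t l)"
proof -
  have "(LINT t:{0..y}|M. usol t l) = (LINT t:{0..x}|M. usol t l) + (LINT t:{x<..y}|M. usol t l)"
    unfolding set_lebesgue_integral_def
  proof (subst Bochner_Integration.integral_add[symmetric])
    show "integrable M (\<lambda>t. indicator {0..x} t *\<^sub>R usol t l)"
      using assms indicator_times_integrable[OF continuous_sol(1) interval_sets, of l 0 x] by simp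
    show "integrable M (\<lambda>t. indicator {x<..y} t *\<^sub>R usol t l)"
      using assms prob_Ioc[of x y] indicator_times_integrable[OF continuous_sol(1), of l "{x<..y}"] by simp
    show "(LINT t|M. indicator {0..y} t *\<^sub>R usol t l) =
        (LINT t|M. indicator {0..x} t *\<^sub>R usol t l + indicator {x<..y} t *\<^sub>R usol t l)"
      using assms by (intro Bochner_Integration.integral_cong) (auto simp: indicator_def)
  qed
  then show ?thesis using assms by (simp add: vsol_eq algebra_simps)
qed

text \<open>The factor \<open>c\<close> is meant as a sign: one bound covers both the solution and
  its negative, which gives two-sided estimates and treats negative stretches like positive
  ones.\<close>

lemma vsol_drop_ge:
  assumes "0 \<le> x" "x \<le> y" "y \<le> 1" "l \<ge> 0" and B: "\<And>t. t \<in> {x..y} \<Longrightarrow> c * usol t l \<ge> B"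
  shows "c * (vsol x l - vsol y l) \<ge> l * (B * prob {x..y})"
proof -
  have "B * prob {x..y} = (LINT t|M. indicator {x<..y} t * B)"
    using prob_Ioc[OF assms(1-3)] by simp
  also have "\<dots> \<le> (LINT t|M. indicator {x<..y} t * (c * usol t l))"
    using prob_Ioc[OF assms(1-3)] B assms(4)
    by (intro integral_mono indicator_times_integrable continuous_intros continuous_sol)
      (auto simp: indicator_def)
  also have "\<dots> = c * (LINT t:{x<..y}|M. usol t l)"
    by (simp add: set_lebesgue_integral_def mult.left_commute)
  finally have "l * (B * prob {x..y}) \<le> l * (c * (LINT t:{x<..y}|M. usol t l))"
    using assms(4) by (intro mult_left_mono) auto
  then show ?thesis by (simp add: vsol_diff[OF assms(1-4)] mult.left_commute)
qed

lemma MVT_usol: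
  assumes "0 \<le> x" "x < y" "y \<le> 1"
  obtains z where "x < z" "z < y" "usol y l - usol x l = (y - x) * vsol z l"
proof -
  have "\<exists>z>x. z < y \<and> usol y l - usol x l = vsol z l * (y - x)"
  proof (rule mvt[OF assms(2), of "\<lambda>x. usol x l" "\<lambda>z h. vsol z l * h"])
    have "continuous_on {0..1} (\<lambda>x. usol x l)"
      using deriv_usol by (intro DERIV_continuous_on)
    then show "continuous_on {x..y} (\<lambda>x. usol x l)"
      by (rule continuous_on_subset) (use assms in auto)
    fix z assume z: "x < z" "z < y"
    then have "at z within {0..1} = at z"
      using assms by (intro at_within_interior) auto
    then show "((\<lambda>x. usol x l) has_derivative (\<lambda>h. vsol z l * h)) (at z)"
      using deriv_usol[of z l] z assms by (simp add: has_field_derivative_def)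
  qed blast
  then show thesis using that by (auto simp: mult.commute)
qed

end

section \<open>Lower bound for the number of eigenvalues\<close>

context atomless_unit_prob begin

lemma vsol_small:
  assumes "0 \<le> x" "x \<le> y" "y \<le> 1" "l \<ge> 0" "A \<ge> 0" and A: "\<And>t. t \<in> {x..y} \<Longrightarrow> \<bar>usol t l\<bar> \<le> A"
  shows "\<bar>vsol x l - vsol y l\<bar> \<le> l * A"
proof -
  have "c * (vsol x l - vsol y l) \<ge> - (l * A)" if "\<bar>c\<bar> = 1" for c :: real
  proof -
    have "c * usol t l \<ge> - A" if "t \<in> {x..y}" for t
      using A[OF that] \<open>\<bar>c\<bar> = 1\<close> abs_mult[of c "usol t l"] by simp
    then have "c * (vsol x l - vsol y l) \<ge> l * (- A * prob {x..y})"
      using assms by (intro vsol_drop_ge) auto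
    moreover have "l * (A * prob {x..y}) \<le> l * (A * 1)"
      using assms by (intro mult_left_mono prob_le_1) auto
    ultimately show ?thesis by simp
  qed
  from this[of 1] this[of "-1"] show ?thesis by simp
qed

text \<open>Uniqueness for the initial value problem at \<open>s\<close>, on a short interval to its
  left. If \<open>A\<close> is the maximum of the absolute value of \<open>u\<close> there, then the
  slope is at most \<open>l * A\<close>, so the mean value theorem gives
  \<open>A \<le> (s - r) * l * A \<le> A / 2\<close>.\<close>

lemma sol_zero_propagates:
  assumes "0 \<le> r" "r \<le> s" "s \<le> 1" "l \<ge> 0" "(s - r) * l \<le> 1 / 2"
    and s: "usol s l = 0" "vsol s l = 0"
  shows "usol r l = 0 \<and> vsol r l = 0"
proof -
  have "continuous_on {r..s} (\<lambda>t. \<bar>usol t l\<bar>)"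
    using continuous_on_subset[OF continuous_sol(1)[OF assms(4)], of "{r..s}"] assms
    by (intro continuous_intros) auto
  then obtain m where m: "m \<in> {r..s}" "\<And>t. t \<in> {r..s} \<Longrightarrow> \<bar>usol t l\<bar> \<le> \<bar>usol m l\<bar>"
    using continuous_attains_sup[of "{r..s}" "\<lambda>t. \<bar>usol t l\<bar>"] assms by auto
  define A where "A = \<bar>usol m l\<bar>"
  have v: "\<bar>vsol t l\<bar> \<le> l * A" if "t \<in> {r..s}" for t
    using vsol_small[of t s l A] that m assms s by (auto simp: A_def)
  have "A = 0"
  proof (cases "m = s")
    case False
    then have "m < s" using m by auto
    then obtain z where z: "m < z" "z < s" "usol s l - usol m l = (s - m) * vsol z l"
      using MVT_usol[of m s l] assms m by auto
    have "A = (s - m) * \<bar>vsol z l\<bar>"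
      using z s \<open>m < s\<close> unfolding A_def by (metis abs_minus_cancel abs_mult abs_of_pos diff_0 diff_gt_0_iff_gt)
    also have "\<dots> \<le> (s - r) * (l * A)"
      using z m v[of z] by (intro mult_mono) auto
    also have "\<dots> \<le> 1 / 2 * A"
      using mult_right_mono[OF assms(5), of A] by (simp add: A_def mult.assoc)
    finally show ?thesis by (simp add: A_def)
  qed (simp add: A_def s)
  then show ?thesis using m(2)[of r] v[of r] assms by (simp add: A_def)
qed

lemma sol_nonzero:
  assumes "x \<in> {0..1}" "l \<ge> 0"
  shows "usol x l \<noteq> 0 \<or> vsol x l \<noteq> 0"
proof -
  \<comment> \<open>Step width for walking back from \<open>x\<close> to 0, where
    \<open>u = 1\<close>. The summand 1 keeps it finite and positive for
    \<open>l = 0\<close>.\<close>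
  define h where "h = 1 / (2 * (l + 1))"
  have h: "h > 0" "h * l \<le> 1 / 2" using assms(2) by (auto simp: h_def divide_simps)
  have main: "usol s l \<noteq> 0 \<or> vsol s l \<noteq> 0" if "s \<in> {0..1}" "s \<le> real n * h" for n s
    using that
  proof (induction n arbitrary: s)
    case 0
    then show ?case by (simp add: sol_initial)
  next
    case (Suc n)
    define r where "r = max 0 (s - h)"
    have "(s - r) * l \<le> h * l" using Suc.prems h assms(2) by (intro mult_right_mono) (auto simp: r_def)
    then have "(s - r) * l \<le> 1 / 2" using h by simp
    moreover have "usol r l \<noteq> 0 \<or> vsol r l \<noteq> 0"
      using Suc.prems h by (intro Suc.IH) (auto simp: r_def algebra_simps)
    ultimately show ?case
      using sol_zero_propagates[of r s l] Suc.prems h assms(2) by (auto simp: r_def)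
  qed
  obtain n where "x / h \<le> real n" using real_arch_simple by blast
  then have "x \<le> real n * h" using h by (simp add: field_simps)
  with main assms(1) show ?thesis by blast
qed

text \<open>A positive solution is concave. On the middle part it is hence at least \<open>\<delta>\<close> times
  \<open>B = max (U \<alpha>) (U \<beta>)\<close>, so its slope drops there by at least \<open>l\<delta>B\<close> times the mass; but by the
  distance to the end points the slope can drop by at most \<open>2B/(\<delta>(b - a))\<close>.\<close>

lemma concave_drop:
  fixes c :: real
  assumes ord: "0 \<le> a" "a < \<alpha>" "\<alpha> \<le> \<beta>" "\<beta> < b" "b \<le> 1" and l: "l \<ge> 0"
    and \<delta>: "\<delta> > 0" "\<delta> * (b - a) \<le> \<alpha> - a" "\<delta> * (b - a) \<le> b - \<beta>"
    and pos: "\<And>t. t \<in> {a<..<b} \<Longrightarrow> c * usol t l > 0"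
  shows "l * \<delta>\<^sup>2 * (b - a) * prob {\<alpha>..\<beta>} \<le> 2"
proof -
  define U V where "U t = c * usol t l" and "V t = c * vsol t l" for t
  have Upos: "U t > 0" if "t \<in> {a<..<b}" for t using pos[OF that] by (simp add: U_def)
  \<comment> \<open>The sign is known only inside the interval; the end points, where
    \<open>u\<close> may vanish, follow by continuity.\<close>
  have Unn: "U t \<ge> 0" if "t \<in> {a..b}" for t
  proof (rule continuous_ge_on_closure[where f = U and S = "{a<..<b}"])
    show "continuous_on (closure {a<..<b}) U"
      using ord l continuous_on_subset[OF continuous_sol(1)[OF l], of "{a..b}"]
      unfolding U_def[abs_def] by (intro continuous_intros) auto
    show "t \<in> closure {a<..<b}" using that ord by simp
  qed (use Upos in \<open>auto intro: less_imp_le\<close>)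
  have Vdec: "V y \<le> V x" if "a \<le> x" "x \<le> y" "y \<le> b" for x y
    using vsol_drop_ge[of x y l 0 c] that ord l Unn by (auto simp: U_def V_def algebra_simps)
  have mvt: "\<exists>z. x < z \<and> z < y \<and> U y - U x = (y - x) * V z" if "a \<le> x" "x < y" "y \<le> b" for x y
  proof -
    have "0 \<le> x" "x < y" "y \<le> 1" using that ord by auto
    then obtain z where z: "x < z" "z < y" "usol y l - usol x l = (y - x) * vsol z l"
      using MVT_usol by blast
    have "U y - U x = c * (usol y l - usol x l)" by (simp add: U_def right_diff_distrib)
    also have "\<dots> = (y - x) * V z" unfolding z(3) by (simp add: V_def mult.left_commute)
    finally show ?thesis using z by blast
  qed
  have left: "(\<alpha> - a) * V \<alpha> \<le> U \<alpha>"
  proof -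
    obtain z where z: "a < z" "z < \<alpha>" "U \<alpha> - U a = (\<alpha> - a) * V z" using mvt[of a \<alpha>] ord by auto
    have "(\<alpha> - a) * V \<alpha> \<le> (\<alpha> - a) * V z" using ord z by (intro mult_left_mono Vdec) auto
    moreover have "0 \<le> U a" using Unn[of a] ord by simp
    ultimately show ?thesis using z(3) by linarith
  qed
  have right: "- (b - \<beta>) * V \<beta> \<le> U \<beta>"
  proof -
    obtain z where z: "\<beta> < z" "z < b" "U b - U \<beta> = (b - \<beta>) * V z" using mvt[of \<beta> b] ord by auto
    have "(b - \<beta>) * V z \<le> (b - \<beta>) * V \<beta>" using ord z by (intro mult_left_mono Vdec) auto
    moreover have "0 \<le> U b" using Unn[of b] ord by simp
    ultimately show ?thesis using z(3) by (simp add: algebra_simps)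
  qed
  \<comment> \<open>Concavity as comparison of adjacent chord slopes, multiplied out to avoid
    divisions.\<close>
  have conc: "(U y - U x) * (w - y) \<ge> (U w - U y) * (y - x)" if xyw: "a \<le> x" "x < y" "y < w" "w \<le> b" for x y w
  proof -
    obtain z1 where z1: "x < z1" "z1 < y" "U y - U x = (y - x) * V z1" using mvt[of x y] xyw by auto
    obtain z2 where z2: "y < z2" "z2 < w" "U w - U y = (w - y) * V z2" using mvt[of y w] xyw by auto
    have "(y - x) * (w - y) * V z2 \<le> (y - x) * (w - y) * V z1"
      using xyw z1 z2 by (intro mult_left_mono Vdec mult_nonneg_nonneg) auto
    then show ?thesis unfolding z1(3) z2(3) by (simp add: mult.commute mult.left_commute)
  qed
  define B where "B = max (U \<alpha>) (U \<beta>)"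
  have B: "B > 0" using Upos[of \<alpha>] ord by (auto simp: B_def)
  have low: "\<delta> * B \<le> U t" if t: "t \<in> {\<alpha>..\<beta>}" for t
  proof -
    have d1: "\<delta> \<le> 1"
    proof (rule ccontr)
      assume "\<not> \<delta> \<le> 1"
      then have "1 * (b - a) < \<delta> * (b - a)" using ord by (intro mult_strict_right_mono) auto
      from less_le_trans[OF this \<delta>(2)] show False using ord by simp
    qed
    \<comment> \<open>The chord from \<open>\<alpha>\<close> to \<open>b\<close>, with
      \<open>U b \<ge> 0\<close>, gives
      \<open>U t * (b - \<alpha>) \<ge> U \<alpha> * (b - t)\<close>, and \<open>b - t\<close> is at
      least \<open>\<delta> * (b - a)\<close>. The bound by \<open>U \<beta>\<close> is the mirror
      image, with the chord from \<open>a\<close>.\<close>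
    have U\<alpha>: "\<delta> * U \<alpha> \<le> U t"
    proof (cases "t = \<alpha>")
      case False
      have c: "(U t - U \<alpha>) * (b - t) \<ge> (U b - U t) * (t - \<alpha>)" using False t ord by (intro conc) auto
      have "(\<delta> * (b - a)) * U \<alpha> \<le> (b - t) * U \<alpha>"
        using \<delta> t Unn[of \<alpha>] ord by (intro mult_right_mono) auto
      also have "\<dots> \<le> U t * (b - \<alpha>)"
        using c mult_nonneg_nonneg[OF Unn[of b], of "t - \<alpha>"] t ord by (simp add: algebra_simps)
      also have "\<dots> \<le> U t * (b - a)" using Unn[of t] t ord by (intro mult_left_mono) auto
      finally have "(\<delta> * U \<alpha>) * (b - a) \<le> U t * (b - a)" by (simp add: mult.commute mult.left_commute)
      then show ?thesis using ord by simp
    next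
      case True
      then show ?thesis using d1 Unn[of \<alpha>] ord by (simp add: mult_left_le_one_le \<delta>(1) less_imp_le)
    qed
    have U\<beta>: "\<delta> * U \<beta> \<le> U t"
    proof (cases "t = \<beta>")
      case False
      have c: "(U t - U a) * (\<beta> - t) \<ge> (U \<beta> - U t) * (t - a)" using False t ord by (intro conc) auto
      have "(\<delta> * (b - a)) * U \<beta> \<le> (t - a) * U \<beta>"
        using \<delta> t Unn[of \<beta>] ord by (intro mult_right_mono) auto
      also have "\<dots> \<le> U t * (\<beta> - a)"
        using c mult_nonneg_nonneg[OF Unn[of a], of "\<beta> - t"] t ord by (simp add: algebra_simps)
      also have "\<dots> \<le> U t * (b - a)" using Unn[of t] t ord by (intro mult_left_mono) auto
      finally have "(\<delta> * U \<beta>) * (b - a) \<le> U t * (b - a)" by (simp add: mult.commute mult.left_commute)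
      then show ?thesis using ord by simp
    next
      case True
      then show ?thesis using d1 Unn[of \<beta>] ord by (simp add: mult_left_le_one_le \<delta>(1) less_imp_le)
    qed
    from U\<alpha> U\<beta> show ?thesis by (auto simp: B_def max_def)
  qed
  have "l * (\<delta> * B * prob {\<alpha>..\<beta>}) \<le> V \<alpha> - V \<beta>"
    using vsol_drop_ge[of \<alpha> \<beta> l "\<delta> * B" c] ord l low by (auto simp: U_def V_def algebra_simps)
  then have "(\<delta> * (b - a)) * (l * (\<delta> * B * prob {\<alpha>..\<beta>})) \<le> (\<delta> * (b - a)) * (V \<alpha> - V \<beta>)"
    using \<delta> ord by (intro mult_left_mono) auto
  also have "\<dots> = (\<delta> * (b - a)) * V \<alpha> + (\<delta> * (b - a)) * (- V \<beta>)" by (simp add: algebra_simps)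
  also have "\<dots> \<le> U \<alpha> + U \<beta>"
  proof (rule add_mono)
    \<comment> \<open>\<open>left\<close> has the larger factor \<open>\<alpha> - a\<close>;
      replacing it by \<open>\<delta> * (b - a)\<close> is sound only for a nonnegative slope, and
      for a negative one the claim is trivial.\<close>
    show "(\<delta> * (b - a)) * V \<alpha> \<le> U \<alpha>"
    proof (cases "V \<alpha> \<ge> 0")
      case True
      then have "(\<delta> * (b - a)) * V \<alpha> \<le> (\<alpha> - a) * V \<alpha>" using \<delta> by (intro mult_right_mono) auto
      with left show ?thesis by simp
    next
      case False
      then have "(\<delta> * (b - a)) * V \<alpha> \<le> 0" using \<delta> ord by (intro mult_nonneg_nonpos) auto
      with Unn[of \<alpha>] ord show ?thesis by simp
    qed
    show "(\<delta> * (b - a)) * (- V \<beta>) \<le> U \<beta>"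
    proof (cases "V \<beta> \<le> 0")
      case True
      then have "(\<delta> * (b - a)) * (- V \<beta>) \<le> (b - \<beta>) * (- V \<beta>)" using \<delta> by (intro mult_right_mono) auto
      with right show ?thesis by (simp add: algebra_simps)
    next
      case False
      then have "(\<delta> * (b - a)) * (- V \<beta>) \<le> 0" using \<delta> ord by (intro mult_nonneg_nonpos) auto
      with Unn[of \<beta>] ord show ?thesis by simp
    qed
  qed
  also have "\<dots> \<le> 2 * B" by (auto simp: B_def)
  finally have "(l * \<delta>\<^sup>2 * (b - a) * prob {\<alpha>..\<beta>}) * B \<le> 2 * B"
    by (simp add: power2_eq_square mult.assoc mult.commute mult.left_commute)
  then show ?thesis using B by simp
qed

lemma usol_zero_in_interval:
  assumes ord: "0 \<le> a" "a < \<alpha>" "\<alpha> \<le> \<beta>" "\<beta> < b" "b \<le> 1" and l: "l \<ge> 0"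
    and \<delta>: "\<delta> > 0" "\<delta> * (b - a) \<le> \<alpha> - a" "\<delta> * (b - a) \<le> b - \<beta>"
    and big: "l * \<delta>\<^sup>2 * (b - a) * prob {\<alpha>..\<beta>} > 2"
  shows "\<exists>z\<in>{a<..<b}. usol z l = 0"
proof (rule ccontr)
  assume nz: "\<not> (\<exists>z\<in>{a<..<b}. usol z l = 0)"
  \<comment> \<open>Without a zero, \<open>u\<close> keeps its sign from the point
    \<open>\<alpha>\<close> throughout the interval, since images of intervals are connected. So
    \<open>c * u\<close> is positive and \<open>concave_drop\<close> applies.\<close>
  define c where "c = sgn (usol \<alpha> l)"
  have "c * usol t l > 0" if t: "t \<in> {a<..<b}" for t
  proof (rule ccontr)
    assume neg: "\<not> c * usol t l > 0"
    have "usol \<alpha> l \<noteq> 0" using nz ord by auto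
    have "usol t l \<noteq> 0" using nz t by auto
    let ?I = "{min \<alpha> t..max \<alpha> t}"
    have sub: "?I \<subseteq> {a<..<b}" using t ord by auto
    then have "continuous_on ?I (\<lambda>x. usol x l)"
      using ord by (intro continuous_on_subset[OF continuous_sol(1)[OF l]]) force
    then have "connected ((\<lambda>x. usol x l) ` ?I)" by (intro connected_continuous_image) auto
    moreover have "usol \<alpha> l \<in> (\<lambda>x. usol x l) ` ?I" "usol t l \<in> (\<lambda>x. usol x l) ` ?I" by auto
    moreover have "usol \<alpha> l \<le> 0 \<and> 0 \<le> usol t l \<or> usol t l \<le> 0 \<and> 0 \<le> usol \<alpha> l"
      using neg \<open>usol \<alpha> l \<noteq> 0\<close> by (auto simp: c_def sgn_if split: if_splits)
    ultimately have "0 \<in> (\<lambda>x. usol x l) ` ?I" unfolding connected_iff_interval by blast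
    with sub nz show False by force
  qed
  from concave_drop[OF ord l \<delta> this] big show False by simp
qed

lemma vsol_W12: "l \<ge> 0 \<Longrightarrow> W12_unit (\<lambda>x. usol x l) (\<lambda>x. vsol x l)"
  unfolding W12_unit_def L2_unit_def
proof (intro conjI ballI)
  assume l: "l \<ge> 0"
  have int: "set_integrable lborel {0..1} f" if "continuous_on {0..1} f" for f :: "real \<Rightarrow> real"
    unfolding set_integrable_def using borel_integrable_compact[of "{0..1}" f] that
    by (simp add: if_distrib indicator_def cong: if_cong)
  show "set_integrable lborel {0..1} (\<lambda>x. (vsol x l)\<^sup>2)"
    using l by (intro int continuous_intros continuous_sol)
  show "set_borel_measurable lborel {0..1} (\<lambda>x. vsol x l)"
    using int[OF continuous_sol(2)[OF l]] unfolding set_integrable_def set_borel_measurable_def by auto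
  fix x :: real assume x: "x \<in> {0..1}"
  have "((\<lambda>x. vsol x l) has_integral usol x l - usol 0 l) {0..x}"
    using x DERIV_subset[OF deriv_usol, of _ "{0..x}" l]
    by (intro fundamental_theorem_of_calculus) (auto simp flip: has_real_derivative_iff_has_vector_derivative)
  moreover have "(LINT t:{0..x}|lborel. vsol t l) = integral {0..x} (\<lambda>t. vsol t l)"
    using x set_integrable_subset[OF int[OF continuous_sol(2)[OF l]], of "{0..x}"]
    by (intro set_borel_integral_eq_integral) auto
  ultimately show "usol x l = usol 0 l + (LINT t:{0..x}|lborel. vsol t l)"
    by (simp add: integral_unique)
qed

text \<open>Integration by parts against \<open>M\<close>: write \<open>v\<close> as an integral
  over \<open>t \<le> x\<close>, apply Fubini on this triangle, and integrate \<open>\<eta>'\<close>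
  over \<open>{t..1}\<close>. The boundary term \<open>vsol 1 l * \<eta> 1\<close> is the
  obstruction to being an eigenfunction.\<close>

lemma weak_form_vsol:
  assumes l: "l \<ge> 0" and \<eta>: "W12_unit \<eta> \<eta>'"
  shows "(LINT x:{0..1}|lborel. vsol x l * \<eta>' x) =
    vsol 1 l * \<eta> 1 + l * (LINT x|M. usol x l * \<eta> x)"
proof -
  interpret P: pair_sigma_finite M lborel ..
  define e where "e x = indicator {0..1} x * \<eta>' x" for x
  have d: "L2_unit \<eta>'" using W12_unitD(1)[OF \<eta>] .
  have e: "integrable lborel e"
    using L2_unit_integrable[OF d] by (simp add: e_def[abs_def] set_integrable_def)
  have u: "integrable M (\<lambda>t. usol t l)" using continuous_sol(1)[OF l] by (rule continuous_integrable)
  \<comment> \<open>Needed for the triangle: the first factor carries the restricted Borel sets, the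
    second the full ones.\<close>
  have [measurable]: "(\<lambda>t. t) \<in> borel_measurable M" by (rule continuous_measurable) auto
  have [measurable]: "e \<in> borel_measurable borel" "(\<lambda>t. usol t l) \<in> borel_measurable M" using e u by auto
  have "integrable (M \<Otimes>\<^sub>M lborel) (\<lambda>(t, x). usol t l * e x)"
  proof (rule P.Fubini_integrable)
    show "integrable M (\<lambda>t. LINT x|lborel. norm (case (t, x) of (t, x) \<Rightarrow> usol t l * e x))"
      using u by (simp add: abs_mult)
    show "AE t in M. integrable lborel (\<lambda>x. case (t, x) of (t, x) \<Rightarrow> usol t l * e x)"
      using e by simp
  qed measurable
  then have "integrable (M \<Otimes>\<^sub>M lborel) (\<lambda>p. indicator {p \<in> space (M \<Otimes>\<^sub>M lborel). fst p \<le> snd p} p *\<^sub>R (case p of (t, x) \<Rightarrow> usol t l * e x))"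
    by (rule integrable_mult_indicator[rotated]) measurable
  then have P: "integrable (M \<Otimes>\<^sub>M lborel) (\<lambda>(t, x). indicator {..x} t * (usol t l * e x))"
    by (rule Bochner_Integration.integrable_cong[THEN iffD1, OF refl, rotated])
      (auto simp: space_pair_measure indicator_def)
  have "(LINT x:{0..1}|lborel. vsol x l * \<eta>' x) =
      (LINT x|lborel. - l * (LINT t|M. indicator {..x} t * (usol t l * e x)))"
    unfolding set_lebesgue_integral_def
  proof (rule Bochner_Integration.integral_cong[OF refl])
    fix x :: real
    show "indicator {0..1} x *\<^sub>R (vsol x l * \<eta>' x) = - l * (LINT t|M. indicator {..x} t * (usol t l * e x))"
    proof (cases "x \<in> {0..1}")
      case True
      have "(LINT t|M. indicator {..x} t * (usol t l * e x)) = (LINT t|M. (indicator {0..x} t * usol t l) * \<eta>' x)"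
        using True by (intro Bochner_Integration.integral_cong) (auto simp: space_unit e_def indicator_def)
      also have "\<dots> = (LINT t:{0..x}|M. usol t l) * \<eta>' x"
        unfolding set_lebesgue_integral_def by simp
      finally show ?thesis using True by (simp add: vsol_eq[OF True l])
    qed (simp add: e_def)
  qed
  also have "\<dots> = - l * (LINT x|lborel. (LINT t|M. indicator {..x} t * (usol t l * e x)))" by simp
  also have "(LINT x|lborel. (LINT t|M. indicator {..x} t * (usol t l * e x))) =
      (LINT t|M. (LINT x|lborel. indicator {..x} t * (usol t l * e x)))"
    using P by (rule P.Fubini_integral)
  also have "\<dots> = (LINT t|M. usol t l * (\<eta> 1 - \<eta> t))"
  proof (rule Bochner_Integration.integral_cong[OF refl])
    fix t assume "t \<in> space M"
    then have t: "t \<in> {0..1}" by (simp add: space_unit)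
    have "(LINT x|lborel. indicator {..x} t * (usol t l * e x)) = (LINT x|lborel. usol t l * (indicator {t..1} x * \<eta>' x))"
      using t by (intro Bochner_Integration.integral_cong) (auto simp: e_def indicator_def)
    also have "\<dots> = usol t l * (LINT x:{t..1}|lborel. \<eta>' x)"
      by (simp add: set_lebesgue_integral_def)
    also have "\<dots> = usol t l * (\<eta> 1 - \<eta> t)" using W12_unit_diff[OF \<eta>, of t 1] t by simp
    finally show "(LINT x|lborel. indicator {..x} t * (usol t l * e x)) = usol t l * (\<eta> 1 - \<eta> t)" .
  qed
  also have "\<dots> = (LINT t|M. usol t l * \<eta> 1 - usol t l * \<eta> t)" by (simp add: right_diff_distrib)
  also have "\<dots> = (LINT t|M. usol t l) * \<eta> 1 - (LINT t|M. usol t l * \<eta> t)"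
    using u W12_mult_integrable[OF vsol_W12[OF l] \<eta>] by (subst Bochner_Integration.integral_diff) auto
  also have "(LINT t|M. usol t l) = (LINT t:{0..1}|M. usol t l)"
    unfolding set_lebesgue_integral_def by (intro Bochner_Integration.integral_cong) (auto simp: space_unit)
  also have "- l * ((LINT t:{0..1}|M. usol t l) * \<eta> 1 - (LINT t|M. usol t l * \<eta> t)) =
      (- l * (LINT t:{0..1}|M. usol t l)) * \<eta> 1 + l * (LINT t|M. usol t l * \<eta> t)"
    by (simp add: algebra_simps)
  also have "- l * (LINT t:{0..1}|M. usol t l) = vsol 1 l" using vsol_eq[of 1 l] l by simp
  finally show ?thesis .
qed

lemma neumann_eigenvalue_if_vsol_zero:
  assumes "l \<ge> 0" "vsol 1 l = 0" shows "neumann_eigenvalue M l"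
  unfolding neumann_eigenvalue_def using vsol_W12[OF assms(1)] weak_form_vsol[OF assms(1)] assms(2)
  by (intro exI[of _ "\<lambda>x. usol x l"] exI[of _ "\<lambda>x. vsol x l"]) (auto simp: sol_initial intro!: bexI[of _ 0])

theorem eigenvalue_count_ge_intervals:
  assumes fin: "finite J" and l: "l \<ge> 0" and \<delta>: "\<delta> > 0"
    and ord: "\<And>j. j \<in> J \<Longrightarrow> 0 \<le> a j \<and> a j < \<alpha> j \<and> \<alpha> j \<le> \<beta> j \<and> \<beta> j < b j \<and> b j \<le> 1"
    and margin: "\<And>j. j \<in> J \<Longrightarrow> \<delta> * (b j - a j) \<le> \<alpha> j - a j \<and> \<delta> * (b j - a j) \<le> b j - \<beta> j"
    and big: "\<And>j. j \<in> J \<Longrightarrow> l * \<delta>\<^sup>2 * (b j - a j) * prob {\<alpha> j..\<beta> j} > 2"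
    and disj: "disjoint_family_on (\<lambda>j. {a j<..<b j}) J"
  shows "of_nat (card J) \<le> eigenvalue_count l M"
proof -
  have "\<forall>j\<in>J. \<exists>z. z \<in> {a j<..<b j} \<and> usol z l = 0"
    using usol_zero_in_interval[OF _ _ _ _ _ l \<delta>] ord margin big by (metis (no_types, lifting))
  then obtain z where z: "\<And>j. j \<in> J \<Longrightarrow> z j \<in> {a j<..<b j} \<and> usol (z j) l = 0" by metis
  \<comment> \<open>The zeros lie in disjoint open intervals, so there are as many zeros as
    intervals.\<close>
  have inj: "inj_on z J"
    using z disj unfolding inj_on_def disjoint_family_on_def by (metis IntI empty_iff)
  have "\<exists>E\<subseteq>{0..<l}. finite E \<and> card E = card (z ` J) \<and> (\<forall>k\<in>E. vsol 1 k = 0)"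
  proof (rule oscillation_count[OF l continuous_usol continuous_vsol])
    show "z ` J \<subseteq> {0..1}" using z ord by force
  qed (use sol_nonzero sol_initial deriv_usol z fin in auto)
  then obtain E where E: "E \<subseteq> {0..<l}" "finite E" "card E = card J" "\<And>k. k \<in> E \<Longrightarrow> vsol 1 k = 0"
    using card_image[OF inj] by auto
  show ?thesis unfolding E(3)[symmetric]
    using E by (intro eigenvalue_count_ge_card neumann_eigenvalue_if_vsol_zero conjI) auto
qed

end

section \<open>Self-similar systems and their cylinders\<close>

text \<open>A continuous injection of an interval is strictly monotone. The minimum and maximum are
  there because both the contractions and \<open>g\<close> may reverse orientation.\<close>

lemma continuous_inj_image_Icc:
  fixes h :: "real \<Rightarrow> real"
  assumes h: "continuous_on {0..1} h" "inj_on h {0..1}" and st: "0 \<le> s" "s < t" "t \<le> 1"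
  shows "h ` {s..t} = {min (h s) (h t)..max (h s) (h t)}"
    "h ` {s<..<t} = {min (h s) (h t)<..<max (h s) (h t)}"
proof -
  have c: "continuous_on {s..t} h" and i: "inj_on h {s..t}"
    using continuous_on_subset[OF h(1), of "{s..t}"] inj_on_subset[OF h(2), of "{s..t}"] st by auto
  have mid: "h x \<in> {min (h s) (h t)<..<max (h s) (h t)}" if "x \<in> {s<..<t}" for x
    using continuous_inj_imp_mono[of s x t h] c i that by auto
  have "connected (h ` {s..t})" using c by (rule connected_continuous_image) auto
  moreover have "min (h s) (h t) \<in> h ` {s..t}" "max (h s) (h t) \<in> h ` {s..t}"
    using st by (auto simp: min_def max_def)
  ultimately have sup: "{min (h s) (h t)..max (h s) (h t)} \<subseteq> h ` {s..t}"
    by (rule connected_contains_Icc)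
  have sub: "h x \<in> {min (h s) (h t)..max (h s) (h t)}" if "x \<in> {s..t}" for x
    using mid[of x] that by (cases "x = s \<or> x = t") (auto simp: less_imp_le)
  show "h ` {s..t} = {min (h s) (h t)..max (h s) (h t)}" using sub sup by blast
  show "h ` {s<..<t} = {min (h s) (h t)<..<max (h s) (h t)}"
  proof (intro equalityI subsetI)
    fix y assume y: "y \<in> {min (h s) (h t)<..<max (h s) (h t)}"
    then obtain x where x: "x \<in> {s..t}" "y = h x"
      using sup by (metis atLeastAtMost_iff greaterThanLessThan_iff imageE less_imp_le subsetD)
    then have "x \<noteq> s" "x \<noteq> t" using y by auto
    with x show "y \<in> h ` {s<..<t}" by auto
  qed (use mid in auto)
qed

locale similarity =
  fixes m :: nat and S :: "nat \<Rightarrow> real \<Rightarrow> real" and \<rho> :: "nat \<Rightarrow> real"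
  assumes system: "similarity_system m S \<rho>"
begin

text \<open>The absolute slope of the affine map, hence the length of its image; read off from the
  end points, it requires no choice of coefficients.\<close>

definition ratio :: "nat \<Rightarrow> real" where "ratio i = \<bar>S i 1 - S i 0\<bar>"

lemma m_ge_2: "m \<ge> 2"
  using system by (simp add: similarity_system_def)

lemma rho_pos: "i \<in> {1..m} \<Longrightarrow> \<rho> i > 0"
  using system by (simp add: similarity_system_def)

lemma rho_sum: "(\<Sum>i=1..m. \<rho> i) = 1"
  using system by (simp add: similarity_system_def)

lemma S_maps: "i \<in> {1..m} \<Longrightarrow> x \<in> {0..1} \<Longrightarrow> S i x \<in> {0..1}"
proof -
  have "\<forall>i\<in>{1..m}. S i ` {0..1} \<subseteq> {0..1}" using system unfolding similarity_system_def by (elim conjE)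
  then show "i \<in> {1..m} \<Longrightarrow> x \<in> {0..1} \<Longrightarrow> S i x \<in> {0..1}" by blast
qed

lemma S_interiors:
  assumes "i \<in> {1..m}" "j \<in> {1..m}" "i \<noteq> j"
  shows "interior (S i ` {0..1}) \<inter> interior (S j ` {0..1}) = {}"
proof -
  have "\<forall>i\<in>{1..m}. \<forall>j\<in>{1..m}. i \<noteq> j \<longrightarrow> interior (S i ` {0..1}) \<inter> interior (S j ` {0..1}) = {}"
    using system unfolding similarity_system_def by (elim conjE)
  with assms show ?thesis by blast
qed

lemma
  assumes i: "i \<in> {1..m}"
  shows ratio_pos: "0 < ratio i" and ratio_less_1: "ratio i < 1"
    and S_dist: "x \<in> {0..1} \<Longrightarrow> y \<in> {0..1} \<Longrightarrow> \<bar>S i x - S i y\<bar> = ratio i * \<bar>x - y\<bar>"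
proof -
  obtain a b where ab: "a \<noteq> 0" "\<bar>a\<bar> < 1" "\<And>x. x \<in> {0..1} \<Longrightarrow> S i x = a * x + b"
  proof -
    have "\<forall>i\<in>{1..m}. \<exists>a b. a \<noteq> 0 \<and> \<bar>a\<bar> < 1 \<and> (\<forall>x\<in>{0..1}. S i x = a * x + b)"
      using system unfolding similarity_system_def by (elim conjE)
    with i that show thesis by blast
  qed
  have r: "ratio i = \<bar>a\<bar>" using ab(3)[of 0] ab(3)[of 1] by (simp add: ratio_def)
  then show "0 < ratio i" "ratio i < 1" using ab by auto
  show "\<bar>S i x - S i y\<bar> = ratio i * \<bar>x - y\<bar>" if "x \<in> {0..1}" "y \<in> {0..1}"
  proof -
    have "S i x - S i y = a * (x - y)" using ab(3) that by (simp add: algebra_simps)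
    then show ?thesis by (simp add: r abs_mult)
  qed
qed

lemma rho_le_1: "i \<in> {1..m} \<Longrightarrow> \<rho> i \<le> 1"
  using member_le_sum[of i "{1..m}" \<rho>] rho_pos rho_sum by (force simp: less_imp_le)

lemma S_inj: "i \<in> {1..m} \<Longrightarrow> inj_on (S i) {0..1}"
proof (rule inj_onI)
  fix x y assume *: "i \<in> {1..m}" "x \<in> {0..1}" "y \<in> {0..1}" "S i x = S i y"
  then have "ratio i * \<bar>x - y\<bar> = 0" using S_dist[of i x y] by simp
  then show "x = y" using ratio_pos[OF *(1)] by simp
qed

lemma S_continuous: "i \<in> {1..m} \<Longrightarrow> continuous_on {0..1} (S i)"
  by (rule lipschitz_on_continuous_on[of "ratio i"])
    (auto simp: lipschitz_on_def dist_real_def S_dist less_imp_le[OF ratio_pos])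

lemma S_open_image:
  assumes "i \<in> {1..m}"
  shows "open (S i ` {0<..<1})" "S i ` {0<..<1} \<subseteq> {0<..<1}"
    "S i ` {0..1} \<subseteq> closure (S i ` {0<..<1})"
proof -
  note im = continuous_inj_image_Icc[OF S_continuous[OF assms] S_inj[OF assms], of 0 1]
  show o: "open (S i ` {0<..<1})" using im by simp
  have "S i ` {0<..<1} \<subseteq> interior {0..1}"
    using S_maps[OF assms] o by (intro interior_maximal) (auto simp: image_subset_iff)
  then show "S i ` {0<..<1} \<subseteq> {0<..<1}" by simp
  have "S i 0 \<noteq> S i 1" using ratio_pos[OF assms] by (auto simp: ratio_def)
  then have "min (S i 0) (S i 1) < max (S i 0) (S i 1)" by (auto simp: min_def max_def)
  then show "S i ` {0..1} \<subseteq> closure (S i ` {0<..<1})" using im by simp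
qed

text \<open>An open set that misses another open set also misses its closure. Hence two of the
  segments can meet only in points that are end points of both.\<close>

lemma S_interior_disjoint:
  assumes "i \<in> {1..m}" "j \<in> {1..m}" "i \<noteq> j"
  shows "S i ` {0<..<1} \<inter> S j ` {0..1} = {}"
proof -
  have "S k ` {0<..<1} \<subseteq> interior (S k ` {0..1})" if "k \<in> {1..m}" for k
    using S_open_image[OF that] by (intro interior_maximal) auto
  then have "S i ` {0<..<1} \<inter> S j ` {0<..<1} = {}"
    using S_interiors[OF assms] assms by blast
  then have "S i ` {0<..<1} \<inter> closure (S j ` {0<..<1}) = {}"
    using S_open_image(1)[OF assms(1)] by (simp add: open_Int_closure_eq_empty)
  then show ?thesis using S_open_image(3)[OF assms(2)] by blast
qed

section \<open>Words and their cylinders\<close>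

fun word_map :: "nat list \<Rightarrow> real \<Rightarrow> real" where
  "word_map [] = (\<lambda>x. x)"
| "word_map (i # w) = S i \<circ> word_map w"

text \<open>Length times mass of the cylinder of \<open>w\<close> under the undeformed measure, once
  \<open>word_map_dist\<close> and \<open>prob_word_image\<close> are available.\<close>

definition weight :: "nat list \<Rightarrow> real" where
  "weight w = (\<Prod>i\<leftarrow>w. ratio i * \<rho> i)"

abbreviation words :: "nat list set" where "words \<equiv> lists {1..m}"

definition word_ratio :: "nat list \<Rightarrow> real" where "word_ratio w = (\<Prod>i\<leftarrow>w. ratio i)"

definition word_prob :: "nat list \<Rightarrow> real" where "word_prob w = (\<Prod>i\<leftarrow>w. \<rho> i)"

lemma weight_eq: "weight w = word_ratio w * word_prob w"
  by (induction w) (auto simp: weight_def word_ratio_def word_prob_def)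

lemma word_pos:
  assumes "w \<in> words" shows "word_ratio w > 0" "word_prob w > 0" "weight w > 0"
proof -
  show "word_ratio w > 0" "word_prob w > 0"
    using assms by (induction w) (auto simp: word_ratio_def word_prob_def intro!: mult_pos_pos ratio_pos rho_pos)
  then show "weight w > 0" by (simp add: weight_eq)
qed

lemma word_map_in: "w \<in> words \<Longrightarrow> x \<in> {0..1} \<Longrightarrow> word_map w x \<in> {0..1}"
  by (induction w arbitrary: x) (use S_maps in auto)

lemma word_map_image: "w \<in> words \<Longrightarrow> A \<subseteq> {0..1} \<Longrightarrow> word_map w ` A \<subseteq> {0..1}"
  using word_map_in by blast

lemma word_map_interior: "w \<in> words \<Longrightarrow> x \<in> {0<..<1} \<Longrightarrow> word_map w x \<in> {0<..<1}"
proof (induction w)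
  case (Cons i w)
  then show ?case using S_open_image(2)[of i] by (simp add: image_subset_iff)
qed simp

lemma word_map_dist:
  assumes "w \<in> words" "x \<in> {0..1}" "y \<in> {0..1}"
  shows "\<bar>word_map w x - word_map w y\<bar> = word_ratio w * \<bar>x - y\<bar>"
  using assms
proof (induction w)
  case (Cons i w)
  then show ?case
    using S_dist[of i "word_map w x" "word_map w y"] word_map_in by (simp add: word_ratio_def)
qed (simp add: word_ratio_def)

lemma word_map_continuous: "w \<in> words \<Longrightarrow> continuous_on {0..1} (word_map w)"
  by (rule lipschitz_on_continuous_on[of "word_ratio w"])
    (auto simp: lipschitz_on_def dist_real_def word_map_dist less_imp_le[OF word_pos(1)])

section \<open>Recursion and growth of the cut sets\<close>

definition cut_set :: "real \<Rightarrow> nat list set" where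
  "cut_set \<epsilon> = {w \<in> words. weight w \<le> \<epsilon> \<and> (\<forall>k<length w. \<epsilon> < weight (take k w))}"

lemma cut_set_words: "cut_set \<epsilon> \<subseteq> words"
  by (auto simp: cut_set_def)

lemma cut_set_ge_1: "\<epsilon> \<ge> 1 \<Longrightarrow> cut_set \<epsilon> = {[]}"
  by (force simp: cut_set_def weight_def)

lemma weight_letter_pos: "i \<in> {1..m} \<Longrightarrow> ratio i * \<rho> i > 0"
  by (simp add: ratio_pos rho_pos)

text \<open>For \<open>\<epsilon> < 1\<close> the empty word is still too heavy, so every word in
  the set has a first letter; removing it divides all weights, and hence the threshold, by the
  weight of that letter.\<close>

lemma cut_set_rec:
  assumes "\<epsilon> < 1"
  shows "cut_set \<epsilon> = (\<Union>i\<in>{1..m}. (#) i ` cut_set (\<epsilon> / (ratio i * \<rho> i)))"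
proof -
  have "w \<in> cut_set \<epsilon> \<longleftrightarrow> (\<exists>i\<in>{1..m}. \<exists>v. w = i # v \<and> v \<in> cut_set (\<epsilon> / (ratio i * \<rho> i)))" for w
  proof (cases w)
    case Nil
    then show ?thesis using assms by (simp add: cut_set_def weight_def)
  next
    case (Cons i v)
    have [simp]: "weight (i # u) = ratio i * \<rho> i * weight u" for u by (simp add: weight_def)
    have all: "(\<forall>k<length (i # v). \<epsilon> < weight (take k (i # v))) \<longleftrightarrow>
        (\<forall>k<length v. \<epsilon> < ratio i * \<rho> i * weight (take k v))"
      using assms by (simp add: All_less_Suc2 weight_def)
    have "i \<in> {1..m} \<Longrightarrow> (\<epsilon> < ratio i * \<rho> i * weight u \<longleftrightarrow> \<epsilon> / (ratio i * \<rho> i) < weight u) \<and>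
      (ratio i * \<rho> i * weight u \<le> \<epsilon> \<longleftrightarrow> weight u \<le> \<epsilon> / (ratio i * \<rho> i))" for u
      using weight_letter_pos[of i] by (simp add: pos_divide_less_eq pos_le_divide_eq mult.commute)
    then show ?thesis
      unfolding Cons cut_set_def mem_Collect_eq all by auto
  qed
  then show ?thesis by (auto simp: image_iff)
qed

definition rmax :: real where "rmax = Max ((\<lambda>i. ratio i * \<rho> i) ` {1..m})"

definition rmin :: real where "rmin = Min ((\<lambda>i. ratio i * \<rho> i) ` {1..m})"

lemma rmax: "i \<in> {1..m} \<Longrightarrow> ratio i * \<rho> i \<le> rmax" "0 < rmax" "rmax < 1"
  and rmin: "i \<in> {1..m} \<Longrightarrow> rmin \<le> ratio i * \<rho> i" "0 < rmin"
proof -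
  have ne: "(\<lambda>i. ratio i * \<rho> i) ` {1..m} \<noteq> {}" using m_ge_2 by auto
  have lt1: "ratio i * \<rho> i < 1" if "i \<in> {1..m}" for i
    using mult_less_le_imp_less[of "ratio i" 1 "\<rho> i" 1] ratio_less_1 ratio_pos rho_pos rho_le_1 that
    by (auto simp: less_imp_le)
  show "rmax < 1" unfolding rmax_def using ne lt1 by (subst Max_less_iff) auto
  show "0 < rmin" unfolding rmin_def using ne weight_letter_pos by (subst Min_gr_iff) auto
  show l: "i \<in> {1..m} \<Longrightarrow> ratio i * \<rho> i \<le> rmax" for i unfolding rmax_def by (intro Max_ge) auto
  show "i \<in> {1..m} \<Longrightarrow> rmin \<le> ratio i * \<rho> i" unfolding rmin_def by (intro Min_le) auto
  show "0 < rmax" using l[of 1] weight_letter_pos[of 1] m_ge_2 by auto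
qed

text \<open>Induction along this recursion. Each step divides the threshold by a letter weight, at
  most \<open>rmax < 1\<close>, so it exceeds 1 after finitely many steps.\<close>

lemma cut_induct [consumes 1, case_names ge less]:
  assumes "\<epsilon> > 0"
    and ge: "\<And>\<epsilon>. \<epsilon> \<ge> 1 \<Longrightarrow> P \<epsilon>"
    and less: "\<And>\<epsilon>. 0 < \<epsilon> \<Longrightarrow> \<epsilon> < 1 \<Longrightarrow> (\<And>i. i \<in> {1..m} \<Longrightarrow> P (\<epsilon> / (ratio i * \<rho> i))) \<Longrightarrow> P \<epsilon>"
  shows "P \<epsilon>"
proof -
  have main: "P \<delta>" if "rmax ^ n \<le> \<delta>" for n \<delta>
    using that
  proof (induction n arbitrary: \<delta>)
    case 0
    then show ?case by (simp add: ge)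
  next
    case (Suc n)
    have "0 < rmax ^ Suc n" using rmax(2) by simp
    with Suc.prems have pos: "0 < \<delta>" by linarith
    have "P (\<delta> / (ratio i * \<rho> i))" if i: "i \<in> {1..m}" for i
    proof (rule Suc.IH)
      have "rmax ^ n \<le> \<delta> / rmax" using Suc.prems rmax(2) by (simp add: pos_le_divide_eq mult.commute)
      also have "\<dots> \<le> \<delta> / (ratio i * \<rho> i)"
        using pos rmax(1)[OF i] weight_letter_pos[OF i] by (intro divide_left_mono) auto
      finally show "rmax ^ n \<le> \<delta> / (ratio i * \<rho> i)" .
    qed
    with pos show ?case by (cases "\<delta> \<ge> 1") (auto intro: ge less)
  qed
  obtain n where "rmax ^ n < \<epsilon>" using real_arch_pow_inv[OF assms(1) rmax(3)] by blast
  then show ?thesis by (intro main[of n]) auto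
qed

lemma cut_set_scale_pos: "0 < \<epsilon> \<Longrightarrow> i \<in> {1..m} \<Longrightarrow> 0 < \<epsilon> / (ratio i * \<rho> i)"
  using weight_letter_pos by simp

lemma finite_cut_set: "\<epsilon> > 0 \<Longrightarrow> finite (cut_set \<epsilon>)"
  by (induction rule: cut_induct) (auto simp: cut_set_ge_1 cut_set_rec)

lemma card_cut_set_rec:
  assumes "0 < \<epsilon>" "\<epsilon> < 1"
  shows "card (cut_set \<epsilon>) = (\<Sum>i=1..m. card (cut_set (\<epsilon> / (ratio i * \<rho> i))))"
proof -
  have "card (cut_set \<epsilon>) = (\<Sum>i=1..m. card ((#) i ` cut_set (\<epsilon> / (ratio i * \<rho> i))))"
    unfolding cut_set_rec[OF assms(2)] using assms
    by (intro card_UN_disjoint) (auto intro!: finite_imageI finite_cut_set cut_set_scale_pos)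
  then show ?thesis by (simp add: card_image)
qed

lemma card_cut_set_ge_1: "\<epsilon> > 0 \<Longrightarrow> card (cut_set \<epsilon>) \<ge> 1"
proof (induction rule: cut_induct)
  case (less \<epsilon>)
  have "1 \<le> card (cut_set (\<epsilon> / (ratio 1 * \<rho> 1)))" using less m_ge_2 by auto
  also have "\<dots> \<le> (\<Sum>i=1..m. card (cut_set (\<epsilon> / (ratio i * \<rho> i))))"
    using m_ge_2 by (intro member_le_sum) auto
  finally show ?case using less by (simp add: card_cut_set_rec)
qed (simp add: cut_set_ge_1)

text \<open>Induction on the larger threshold: as soon as it is below 1, so is the smaller one, and
  the same recursion applies to both.\<close>

lemma card_cut_set_antimono:
  assumes "0 < \<epsilon>" "\<epsilon> \<le> \<epsilon>'"
  shows "card (cut_set \<epsilon>') \<le> card (cut_set \<epsilon>)"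
proof -
  have "\<forall>\<epsilon>. 0 < \<epsilon> \<and> \<epsilon> \<le> \<epsilon>' \<longrightarrow> card (cut_set \<epsilon>') \<le> card (cut_set \<epsilon>)" if "\<epsilon>' > 0"
    using that
  proof (induction rule: cut_induct)
    case (ge \<epsilon>')
    then show ?case using card_cut_set_ge_1 by (simp add: cut_set_ge_1)
  next
    case (less \<epsilon>')
    show ?case
    proof (intro allI impI)
      fix \<epsilon> assume e: "0 < \<epsilon> \<and> \<epsilon> \<le> \<epsilon>'"
      have "card (cut_set (\<epsilon>' / (ratio i * \<rho> i))) \<le> card (cut_set (\<epsilon> / (ratio i * \<rho> i)))" if "i \<in> {1..m}" for i
      proof -
        have "\<epsilon> / (ratio i * \<rho> i) \<le> \<epsilon>' / (ratio i * \<rho> i)"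
          using e less_imp_le[OF weight_letter_pos[OF that]] by (intro divide_right_mono) auto
        with less.IH[OF that] e cut_set_scale_pos[OF _ that] show ?thesis by blast
      qed
      then show "card (cut_set \<epsilon>') \<le> card (cut_set \<epsilon>)"
        using less.hyps e by (auto simp: card_cut_set_rec intro!: sum_mono)
    qed
  qed
  then show ?thesis using assms by auto
qed

text \<open>The recursion is linear and commutes with scaling the threshold, so the factor
  \<open>m\<close> only has to be found for \<open>\<epsilon> \<ge> 1\<close>. There, if the scaled
  threshold is below 1, it is still at least \<open>rmax\<close>, and each of the \<open>m\<close>
  letters is already cut.\<close>

lemma card_cut_set_rmax: "\<epsilon> > 0 \<Longrightarrow> card (cut_set (\<epsilon> * rmax)) \<le> m * card (cut_set \<epsilon>)"
proof (induction rule: cut_induct)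
  case (ge \<epsilon>)
  show ?case
  proof (cases "\<epsilon> * rmax \<ge> 1")
    case True
    then show ?thesis using ge m_ge_2 by (simp add: cut_set_ge_1)
  next
    case False
    have "card (cut_set (\<epsilon> * rmax / (ratio i * \<rho> i))) = 1" if i: "i \<in> {1..m}" for i
    proof -
      have "ratio i * \<rho> i \<le> 1 * rmax" using rmax(1)[OF i] by simp
      also have "\<dots> \<le> \<epsilon> * rmax" using ge rmax(2) by (intro mult_right_mono) auto
      finally have "1 \<le> \<epsilon> * rmax / (ratio i * \<rho> i)"
        using weight_letter_pos[OF i] by (subst pos_le_divide_eq) auto
      then show ?thesis by (simp add: cut_set_ge_1)
    qed
    moreover have "0 < \<epsilon> * rmax" using ge rmax(2) by simp
    ultimately show ?thesis using False ge by (simp add: card_cut_set_rec cut_set_ge_1)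
  qed
next
  case (less \<epsilon>)
  have "\<epsilon> * rmax < 1" using less.hyps rmax mult_strict_mono[of \<epsilon> 1 rmax 1] by simp
  moreover have "0 < \<epsilon> * rmax" using less.hyps rmax by simp
  ultimately have "card (cut_set (\<epsilon> * rmax)) = (\<Sum>i=1..m. card (cut_set (\<epsilon> / (ratio i * \<rho> i) * rmax)))"
    by (simp add: card_cut_set_rec)
  also have "\<dots> \<le> (\<Sum>i=1..m. m * card (cut_set (\<epsilon> / (ratio i * \<rho> i))))"
    using less.IH by (intro sum_mono) auto
  also have "\<dots> = m * card (cut_set \<epsilon>)"
    using less.hyps by (simp add: card_cut_set_rec sum_distrib_left)
  finally show ?case .
qed

lemma card_cut_set_doubling:
  assumes "c > 0"
  obtains K :: nat where "K > 0" "\<And>\<epsilon>. \<epsilon> > 0 \<Longrightarrow> card (cut_set (\<epsilon> * c)) \<le> K * card (cut_set \<epsilon>)"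
proof -
  obtain n where n: "rmax ^ n < c" using real_arch_pow_inv[OF assms rmax(3)] by blast
  have it: "card (cut_set (\<epsilon> * rmax ^ k)) \<le> m ^ k * card (cut_set \<epsilon>)" if "\<epsilon> > 0" for k \<epsilon>
  proof (induction k)
    case (Suc k)
    have "card (cut_set (\<epsilon> * rmax ^ Suc k)) = card (cut_set (\<epsilon> * rmax ^ k * rmax))"
      by (simp add: mult_ac)
    also have "\<dots> \<le> m * card (cut_set (\<epsilon> * rmax ^ k))"
      using that rmax(2) by (intro card_cut_set_rmax) auto
    also have "\<dots> \<le> m * (m ^ k * card (cut_set \<epsilon>))" using Suc by (intro mult_left_mono) auto
    finally show ?case by (simp add: mult.assoc)
  qed simp
  show thesis
  proof
    show "m ^ n > 0" using m_ge_2 by simp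
    fix \<epsilon> :: real assume e: "\<epsilon> > 0"
    have "card (cut_set (\<epsilon> * c)) \<le> card (cut_set (\<epsilon> * rmax ^ n))"
      using n e rmax(2) by (intro card_cut_set_antimono) auto
    also have "\<dots> \<le> m ^ n * card (cut_set \<epsilon>)" using it[OF e] .
    finally show "card (cut_set (\<epsilon> * c)) \<le> m ^ n * card (cut_set \<epsilon>)" .
  qed
qed

lemma weight_cut_set_le: "w \<in> cut_set \<epsilon> \<Longrightarrow> weight w \<le> \<epsilon>"
  by (simp add: cut_set_def)

text \<open>The word without its last letter is a proper prefix, so it weighs more than
  \<open>\<epsilon>\<close>, and one letter costs at most the factor \<open>rmin\<close>.\<close>

lemma weight_cut_set_ge:
  assumes "w \<in> cut_set \<epsilon>" "0 < \<epsilon>" "\<epsilon> < 1"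
  shows "\<epsilon> * rmin \<le> weight w"
proof -
  have "w \<noteq> []" using assms by (auto simp: cut_set_def weight_def)
  then obtain v i where w: "w = v @ [i]" by (metis append_butlast_last_id)
  have "take (length v) w = v" "length v < length w" by (simp_all add: w)
  then have "\<epsilon> < weight v" using assms(1) unfolding cut_set_def by fastforce
  moreover have "i \<in> {1..m}" using assms(1) w by (auto simp: cut_set_def)
  moreover have "weight w = weight v * (ratio i * \<rho> i)" by (simp add: w weight_def)
  ultimately show ?thesis
    using rmin assms(2) by (auto intro!: mult_mono)
qed

lemma cut_set_disjoint:
  assumes "\<epsilon> > 0"
  shows "disjoint_family_on (\<lambda>w. word_map w ` {0<..<1}) (cut_set \<epsilon>)"
  using assms
proof (induction rule: cut_induct)
  case (ge \<epsilon>)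
  then show ?case by (simp add: cut_set_ge_1 disjoint_family_on_def)
next
  case (less \<epsilon>)
  have "word_map w ` {0<..<1} \<inter> word_map v ` {0<..<1} = {}"
    if wv: "w \<in> cut_set \<epsilon>" "v \<in> cut_set \<epsilon>" "w \<noteq> v" for w v
  proof -
    obtain i w' where w: "i \<in> {1..m}" "w = i # w'" "w' \<in> cut_set (\<epsilon> / (ratio i * \<rho> i))"
      using wv(1) unfolding cut_set_rec[OF less.hyps(2)] by auto
    obtain j v' where v: "j \<in> {1..m}" "v = j # v'" "v' \<in> cut_set (\<epsilon> / (ratio j * \<rho> j))"
      using wv(2) unfolding cut_set_rec[OF less.hyps(2)] by auto
    have sub: "word_map w' ` {0<..<1} \<subseteq> {0<..<1}" "word_map v' ` {0<..<1} \<subseteq> {0<..<1}"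
      using word_map_interior w(3) v(3) cut_set_words by blast+
    show ?thesis
    proof (cases "i = j")
      case True
      have "word_map w' ` {0<..<1} \<inter> word_map v' ` {0<..<1} = {}"
        using less.IH[OF w(1)] w v wv(3) True unfolding disjoint_family_on_def by blast
      moreover have "inj_on (S i) {0<..<1}" using S_inj[OF w(1)] by (rule inj_on_subset) auto
      ultimately have "S i ` (word_map w' ` {0<..<1}) \<inter> S i ` (word_map v' ` {0<..<1}) = {}"
        using inj_on_image_Int[of "S i" "{0<..<1}", OF _ sub] by simp
      then show ?thesis by (simp add: w(2) v(2) True image_comp)
    next
      case False
      have "S i ` {0<..<1} \<inter> S j ` {0<..<1} = {}"
        using S_interior_disjoint[OF w(1) v(1) False] by fastforce
      then have "S i ` (word_map w' ` {0<..<1}) \<inter> S j ` (word_map v' ` {0<..<1}) = {}"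
        using sub by blast
      then show ?thesis by (simp add: w(2) v(2) image_comp)
    qed
  qed
  then show ?case by (simp add: disjoint_family_on_def)
qed

end

section \<open>Self-similar measures\<close>

locale self_similar = similarity m S \<rho> + unit_prob_space M for m S \<rho> M +
  assumes self_sim: "self_similar_measure m S \<rho> M"
begin

lemma compact_in_sets: "compact A \<Longrightarrow> A \<subseteq> {0..1} \<Longrightarrow> A \<in> sets M"
  unfolding sets_unit by (auto simp: sets_restrict_space borel_compact image_iff intro!: bexI[of _ A])

lemma prob_eq: "E \<in> sets M \<Longrightarrow> prob E = (\<Sum>i=1..m. \<rho> i * prob (S i -` E \<inter> {0..1}))"
  using self_sim by (simp add: self_similar_measure_def)

lemma preimage_other:
  assumes "i \<in> {1..m}" "j \<in> {1..m}" "i \<noteq> j"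
  shows "S j -` (S i ` {0..1}) \<inter> {0..1} \<subseteq> {0, 1}"
proof
  fix x assume x: "x \<in> S j -` (S i ` {0..1}) \<inter> {0..1}"
  show "x \<in> {0, 1}"
  proof (rule ccontr)
    assume "x \<notin> {0, 1}"
    with x have "S j x \<in> S j ` {0<..<1} \<inter> S i ` {0..1}" by (auto simp: order_less_le)
    then show False using S_interior_disjoint[of j i] assms by auto
  qed
qed

lemma singleton_in_sets: "x \<in> {0..1} \<Longrightarrow> {x} \<in> sets M"
  by (rule compact_in_sets) auto

text \<open>By invariance \<open>p\<close> is the average, with positive weights
  \<open>\<rho> j\<close>, of the masses \<open>q j\<close> of the preimages. None exceeds the
  maximum \<open>p\<close>, so all are equal to it.\<close>

lemma max_atom_preimage:
  assumes max: "\<And>y. prob {y} \<le> p" and x: "x \<in> {0..1}" "prob {x} = p" and p: "p > 0" and i: "i \<in> {1..m}"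
  shows "\<exists>y\<in>{0..1}. S i y = x \<and> prob {y} = p"
proof -
  define q where "q j = prob (S j -` {x} \<inter> {0..1})" for j
  have q: "q j \<le> p" "q j > 0 \<Longrightarrow> \<exists>y\<in>{0..1}. S j y = x \<and> q j = prob {y}" if "j \<in> {1..m}" for j
  proof -
    have "(\<exists>y\<in>{0..1}. S j y = x \<and> q j = prob {y}) \<or> q j = 0"
    proof (cases "S j -` {x} \<inter> {0..1} = {}")
      case False
      then have "\<exists>y\<in>{0..1}. S j y = x" by blast
      then obtain y where y: "y \<in> {0..1}" "S j y = x" by blast
      then have "S j -` {x} \<inter> {0..1} = {y}" using inj_onD[OF S_inj[OF that]] by auto
      then show ?thesis using y by (auto simp: q_def)
    qed (simp add: q_def)
    then show "q j \<le> p" "q j > 0 \<Longrightarrow> \<exists>y\<in>{0..1}. S j y = x \<and> q j = prob {y}"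
      using max p by (auto simp: less_imp_le)
  qed
  have "p = (\<Sum>j=1..m. \<rho> j * q j)"
    using prob_eq[OF singleton_in_sets[OF x(1)]] x(2) by (simp add: q_def)
  then have "(\<Sum>j=1..m. \<rho> j * (p - q j)) = 0"
    using rho_sum by (simp add: right_diff_distrib sum_subtractf flip: sum_distrib_right)
  moreover have "\<forall>j\<in>{1..m}. 0 \<le> \<rho> j * (p - q j)" using q(1) rho_pos by (auto simp: less_imp_le)
  ultimately have "\<rho> i * (p - q i) = 0" using i by (subst (asm) sum_nonneg_eq_0_iff) auto
  then have "q i = p" using rho_pos[OF i] by simp
  then show ?thesis using q(2)[OF i] p by auto
qed

text \<open>An atom \<open>z\<close> of maximal mass has preimages of the same mass under
  \<open>S 1\<close> and under \<open>S 2\<close>, so it is a common point of both segments, and its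
  preimage \<open>e\<close> under \<open>S 1\<close> must be 0 or 1. But \<open>e\<close> is itself
  a heaviest atom, hence also common to both segments, and two segments in [0,1] without common
  interior points cannot share 0 or 1.\<close>

lemma no_atoms: "prob {x} = 0"
proof (rule ccontr)
  assume nz: "prob {x} \<noteq> 0"
  have pos: "prob {x} > 0" using nz by (simp add: zero_less_measure_iff)
  \<comment> \<open>Finite, since the total mass is 1; this makes the supremum of the atom masses a
    maximum.\<close>
  define B where "B = {y. prob {y} \<ge> prob {x}}"
  have B01: "B \<subseteq> {0..1}"
  proof
    fix y assume "y \<in> B"
    then have "prob {y} \<noteq> 0" using pos by (auto simp: B_def)
    then have "{y} \<in> sets M" using measure_notin_sets by blast
    then show "y \<in> {0..1}" using sets.sets_into_space[of "{y}" M] unfolding space_unit by blast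
  qed
  have "finite B"
  proof (rule ccontr)
    assume "infinite B"
    obtain n where n: "1 < real n * prob {x}" using reals_Archimedean3[OF pos] by blast
    obtain F where F: "F \<subseteq> B" "finite F" "card F = n"
      using infinite_arbitrarily_large[OF \<open>infinite B\<close>] by blast
    have "real n * prob {x} \<le> (\<Sum>y\<in>F. prob {y})"
      using F sum_bounded_below[of F "prob {x}" "\<lambda>y. prob {y}"] by (auto simp: B_def)
    also have "\<dots> = prob F"
      using F B01 singleton_in_sets by (intro finite_measure_eq_sum_singleton[symmetric]) auto
    also have "\<dots> \<le> 1" by simp
    finally show False using n by simp
  qed
  moreover have "x \<in> B" by (simp add: B_def)
  ultimately have fB: "finite ((\<lambda>y. prob {y}) ` B)" and "Max ((\<lambda>y. prob {y}) ` B) \<in> (\<lambda>y. prob {y}) ` B"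
    by (auto intro!: Max_in)
  then obtain z where zB: "z \<in> B" "Max ((\<lambda>y. prob {y}) ` B) = prob {z}" by blast
  have z: "z \<in> B" "\<And>y. y \<in> B \<Longrightarrow> prob {y} \<le> prob {z}"
    using zB(1) Max_ge[OF fB] unfolding zB(2) by blast+
  define p where "p = prob {z}"
  have max: "prob {y} \<le> p" for y
  proof (cases "y \<in> B")
    case False
    then have "prob {y} < prob {x}" "prob {x} \<le> prob {z}" using z(1) unfolding B_def by auto
    then show ?thesis unfolding p_def by linarith
  qed (simp add: z(2) p_def)
  have p: "p > 0" using z(1) pos by (auto simp: B_def p_def)
  have z01: "z \<in> {0..1}" using z(1) B01 by blast
  have one: "1 \<in> {1..m}" "2 \<in> {1..m}" using m_ge_2 by auto
  obtain e where e: "e \<in> {0..1}" "S 1 e = z" "prob {e} = p"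
    using max_atom_preimage[OF max z01 p_def[symmetric] p one(1)] by blast
  obtain f where f: "f \<in> {0..1}" "S 2 f = z"
    using max_atom_preimage[OF max z01 p_def[symmetric] p one(2)] by blast
  have e01: "e \<in> {0, 1}" using preimage_other[of 2 1] one e f by force
  have "\<exists>y\<in>{0..1}. S 1 y = e" "\<exists>y\<in>{0..1}. S 2 y = e"
    using max_atom_preimage[OF max e(1,3) p] one by blast+
  then have ein: "e \<in> S 1 ` {0..1}" "e \<in> S 2 ` {0..1}"
    unfolding image_iff by metis+
  have im: "\<exists>a b. S i ` {0..1} = {a..b} \<and> S i ` {0<..<1} = {a<..<b} \<and> a < b \<and> 0 \<le> a \<and> b \<le> 1" if i: "i \<in> {1..m}" for i
  proof -
    have "S i 0 \<noteq> S i 1" using ratio_pos[OF i] by (auto simp: ratio_def)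
    then show ?thesis
      using continuous_inj_image_Icc[OF S_continuous[OF i] S_inj[OF i], of 0 1] S_maps[OF i, of 0] S_maps[OF i, of 1]
      by (intro exI[of _ "min (S i 0) (S i 1)"] exI[of _ "max (S i 0) (S i 1)"]) (auto simp: min_def max_def)
  qed
  obtain a b where ab: "S 1 ` {0..1} = {a..b}" "S 1 ` {0<..<1} = {a<..<b}" "a < b" "0 \<le> a" "b \<le> 1"
    using im[OF one(1)] by blast
  obtain c d where cd: "S 2 ` {0..1} = {c..d}" "c < d" "0 \<le> c" "d \<le> 1" using im[OF one(2)] by blast
  have disj: "{a<..<b} \<inter> {c..d} = {}" using S_interior_disjoint[OF one] ab(2) cd(1) by simp
  \<comment> \<open>If both segments begin at 0, half of the smaller right end lies inside both; the
    case of a common right end 1 is symmetric.\<close>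
  have "(min b d) / 2 \<in> {a<..<b} \<inter> {c..d}" if "e = 0" using ein that ab cd by (auto simp: min_def)
  moreover have "(1 + max a c) / 2 \<in> {a<..<b} \<inter> {c..d}" if "e = 1" using ein that ab cd by (auto simp: max_def)
  ultimately show False using e01 disj by blast
qed

sublocale atomless_unit_prob M
  by unfold_locales (rule no_atoms)

text \<open>Under any other map the preimage of the image lies in the two end points, which are
  null, so one summand of the invariance equation survives. For compact sets measurability of the
  images comes for free.\<close>

lemma prob_S_image:
  assumes i: "i \<in> {1..m}" and A: "compact A" "A \<subseteq> {0..1}"
  shows "prob (S i ` A) = \<rho> i * prob A"
proof -
  have "compact (S i ` A)" using continuous_on_subset[OF S_continuous[OF i] A(2)] A(1) by (rule compact_continuous_image)
  moreover have "S i ` A \<subseteq> {0..1}" using S_maps[OF i] A(2) by (auto simp: image_subset_iff)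
  ultimately have s: "S i ` A \<in> sets M" by (rule compact_in_sets)
  have "S i -` (S i ` A) \<inter> {0..1} = A" using inj_onD[OF S_inj[OF i]] A(2) by blast
  moreover have "prob (S j -` (S i ` A) \<inter> {0..1}) = 0" if j: "j \<in> {1..m}" "j \<noteq> i" for j
  proof -
    have "S j -` (S i ` A) \<inter> {0..1} \<subseteq> {0} \<union> {1}" using preimage_other[OF i j(1)] j A(2) by blast
    then have "prob (S j -` (S i ` A) \<inter> {0..1}) \<le> prob ({0} \<union> {1})"
      by (intro finite_measure_mono sets.Un singleton_in_sets) auto
    also have "\<dots> \<le> prob {0} + prob {1}" by (intro measure_Un_le singleton_in_sets) auto
    finally show ?thesis by (simp add: no_atoms measure_le_0_iff)
  qed
  ultimately have "(\<Sum>j=1..m. \<rho> j * prob (S j -` (S i ` A) \<inter> {0..1})) = (\<Sum>j=1..m. if j = i then \<rho> i * prob A else 0)"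
    by (intro sum.cong) auto
  then show ?thesis using prob_eq[OF s] i by simp
qed

lemma compact_word_image: "w \<in> words \<Longrightarrow> compact A \<Longrightarrow> A \<subseteq> {0..1} \<Longrightarrow> compact (word_map w ` A)"
  using continuous_on_subset[OF word_map_continuous] compact_continuous_image by blast

lemma prob_word_image:
  assumes "w \<in> words" "compact A" "A \<subseteq> {0..1}"
  shows "prob (word_map w ` A) = word_prob w * prob A"
  using assms(1)
proof (induction w)
  case (Cons i w)
  have "prob (S i ` (word_map w ` A)) = \<rho> i * prob (word_map w ` A)"
    using Cons.hyps compact_word_image[OF Cons.hyps(2) assms(2,3)] word_map_image[OF Cons.hyps(2) assms(3)]
    by (intro prob_S_image) auto
  then show ?case using Cons.IH by (simp add: image_comp word_prob_def)
qed (simp add: word_prob_def)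

text \<open>Cylinders leave gaps in [0,1], so they cover only in the sense of mass. The preimage
  under \<open>S i\<close> of the union contains the union for the rescaled threshold, which has
  full mass by induction, and invariance averages these masses.\<close>

lemma cut_set_cover: "\<epsilon> > 0 \<Longrightarrow> prob (\<Union>w\<in>cut_set \<epsilon>. word_map w ` {0..1}) = 1"
proof (induction rule: cut_induct)
  case (ge \<epsilon>)
  then show ?case using prob_space space_unit by (simp add: cut_set_ge_1)
next
  case (less \<epsilon>)
  define U where "U \<delta> = (\<Union>w\<in>cut_set \<delta>. word_map w ` {0..1})" for \<delta>
  have U: "compact (U \<delta>) \<and> U \<delta> \<subseteq> {0..1}" if "\<delta> > 0" for \<delta>
  proof
    show "compact (U \<delta>)" unfolding U_def
      using compact_word_image[of _ "{0..1}"] subsetD[OF cut_set_words]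
      by (intro compact_UN finite_cut_set that) auto
    show "U \<delta> \<subseteq> {0..1}" unfolding U_def
      by (intro UN_least word_map_image subsetD[OF cut_set_words] order_refl)
  qed
  have Us: "U \<delta> \<in> sets M" if "\<delta> > 0" for \<delta> using U[OF that] compact_in_sets by blast
  have sub: "U (\<epsilon> / (ratio i * \<rho> i)) \<subseteq> S i -` U \<epsilon> \<inter> {0..1}" if i: "i \<in> {1..m}" for i
  proof -
    have "i # w \<in> cut_set \<epsilon>" if "w \<in> cut_set (\<epsilon> / (ratio i * \<rho> i))" for w
      unfolding cut_set_rec[OF less.hyps(2)] using i that by (intro UN_I[of i] imageI)
    then have "word_map (i # w) ` {0..1} \<subseteq> U \<epsilon>" if "w \<in> cut_set (\<epsilon> / (ratio i * \<rho> i))" for w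
      unfolding U_def using that by (intro UN_upper)
    then have "S i ` U (\<epsilon> / (ratio i * \<rho> i)) \<subseteq> U \<epsilon>"
      unfolding U_def[of "\<epsilon> / (ratio i * \<rho> i)"] image_UN by (intro UN_least) (simp add: image_comp)
    then show ?thesis using U[OF cut_set_scale_pos[OF less.hyps(1) i]] by blast
  qed
  have closed: "S i -` U \<epsilon> \<inter> {0..1} \<in> sets M" if "i \<in> {1..m}" for i
  proof -
    have "closed (S i -` U \<epsilon> \<inter> {0..1})"
      using continuous_closed_preimage[OF S_continuous[OF that], of "U \<epsilon>"] U[OF less.hyps(1)]
      by (simp add: compact_imp_closed Int_commute)
    then have "compact ({0..1} \<inter> (S i -` U \<epsilon> \<inter> {0..1}))" by (intro compact_Int_closed) auto
    then show ?thesis by (intro compact_in_sets) (auto simp: Int_commute Int_assoc)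
  qed
  have "1 = (\<Sum>i=1..m. \<rho> i * 1)" using rho_sum by simp
  also have "\<dots> = (\<Sum>i=1..m. \<rho> i * prob (U (\<epsilon> / (ratio i * \<rho> i))))"
    using less.IH by (intro sum.cong) (auto simp: U_def)
  also have "\<dots> \<le> (\<Sum>i=1..m. \<rho> i * prob (S i -` U \<epsilon> \<inter> {0..1}))"
    using rho_pos sub closed by (intro sum_mono mult_left_mono finite_measure_mono) (auto simp: less_imp_le)
  also have "\<dots> = prob (U \<epsilon>)" using prob_eq[OF Us[OF less.hyps(1)]] by simp
  finally have "prob (U \<epsilon>) = 1" by (intro antisym) auto
  then show ?case by (simp add: U_def)
qed

lemma ex_central_mass: "\<exists>\<theta>>0. \<theta> < 1 / 2 \<and> prob {\<theta>..1 - \<theta>} \<ge> 1 / 2"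
proof -
  \<comment> \<open>These intervals exhaust the open unit interval, which has full mass. The offset
    3 keeps the margin at most 1/3, thus below 1/2.\<close>
  define A where "A n = {1 / real (n + 3)..1 - 1 / real (n + 3)}" for n
  have "incseq A" unfolding A_def incseq_def by (auto intro!: divide_left_mono elim!: order_trans)
  have s: "range A \<subseteq> sets M" unfolding A_def by (auto intro!: interval_sets)
  have U: "(\<Union>n. A n) = {0<..<1}"
  proof (intro equalityI subsetI)
    fix x :: real assume x: "x \<in> {0<..<1}"
    then have "0 < min x (1 - x)" by simp
    then obtain n where n: "1 / real (Suc n) < min x (1 - x)"
      using reals_Archimedean[of "min x (1 - x)"] by (metis inverse_eq_divide)
    have "1 / real (n + 3) \<le> 1 / real (Suc n)" by (intro divide_left_mono) auto
    with n show "x \<in> (\<Union>n. A n)" by (intro UN_I[of n]) (auto simp: A_def)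
  next
    fix x assume "x \<in> (\<Union>n. A n)"
    then obtain n where "x \<in> A n" by blast
    moreover have "1 / real (n + 3) > 0" by simp
    ultimately show "x \<in> {0<..<1}" unfolding A_def by (simp only: atLeastAtMost_iff greaterThanLessThan_iff) linarith
  qed
  have "{0<..<1::real} = ({0..1} - {0}) - {1}" by auto
  moreover have "prob (({0..1} - {0}) - {1}) = 1"
    using singleton_in_sets[of 0] singleton_in_sets[of 1] interval_sets[of 0 1] prob_space space_unit
    by (subst finite_measure_Diff; (subst finite_measure_Diff)?) (auto simp: no_atoms)
  ultimately have "(\<lambda>n. prob (A n)) \<longlonglongrightarrow> 1"
    using finite_Lim_measure_incseq[OF s \<open>incseq A\<close>] U by simp
  then have "\<forall>\<^sub>F n in sequentially. prob (A n) > 1 / 2" by (rule order_tendstoD) simp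
  then obtain n where n: "prob (A n) > 1 / 2" by (auto simp: eventually_sequentially)
  show ?thesis
  proof (intro exI[of _ "1 / real (n + 3)"] conjI)
    show "1 / real (n + 3) < 1 / 2" by (intro divide_strict_left_mono) auto
  qed (use n in \<open>auto simp: A_def\<close>)
qed

end

section \<open>Comparison of the eigenvalue counts\<close>

context self_similar begin

text \<open>Formulated for a general \<open>G\<close> so that it can be used twice: with the inverse
  of \<open>g\<close> for the deformed measure and with the identity for the original one.\<close>

lemma bilipschitz_count:
  fixes G :: "real \<Rightarrow> real" and N :: "real measure"
  assumes N: "atomless_unit_prob N" and L: "L > 0"
    and maps: "\<And>x. x \<in> {0..1} \<Longrightarrow> G x \<in> {0..1}"
    and up: "\<And>x y. x \<in> {0..1} \<Longrightarrow> y \<in> {0..1} \<Longrightarrow> \<bar>G x - G y\<bar> \<le> L * \<bar>x - y\<bar>"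
    and lo: "\<And>x y. x \<in> {0..1} \<Longrightarrow> y \<in> {0..1} \<Longrightarrow> \<bar>x - y\<bar> \<le> L * \<bar>G x - G y\<bar>"
    and push: "\<And>X. compact X \<Longrightarrow> X \<subseteq> {0..1} \<Longrightarrow> measure N (G ` X) = prob X"
  shows "\<exists>A B. 0 < A \<and> 0 < B \<and> (\<forall>l>0. of_nat (card (cut_set (A / l))) \<le> eigenvalue_count l N \<and>
    eigenvalue_count l N \<le> of_nat (card (cut_set (B / l))))"
proof -
  interpret N: atomless_unit_prob N by (rule N)
  obtain \<theta> where \<theta>: "0 < \<theta>" "\<theta> < 1 / 2" "prob {\<theta>..1 - \<theta>} \<ge> 1 / 2" using ex_central_mass by blast
  define h where "h w = (\<lambda>x. G (word_map w x))" for w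
  define a b \<alpha> \<beta> where "a w = min (h w 0) (h w 1)" and "b w = max (h w 0) (h w 1)"
    and "\<alpha> w = min (h w \<theta>) (h w (1 - \<theta>))" and "\<beta> w = max (h w \<theta>) (h w (1 - \<theta>))" for w
  have G_inj: "inj_on G {0..1}" using lo by (intro inj_onI) fastforce
  have hup: "\<bar>h w x - h w y\<bar> \<le> L * word_ratio w * \<bar>x - y\<bar>"
    and hlo: "word_ratio w * \<bar>x - y\<bar> \<le> L * \<bar>h w x - h w y\<bar>"
    if "w \<in> words" "x \<in> {0..1}" "y \<in> {0..1}" for w x y
    using up[of "word_map w x" "word_map w y"] lo[of "word_map w x" "word_map w y"]
      word_map_in[OF that(1)] word_map_dist[OF that] that by (auto simp: h_def mult.assoc)
  have himg: "h w ` X = G ` (word_map w ` X)" for w X by (simp add: h_def image_comp comp_def)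
  have hcont: "continuous_on {0..1} (h w)" if w: "w \<in> words" for w
  proof (rule lipschitz_on_continuous_on[of "L * word_ratio w"])
    show "(L * word_ratio w)-lipschitz_on {0..1} (h w)"
      using hup[OF w] L word_pos(1)[OF w] by (auto simp: lipschitz_on_def dist_real_def less_imp_le)
  qed
  have hinj: "inj_on (h w) {0..1}" if w: "w \<in> words" for w
  proof (rule inj_onI)
    fix x y assume "x \<in> {0..1}" "y \<in> {0..1}" "h w x = h w y"
    then have "word_ratio w * \<bar>x - y\<bar> \<le> 0" using hlo[OF w, of x y] by simp
    then show "x = y" using word_pos(1)[OF w] by (simp add: mult_le_0_iff)
  qed
  have ab: "h w ` {0..1} = {a w..b w}" "h w ` {0<..<1} = {a w<..<b w}"
    and \<alpha>\<beta>: "h w ` {\<theta>..1 - \<theta>} = {\<alpha> w..\<beta> w}" if w: "w \<in> words" for w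
    using continuous_inj_image_Icc[OF hcont[OF w] hinj[OF w], of 0 1]
      continuous_inj_image_Icc[OF hcont[OF w] hinj[OF w], of \<theta> "1 - \<theta>"] \<theta>
    by (auto simp: a_def b_def \<alpha>_def \<beta>_def)
  have h01: "h w x \<in> {0..1}" if "w \<in> words" "x \<in> {0..1}" for w x
    unfolding h_def using maps word_map_in that by blast
  have ab01: "0 \<le> a w" "b w \<le> 1" "a w \<le> b w" if "w \<in> words" for w
    using h01[OF that, of 0] h01[OF that, of 1] by (auto simp: a_def b_def min_def max_def)
  have len: "b w - a w = \<bar>h w 0 - h w 1\<bar>" for w by (auto simp: a_def b_def)
  have len_up: "b w - a w \<le> L * word_ratio w" and len_lo: "word_ratio w \<le> L * (b w - a w)" if "w \<in> words" for w
    using hup[OF that, of 0 1] hlo[OF that, of 0 1] unfolding len by auto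
  have mass: "measure N {a w..b w} = word_prob w" if w: "w \<in> words" for w
    using push[of "word_map w ` {0..1}"] prob_word_image[OF w, of "{0..1}"] compact_word_image[OF w, of "{0..1}"]
      word_map_image[OF w, of "{0..1}"] prob_space
    unfolding ab(1)[OF w, symmetric] himg by (simp add: space_unit)
  have mid: "measure N {\<alpha> w..\<beta> w} \<ge> word_prob w / 2" if w: "w \<in> words" for w
  proof -
    have "{\<theta>..1 - \<theta>} \<subseteq> {0..1}" using \<theta> by auto
    then have "measure N {\<alpha> w..\<beta> w} = word_prob w * prob {\<theta>..1 - \<theta>}"
      using push[of "word_map w ` {\<theta>..1 - \<theta>}"] prob_word_image[OF w, of "{\<theta>..1 - \<theta>}"]
        compact_word_image[OF w, of "{\<theta>..1 - \<theta>}"] word_map_image[OF w, of "{\<theta>..1 - \<theta>}"]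
      unfolding \<alpha>\<beta>[OF w, symmetric] himg by simp
    also have "\<dots> \<ge> word_prob w * (1 / 2)"
      using \<theta>(3) word_pos(2)[OF w] by (intro mult_left_mono) auto
    finally show ?thesis by simp
  qed
  have margin: "word_ratio w * \<theta> \<le> L * (\<alpha> w - a w) \<and> word_ratio w * \<theta> \<le> L * (b w - \<beta> w)" if w: "w \<in> words" for w
  proof -
    have in_ab: "h w x \<in> {a w..b w}" if "x \<in> {\<theta>, 1 - \<theta>}" for x
      using that \<theta> unfolding ab(1)[OF w, symmetric] by auto
    \<comment> \<open>Stated for all four pairs of a middle point and an end point, so it does not
      matter which of them become minimum or maximum, that is, whether \<open>h w\<close> reverses
      orientation.\<close>
    have sep: "word_ratio w * \<theta> \<le> L * \<bar>h w x - h w e\<bar>" if "x \<in> {\<theta>, 1 - \<theta>}" "e \<in> {0, 1}" for x e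
    proof -
      have "word_ratio w * \<theta> \<le> word_ratio w * \<bar>x - e\<bar>"
        using that \<theta> word_pos(1)[OF w] by (intro mult_left_mono) auto
      also have "\<dots> \<le> L * \<bar>h w x - h w e\<bar>" using that \<theta> by (intro hlo[OF w]) auto
      finally show ?thesis .
    qed
    obtain x e where "x \<in> {\<theta>, 1 - \<theta>}" "e \<in> {0, 1}" "\<alpha> w = h w x" "a w = h w e"
      unfolding \<alpha>_def a_def min_def by (metis insertCI)
    with sep[of x e] in_ab[of x] have "word_ratio w * \<theta> \<le> L * (\<alpha> w - a w)" by simp
    moreover obtain x e where "x \<in> {\<theta>, 1 - \<theta>}" "e \<in> {0, 1}" "\<beta> w = h w x" "b w = h w e"
      unfolding \<beta>_def b_def max_def by (metis insertCI)
    with sep[of x e] in_ab[of x] have "word_ratio w * \<theta> \<le> L * (b w - \<beta> w)" by simp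
    ultimately show ?thesis by blast
  qed
  have disj: "disjoint_family_on (\<lambda>w. {a w<..<b w}) (cut_set \<epsilon>)" if e: "\<epsilon> > 0" for \<epsilon>
    unfolding disjoint_family_on_def
  proof (intro ballI impI)
    fix w v assume wv: "w \<in> cut_set \<epsilon>" "v \<in> cut_set \<epsilon>" "w \<noteq> v"
    then have words: "w \<in> words" "v \<in> words" using cut_set_words by blast+
    have "word_map w ` {0<..<1} \<inter> word_map v ` {0<..<1} = {}"
      using cut_set_disjoint[OF e] wv unfolding disjoint_family_on_def by blast
    moreover have "word_map w ` {0<..<1} \<subseteq> {0..1}" "word_map v ` {0<..<1} \<subseteq> {0..1}"
      using word_map_image[OF words(1), of "{0<..<1}"] word_map_image[OF words(2), of "{0<..<1}"]
      by (simp_all add: subset_iff)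
    ultimately have "G ` (word_map w ` {0<..<1}) \<inter> G ` (word_map v ` {0<..<1}) = {}"
      using inj_on_image_Int[OF G_inj] by (metis image_empty)
    then show "{a w<..<b w} \<inter> {a v<..<b v} = {}"
      unfolding ab(2)[OF words(1), symmetric] ab(2)[OF words(2), symmetric] himg .
  qed
  \<comment> \<open>An image has length at most \<open>L * word_ratio w\<close>, while its margins
    are at least \<open>word_ratio w * \<theta> / L\<close>; the quotient is \<delta>.\<close>
  define \<delta> where "\<delta> = \<theta> / L\<^sup>2"
  \<comment> \<open>A cut cylinder has weight at least \<open>A / l * rmin\<close>. Its image loses
    at most a factor \<open>L\<close> in length, and its middle part holds at least half of the
    mass, so the quantity to be made larger than 2 is at least 5/2.\<close>
  define A where "A = 5 * L / (\<delta>\<^sup>2 * rmin)"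
  have \<delta>: "\<delta> > 0" using \<theta> L by (simp add: \<delta>_def)
  have A: "A > 0" using \<delta> L rmin(2) by (simp add: A_def)
  have lower: "of_nat (card (cut_set (A / l))) \<le> eigenvalue_count l N" if l: "l > 0" for l
  proof (cases "A / l \<ge> 1")
    case True
    have "of_nat (card {0::real}) \<le> eigenvalue_count l N"
      using N.neumann_eigenvalue_0 l by (intro N.eigenvalue_count_ge_card) auto
    then show ?thesis using True by (simp add: cut_set_ge_1)
  next
    case False
    have e: "0 < A / l" "A / l < 1" using False A l by auto
    show ?thesis
    proof (rule N.eigenvalue_count_ge_intervals[where a = a and b = b and \<alpha> = \<alpha> and \<beta> = \<beta> and \<delta> = \<delta>])
      fix w assume w: "w \<in> cut_set (A / l)"
      then have wW: "w \<in> words" using cut_set_words by blast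
      have "\<delta> * (b w - a w) \<le> \<delta> * (L * word_ratio w)"
        using len_up[OF wW] \<delta> by (intro mult_left_mono) auto
      also have "\<dots> = (word_ratio w * \<theta>) / L" using L by (simp add: \<delta>_def power2_eq_square)
      finally have d: "\<delta> * (b w - a w) \<le> (word_ratio w * \<theta>) / L" .
      have "(word_ratio w * \<theta>) / L \<le> \<alpha> w - a w" "(word_ratio w * \<theta>) / L \<le> b w - \<beta> w"
        using margin[OF wW] L by (simp_all add: pos_divide_le_eq mult.commute)
      with d show "\<delta> * (b w - a w) \<le> \<alpha> w - a w \<and> \<delta> * (b w - a w) \<le> b w - \<beta> w" by simp
      have "0 < (word_ratio w * \<theta>) / L" using word_pos(1)[OF wW] \<theta> L by simp
      with \<open>(word_ratio w * \<theta>) / L \<le> \<alpha> w - a w\<close> \<open>(word_ratio w * \<theta>) / L \<le> b w - \<beta> w\<close>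
      have "a w < \<alpha> w" "\<beta> w < b w" by linarith+
      moreover have "\<alpha> w \<le> \<beta> w" by (simp add: \<alpha>_def \<beta>_def)
      ultimately show "0 \<le> a w \<and> a w < \<alpha> w \<and> \<alpha> w \<le> \<beta> w \<and> \<beta> w < b w \<and> b w \<le> 1"
        using ab01[OF wW] by simp
      have "2 < l * \<delta>\<^sup>2 * ((A / l * rmin) / (2 * L))"
        using l \<delta> rmin(2) L by (simp add: A_def)
      also have "\<dots> \<le> l * \<delta>\<^sup>2 * (weight w / (2 * L))"
        using weight_cut_set_ge[OF w e] l L by (intro mult_left_mono divide_right_mono) auto
      also have "\<dots> = l * \<delta>\<^sup>2 * ((word_ratio w / L) * (word_prob w / 2))"
        by (simp add: weight_eq)
      also have "\<dots> \<le> l * \<delta>\<^sup>2 * ((b w - a w) * measure N {\<alpha> w..\<beta> w})"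
        using len_lo[OF wW] mid[OF wW] L l word_pos[OF wW] ab01(3)[OF wW]
        by (intro mult_left_mono mult_mono) (auto simp: pos_divide_le_eq mult.commute)
      finally show "2 < l * \<delta>\<^sup>2 * (b w - a w) * measure N {\<alpha> w..\<beta> w}" by (simp add: mult.assoc)
    qed (use l \<delta> finite_cut_set[OF e(1)] disj[OF e(1)] in auto)
  qed
  \<comment> \<open>With weights at most \<open>(1 / L) / l\<close>, and image lengths at most
    \<open>L\<close> times the original ones, \<open>l\<close> times length times mass is at most
    1.\<close>
  have upper: "eigenvalue_count l N \<le> of_nat (card (cut_set ((1 / L) / l)))" if l: "l > 0" for l
  proof -
    define \<epsilon> where "\<epsilon> = (1 / L) / l"
    have e: "\<epsilon> > 0" using L l by (simp add: \<epsilon>_def)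
    show ?thesis unfolding \<epsilon>_def[symmetric]
    proof (rule N.eigenvalue_count_le_card[where a = a and b = b])
      let ?U = "\<Union>w\<in>cut_set \<epsilon>. word_map w ` {0..1}"
      have "(\<Union>w\<in>cut_set \<epsilon>. {a w..b w}) = (\<Union>w\<in>cut_set \<epsilon>. G ` (word_map w ` {0..1}))"
        using ab(1)[OF subsetD[OF cut_set_words]] himg by (intro SUP_cong refl) simp
      also have "\<dots> = G ` ?U" by (simp add: image_UN)
      finally have "measure N (\<Union>w\<in>cut_set \<epsilon>. {a w..b w}) = measure N (G ` ?U)" by simp
      also have "\<dots> = prob ?U"
      proof (rule push)
        show "compact ?U" using compact_word_image[of _ "{0..1}"] subsetD[OF cut_set_words]
          by (intro compact_UN finite_cut_set e) auto
        show "?U \<subseteq> {0..1}" by (intro UN_least word_map_image subsetD[OF cut_set_words] order_refl)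
      qed
      finally show "measure N (\<Union>w\<in>cut_set \<epsilon>. {a w..b w}) = 1" using cut_set_cover[OF e] by simp
      fix w assume w: "w \<in> cut_set \<epsilon>"
      then have wW: "w \<in> words" using cut_set_words by blast
      show "0 \<le> a w \<and> a w \<le> b w \<and> b w \<le> 1" using ab01[OF wW] by simp
      have "l * (b w - a w) * measure N {a w..b w} \<le> l * (L * word_ratio w) * word_prob w"
        unfolding mass[OF wW] using len_up[OF wW] l word_pos(2)[OF wW]
        by (intro mult_right_mono mult_left_mono) auto
      also have "\<dots> = l * L * weight w" by (simp add: weight_eq)
      also have "\<dots> \<le> l * L * \<epsilon>" using weight_cut_set_le[OF w] l L by (intro mult_left_mono) auto
      also have "\<dots> = 1" using l L by (simp add: \<epsilon>_def)
      finally show "l * (b w - a w) * measure N {a w..b w} \<le> 1" .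
    qed (use l finite_cut_set[OF e] disj[OF e] in auto)
  qed
  show ?thesis using A L lower upper
    by (intro exI[of _ A] exI[of _ "1 / L"]) auto
qed

text \<open>The thresholds \<open>A / l\<close> and \<open>B / l\<close> differ by the factor
  \<open>B / A\<close>, which does not depend on \<open>l\<close>, so
  \<open>card_cut_set_doubling\<close> provides a single constant.\<close>

lemma eigenvalue_count_le_mult:
  assumes "atomless_unit_prob N" "atomless_unit_prob N'" "0 < A" "0 < B"
    and lower: "\<And>l. l > 0 \<Longrightarrow> of_nat (card (cut_set (A / l))) \<le> eigenvalue_count l N"
    and upper: "\<And>l. l > 0 \<Longrightarrow> eigenvalue_count l N' \<le> of_nat (card (cut_set (B / l)))"
  shows "\<exists>K::nat. K > 0 \<and> (\<forall>l\<ge>0. eigenvalue_count l N' \<le> of_nat K * eigenvalue_count l N)"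
proof -
  obtain K :: nat where K: "K > 0" "\<And>\<epsilon>. \<epsilon> > 0 \<Longrightarrow> card (cut_set (\<epsilon> * (B / A))) \<le> K * card (cut_set \<epsilon>)"
    using card_cut_set_doubling[of "B / A"] assms(3,4) by (metis divide_pos_pos)
  have "eigenvalue_count l N' \<le> of_nat K * eigenvalue_count l N" if "l \<ge> 0" for l
  proof (cases "l = 0")
    case True
    interpret N': atomless_unit_prob N' by fact
    show ?thesis using N'.eigenvalue_count_0 by (simp add: True)
  next
    case False
    then have l: "l > 0" using that by simp
    have "A / l * (B / A) = B / l" using assms(3) by simp
    then have "card (cut_set (B / l)) \<le> K * card (cut_set (A / l))"
      using K(2)[of "A / l"] assms(3) l by simp
    then have "(of_nat (card (cut_set (B / l))) :: ennreal) \<le> of_nat (K * card (cut_set (A / l)))"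
      by (simp only: of_nat_le_iff)
    then have "eigenvalue_count l N' \<le> of_nat K * of_nat (card (cut_set (A / l)))"
      using order_trans[OF upper[OF l]] by simp
    also have "\<dots> \<le> of_nat K * eigenvalue_count l N" using lower[OF l] by (intro mult_left_mono) auto
    finally show ?thesis .
  qed
  with K(1) show ?thesis by blast
qed

end

lemma W1inf_diffeo_bilipschitz:
  assumes "W1inf_diffeo g"
  defines "G \<equiv> inv_into {0..1} g"
  obtains L where "L > 0" "\<And>x y. x \<in> {0..1} \<Longrightarrow> y \<in> {0..1} \<Longrightarrow> \<bar>G x - G y\<bar> \<le> L * \<bar>x - y\<bar>"
    "\<And>x y. x \<in> {0..1} \<Longrightarrow> y \<in> {0..1} \<Longrightarrow> \<bar>x - y\<bar> \<le> L * \<bar>G x - G y\<bar>"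
proof -
  have bij: "bij_betw g {0..1} {0..1}" using assms(1) by (simp add: W1inf_diffeo_def)
  obtain C D where C: "C-lipschitz_on {0..1} g" and D: "D-lipschitz_on {0..1} G"
    using assms unfolding W1inf_diffeo_def by blast
  have G: "G x \<in> {0..1}" "g (G x) = x" if "x \<in> {0..1}" for x
    using bij_betw_apply[OF bij_betw_inv_into[OF bij] that] bij_betw_inv_into_right[OF bij that]
    unfolding G_def by auto
  show thesis
  proof
    \<comment> \<open>A common constant for \<open>g\<close> and its inverse; the 1 makes it
      positive without examining \<open>C\<close> and \<open>D\<close>.\<close>
    show "max 1 (max C D) > 0" by simp
    fix x y :: real assume xy: "x \<in> {0..1}" "y \<in> {0..1}"
    have "\<bar>G x - G y\<bar> \<le> D * \<bar>x - y\<bar>" using lipschitz_onD[OF D xy] by (simp add: dist_real_def)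
    also have "\<dots> \<le> max 1 (max C D) * \<bar>x - y\<bar>" by (intro mult_right_mono) auto
    finally show "\<bar>G x - G y\<bar> \<le> max 1 (max C D) * \<bar>x - y\<bar>" .
    have "\<bar>x - y\<bar> \<le> C * \<bar>G x - G y\<bar>"
      using lipschitz_onD[OF C G(1)[OF xy(1)] G(1)[OF xy(2)]] G(2) xy by (simp add: dist_real_def)
    also have "\<dots> \<le> max 1 (max C D) * \<bar>G x - G y\<bar>" by (intro mult_right_mono) auto
    finally show "\<bar>x - y\<bar> \<le> max 1 (max C D) * \<bar>G x - G y\<bar>" .
  qed
qed

lemma atomless_deformed_measure:
  assumes "atomless_unit_prob M" and g: "W1inf_diffeo g"
  shows "atomless_unit_prob (deformed_measure M g)"
proof -
  interpret atomless_unit_prob M by fact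
  have bij: "bij_betw g {0..1} {0..1}" using g by (simp add: W1inf_diffeo_def)
  have sp: "space unit_borel = {0..1::real}" by (simp add: space_restrict_space)
  have sub: "sets unit_borel \<subseteq> Pow {0..1}" using sets.space_closed[of unit_borel] unfolding sp .
  have sets: "sets (deformed_measure M g) = sets unit_borel"
    unfolding deformed_measure_def using sub sets.sigma_sets_eq[of unit_borel] by (simp add: sp)
  have space: "space (deformed_measure M g) = {0..1}"
    unfolding deformed_measure_def using sub by (simp add: space_measure_of)
  note em = emeasure_deformed_measure[OF g sets_unit]
  interpret D: prob_space "deformed_measure M g"
  proof (rule prob_spaceI)
    have "{0..1} \<in> sets unit_borel" using sets.top[of unit_borel] unfolding sp .
    from em[OF this] show "emeasure (deformed_measure M g) (space (deformed_measure M g)) = 1"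
      using bij emeasure_space_1 by (simp add: space bij_betw_def space_unit)
  qed
  show ?thesis
  proof unfold_locales
    show "sets (deformed_measure M g) = sets unit_borel" by (rule sets)
    show "measure (deformed_measure M g) {x} = 0" for x
    proof (cases "{x} \<in> sets unit_borel")
      case True
      from em[OF this] atomless[of "g x"] show ?thesis by (simp add: measure_def)
    next
      case False
      then show ?thesis by (intro measure_notin_sets) (simp add: sets)
    qed
  qed
qed

theorem theorem1:
  fixes m :: nat and S :: "nat \<Rightarrow> real \<Rightarrow> real" and \<rho> :: "nat \<Rightarrow> real"
    and \<mu>0 \<mu> :: "real measure" and g :: "real \<Rightarrow> real"
  assumes "similarity_system m S \<rho>"
    and "self_similar_measure m S \<rho> \<mu>0"
    and "W1inf_diffeo g"
    and "\<mu> = deformed_measure \<mu>0 g"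
  shows "\<exists>C1 C2 :: real. C1 > 0 \<and> C2 > 0 \<and>
    (\<forall>l :: real. l \<ge> 0 \<longrightarrow>
       ennreal C1 * eigenvalue_count l \<mu>0 \<le> eigenvalue_count l \<mu> \<and>
       eigenvalue_count l \<mu> \<le> ennreal C2 * eigenvalue_count l \<mu>0)"
proof -
  interpret prob_space \<mu>0 using assms(2) by (simp add: self_similar_measure_def)
  interpret self_similar m S \<rho> \<mu>0
    using assms(1,2) by unfold_locales (auto simp: self_similar_measure_def)
  let ?G = "inv_into {0..1} g"
  have \<mu>0: "atomless_unit_prob \<mu>0" ..
  have \<mu>: "atomless_unit_prob \<mu>" unfolding assms(4) using \<mu>0 assms(3) by (rule atomless_deformed_measure)
  have bij: "bij_betw g {0..1} {0..1}" using assms(3) by (simp add: W1inf_diffeo_def)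
  have maps: "?G x \<in> {0..1}" if "x \<in> {0..1}" for x
    using bij_betw_apply[OF bij_betw_inv_into[OF bij] that] .
  obtain L where L: "L > 0" "\<And>x y. x \<in> {0..1} \<Longrightarrow> y \<in> {0..1} \<Longrightarrow> \<bar>?G x - ?G y\<bar> \<le> L * \<bar>x - y\<bar>"
    "\<And>x y. x \<in> {0..1} \<Longrightarrow> y \<in> {0..1} \<Longrightarrow> \<bar>x - y\<bar> \<le> L * \<bar>?G x - ?G y\<bar>"
    using W1inf_diffeo_bilipschitz[OF assms(3)] by blast
  \<comment> \<open>The deformed measure assigns to a set the original mass of its
    \<open>g\<close>-image, and \<open>g\<close> undoes \<open>?G\<close>, so masses are preserved
    exactly.\<close>
  have push: "measure \<mu> (?G ` X) = prob X" if X: "compact X" "X \<subseteq> {0..1}" for X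
  proof -
    have "continuous_on {0..1} ?G"
      using assms(3) lipschitz_on_continuous_on unfolding W1inf_diffeo_def by blast
    then have "compact (?G ` X)" using X by (metis compact_continuous_image continuous_on_subset)
    moreover have "?G ` X \<subseteq> {0..1}" using maps X(2) by blast
    ultimately have "?G ` X \<in> sets \<mu>0" by (rule compact_in_sets)
    moreover have "g ` ?G ` X = X"
      using bij_betw_inv_into_right[OF bij] X(2) by (force simp: image_comp)
    ultimately show ?thesis
      using emeasure_deformed_measure[OF assms(3) sets_unit, of "?G ` X"]
      by (simp add: assms(4) sets_unit measure_def)
  qed
  obtain A B where AB: "0 < A" "0 < B"
    "\<And>l. l > 0 \<Longrightarrow> of_nat (card (cut_set (A / l))) \<le> eigenvalue_count l \<mu>"
    "\<And>l. l > 0 \<Longrightarrow> eigenvalue_count l \<mu> \<le> of_nat (card (cut_set (B / l)))"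
    using bilipschitz_count[OF \<mu> L(1) maps L(2,3) push] by blast
  obtain A0 B0 where AB0: "0 < A0" "0 < B0"
    "\<And>l. l > 0 \<Longrightarrow> of_nat (card (cut_set (A0 / l))) \<le> eigenvalue_count l \<mu>0"
    "\<And>l. l > 0 \<Longrightarrow> eigenvalue_count l \<mu>0 \<le> of_nat (card (cut_set (B0 / l)))"
    using bilipschitz_count[OF \<mu>0, of 1 "\<lambda>x. x"] by auto
  obtain K :: nat where K: "K > 0" "\<And>l. l \<ge> 0 \<Longrightarrow> eigenvalue_count l \<mu> \<le> of_nat K * eigenvalue_count l \<mu>0"
    using eigenvalue_count_le_mult[OF \<mu>0 \<mu> AB0(1) AB(2) AB0(3) AB(4)] by blast
  obtain K' :: nat where K': "K' > 0" "\<And>l. l \<ge> 0 \<Longrightarrow> eigenvalue_count l \<mu>0 \<le> of_nat K' * eigenvalue_count l \<mu>"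
    using eigenvalue_count_le_mult[OF \<mu> \<mu>0 AB(1) AB0(2) AB(3) AB0(4)] by blast
  show ?thesis
  \<comment> \<open>\<open>K\<close> comes from comparing \<open>\<mu>\<close> with
    \<open>\<mu>0\<close>; the comparison with the roles exchanged gives \<open>K'\<close>, whose
    reciprocal is the lower constant.\<close>
  proof (rule exI[of _ "1 / real K'"], rule exI[of _ "real K"], intro conjI allI impI)
    fix l :: real assume l: "l \<ge> 0"
    have "ennreal (1 / real K') * eigenvalue_count l \<mu>0 \<le> ennreal (1 / real K') * (ennreal (real K') * eigenvalue_count l \<mu>)"
      using K'(2)[OF l] by (intro mult_left_mono) (auto simp: ennreal_of_nat_eq_real_of_nat)
    also have "\<dots> = ennreal (1 / real K' * real K') * eigenvalue_count l \<mu>"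
      by (subst ennreal_mult) (auto simp: mult.assoc)
    also have "\<dots> = eigenvalue_count l \<mu>" using K'(1) by simp
    finally show "ennreal (1 / real K') * eigenvalue_count l \<mu>0 \<le> eigenvalue_count l \<mu>" .
    show "eigenvalue_count l \<mu> \<le> ennreal (real K) * eigenvalue_count l \<mu>0"
      using K(2)[OF l] by (simp add: ennreal_of_nat_eq_real_of_nat)
  qed (use K K' in auto)
qed

end
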